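(* Let $(M^n,g)$ be a complete Riemannian manifold isometrically immersed into a semi-Riemannian manifold $(\overline{M}^{n+1}_c,\overline{g})$ of constant sectional curvature $c$. Let $\overline{V}$ be a conformal vector field on $\overline{M}^{n+1}_c$ with conformal factor $\sigma$ whose tangent component defines a Ricci almost soliton structure on $M^n$, and let $\lambda$ be the soliton function. Suppose that $\psi=\sigma|_{M^n}-\lambda$ is non-zero in some dense subset of $M^n$ and that $Ric=\mu\mathcal{A}$ for some smooth function $\mu$ on $M^n$. Then the angle function $C=\overline{g}(\overline{V},N)$ is a special scalar concircular field on $(M^n,g)$.
   Context: Conventions. $\overline{\nabla}$ is the Levi-Civita connection of $\overline{g}$; $N$ is a field of unit normal vectors along $M^n$ and $\epsilon_N=\overline{g}(N,N)=\pm1$. The Weingarten operator $\mathcal{A}$ is given by $\overline{\nabla}_XN=-\mathcal{A}X$; it is identified with the symmetric $(0,2)$-tensor $\mathcal{A}(X,Y)=g(\mathcal{A}X,Y)$, and $Ric$ is the Ricci tensor of $(M^n,g)$ (so that $Ric=(n-1)g$ on the unit sphere). A vector field $\overline{V}$ is conformal with conformal factor $\sigma\in C^\infty(\overline{M}^{n+1}_c)$ if $\mathcal{L}_{\overline{V}}\overline{g}=2\sigma\overline{g}$. Its tangent component $V$ along $M^n$ is defined by $\overline{V}=V+\epsilon_NCN$ with $V$ tangent to $M^n$, where $C=\overline{g}(\overline{V},N)$. A vector field $X$ on $(M^n,g)$ defines a Ricci almost soliton structure with soliton function $\lambda:M^n\to\mathbb{R}$ if $Ric+\frac12\mathcal{L}_Xg=\lambda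 g$. Throughout, Ricci almost solitons are assumed to be proper, i.e. $\lambda$ is non-constant. A function $\rho\in C^\infty(M^n)$ is a special scalar concircular field on $(M^n,g)$ if $\mathrm{Hess}\,\rho=(-k\rho+b)g$ for some real constants $k,b$.
   Formalization: The formal statement takes M connected and n ≥ 2; for n = 1 the claim is false, e.g. the parabola y = x²/2 in the Euclidean plane with a vertical translation field, where Ric = 0, μ = 0 and C'' = 3C⁵ − 4C⁷. *)

theory Defs
  imports "HOL-Analysis.Analysis"
begin

section \<open>Smooth functions on open subsets of Euclidean spaces\<close>

primrec Ck_on :: "nat \<Rightarrow> 'a::real_normed_vector set \<Rightarrow> ('a \<Rightarrow> 'b::real_normed_vector) \<Rightarrow> bool" where
  "Ck_on 0 S f \<longleftrightarrow> continuous_on S f"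
| "Ck_on (Suc n) S f \<longleftrightarrow> (\<forall>u\<in>S. f differentiable (at u)) \<and>
     (\<forall>v. Ck_on n S (\<lambda>u. frechet_derivative f (at u) v))"

definition smooth_on :: "'a::real_normed_vector set \<Rightarrow> ('a \<Rightarrow> 'b::real_normed_vector) \<Rightarrow> bool" where
  "smooth_on S f \<longleftrightarrow> (\<forall>n. Ck_on n S f)"


section \<open>Smooth manifolds\<close>

text \<open>
  A smooth manifold is a type \<open>'m\<close> of class \<open>t2_space\<close> and \<open>second_countable_topology\<close> (all of
  \<open>UNIV :: 'm set\<close> being the underlying space) together with a smooth atlas \<open>A\<close> of charts with
  values in \<open>real ^ 'n\<close>; its dimension is \<open>CARD('n)\<close>. The atlas need not be maximal: smoothness
  and tensor fields for \<open>A\<close> are the same data as for the maximal atlas generated by \<open>A\<close>.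
\<close>

datatype ('m, 'n) chart = Chart (cdom: "'m set") (cmap: "'m \<Rightarrow> real ^ 'n")

definition cinv :: "('m, 'n::finite) chart \<Rightarrow> real ^ 'n \<Rightarrow> 'm" where
  "cinv x = inv_into (cdom x) (cmap x)"

definition is_chart :: "('m::topological_space, 'n::finite) chart \<Rightarrow> bool" where
  "is_chart x \<longleftrightarrow> open (cdom x) \<and> open (cmap x ` cdom x) \<and>
     homeomorphism (cdom x) (cmap x ` cdom x) (cmap x) (cinv x)"

definition smooth_atlas :: "('m::topological_space, 'n::finite) chart set \<Rightarrow> bool" where
  "smooth_atlas A \<longleftrightarrow> (\<forall>x\<in>A. is_chart x) \<and> (\<Union>x\<in>A. cdom x) = UNIV \<and>
     (\<forall>x\<in>A. \<forall>y\<in>A. smooth_on (cmap x ` (cdom x \<inter> cdom y)) (cmap y \<circ> cinv x))"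

text \<open>
  \<open>cderiv x f p v\<close> is the derivative at \<open>p\<close> of \<open>f\<close>, read in the chart \<open>x\<close>, in the direction of the
  vector with components \<open>v\<close>. In particular \<open>cderiv x (cmap y) p\<close> is the Jacobian of the
  coordinate change from \<open>x\<close> to \<open>y\<close>, and \<open>cderiv x (cmap y \<circ> F) p\<close> is the differential of a map
  \<open>F\<close> with respect to the charts \<open>x\<close> and \<open>y\<close>.
\<close>

definition cderiv ::
  "('m, 'n::finite) chart \<Rightarrow> ('m \<Rightarrow> 'b::real_normed_vector) \<Rightarrow> 'm \<Rightarrow> real ^ 'n \<Rightarrow> 'b" where
  "cderiv x f p v = frechet_derivative (f \<circ> cinv x) (at (cmap x p)) v"

definition pd ::
  "('m, 'n::finite) chart \<Rightarrow> 'n \<Rightarrow> ('m \<Rightarrow> 'b::real_normed_vector) \<Rightarrow> 'm \<Rightarrow> 'b" where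
  "pd x i f p = cderiv x f p (axis i 1)"

definition smooth_in ::
  "('m, 'n::finite) chart \<Rightarrow> 'm set \<Rightarrow> ('m \<Rightarrow> 'b::real_normed_vector) \<Rightarrow> bool" where
  "smooth_in x U f \<longleftrightarrow> smooth_on (cmap x ` (cdom x \<inter> U)) (f \<circ> cinv x)"

definition smooth_fun :: "('m, 'n::finite) chart set \<Rightarrow> ('m \<Rightarrow> real) \<Rightarrow> bool" where
  "smooth_fun A f \<longleftrightarrow> (\<forall>x\<in>A. smooth_in x UNIV f)"

definition smooth_map ::
  "('m::topological_space, 'n::finite) chart set \<Rightarrow> ('q::topological_space, 'k::finite) chart set \<Rightarrow>
   ('m \<Rightarrow> 'q) \<Rightarrow> bool" where
  "smooth_map A B F \<longleftrightarrow> continuous_on UNIV F \<and>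
     (\<forall>x\<in>A. \<forall>y\<in>B. smooth_in x (F -` cdom y) (cmap y \<circ> F))"


section \<open>Tensor fields\<close>

text \<open>
  A tensor field is given by its components in each chart of the atlas, subject to the usual
  transformation law: \<open>X x p $ i\<close> are the components of a vector field and \<open>g x p $ i $ j\<close> those of
  a \<open>(0,2)\<close>-tensor field at the point \<open>p\<close> in the chart \<open>x\<close>. A \<open>(1,1)\<close>-tensor field is given by the
  matrices \<open>S x p\<close> acting on components by \<open>*v\<close>. Only the values for \<open>x\<close> in the atlas
  and \<open>p \<in> cdom x\<close> matter.
\<close>

type_synonym ('m, 'n) vfield = "('m, 'n) chart \<Rightarrow> 'm \<Rightarrow> real ^ 'n"
type_synonym ('m, 'n) tensor2 = "('m, 'n) chart \<Rightarrow> 'm \<Rightarrow> real ^ 'n ^ 'n"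

definition vector_field :: "('m, 'n::finite) chart set \<Rightarrow> ('m, 'n) vfield \<Rightarrow> bool" where
  "vector_field A X \<longleftrightarrow> (\<forall>x\<in>A. smooth_in x UNIV (X x)) \<and>
     (\<forall>x\<in>A. \<forall>y\<in>A. \<forall>p\<in>cdom x \<inter> cdom y. X y p = cderiv x (cmap y) p (X x p))"

definition ip ::
  "('m, 'n::finite) tensor2 \<Rightarrow> ('m, 'n) chart \<Rightarrow> 'm \<Rightarrow> real ^ 'n \<Rightarrow> real ^ 'n \<Rightarrow> real" where
  "ip g x p v w = (\<Sum>i\<in>UNIV. \<Sum>j\<in>UNIV. g x p $ i $ j * v $ i * w $ j)"

definition tensor2_field :: "('m, 'n::finite) chart set \<Rightarrow> ('m, 'n) tensor2 \<Rightarrow> bool" where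
  "tensor2_field A g \<longleftrightarrow> (\<forall>x\<in>A. smooth_in x UNIV (g x)) \<and>
     (\<forall>x\<in>A. \<forall>y\<in>A. \<forall>p\<in>cdom x \<inter> cdom y. \<forall>v w.
        ip g x p v w = ip g y p (cderiv x (cmap y) p v) (cderiv x (cmap y) p w))"

definition symmetric_tensor2 :: "('m, 'n::finite) chart set \<Rightarrow> ('m, 'n) tensor2 \<Rightarrow> bool" where
  "symmetric_tensor2 A g \<longleftrightarrow> (\<forall>x\<in>A. \<forall>p\<in>cdom x. \<forall>i j. g x p $ i $ j = g x p $ j $ i)"


section \<open>Riemannian and semi-Riemannian metrics\<close>

definition riemannian_metric :: "('m, 'n::finite) chart set \<Rightarrow> ('m, 'n) tensor2 \<Rightarrow> bool" where
  "riemannian_metric A g \<longleftrightarrow> tensor2_field A g \<and> symmetric_tensor2 A g \<and>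
     (\<forall>x\<in>A. \<forall>p\<in>cdom x. \<forall>v. v \<noteq> 0 \<longrightarrow> ip g x p v v > 0)"

definition metric_index ::
  "('m, 'n::finite) tensor2 \<Rightarrow> ('m, 'n) chart \<Rightarrow> 'm \<Rightarrow> nat" where
  "metric_index g x p = Max {dim W |W. subspace W \<and> (\<forall>v\<in>W. v \<noteq> 0 \<longrightarrow> ip g x p v v < 0)}"

definition semi_riemannian_metric :: "('m, 'n::finite) chart set \<Rightarrow> ('m, 'n) tensor2 \<Rightarrow> bool" where
  "semi_riemannian_metric A g \<longleftrightarrow> tensor2_field A g \<and> symmetric_tensor2 A g \<and>
     (\<forall>x\<in>A. \<forall>p\<in>cdom x. \<forall>v. (\<forall>w. ip g x p v w = 0) \<longrightarrow> v = 0) \<and>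
     (\<exists>\<nu>. \<forall>x\<in>A. \<forall>p\<in>cdom x. metric_index g x p = \<nu>)"


section \<open>Levi-Civita connection and curvature\<close>

text \<open>\<open>christoffel g x p k i j\<close> is \<open>\<Gamma>\<^sup>k\<^sub>i\<^sub>j\<close>, that is, \<open>\<nabla>\<^bsub>\<partial>i\<^esub> \<partial>j = \<Sum>k. \<Gamma>\<^sup>k\<^sub>i\<^sub>j \<partial>k\<close>.\<close>

definition christoffel ::
  "('m, 'n::finite) tensor2 \<Rightarrow> ('m, 'n) chart \<Rightarrow> 'm \<Rightarrow> 'n \<Rightarrow> 'n \<Rightarrow> 'n \<Rightarrow> real" where
  "christoffel g x p k i j = 1 / 2 * (\<Sum>l\<in>UNIV. matrix_inv (g x p) $ k $ l *
     (pd x i (\<lambda>q. g x q $ j $ l) p + pd x j (\<lambda>q. g x q $ i $ l) p - pd x l (\<lambda>q. g x q $ i $ j) p))"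

definition christoffel_form ::
  "('m, 'n::finite) tensor2 \<Rightarrow> ('m, 'n) chart \<Rightarrow> 'm \<Rightarrow> real ^ 'n \<Rightarrow> real ^ 'n \<Rightarrow> real ^ 'n" where
  "christoffel_form g x p v w =
     (\<chi> k. \<Sum>i\<in>UNIV. \<Sum>j\<in>UNIV. christoffel g x p k i j * v $ i * w $ j)"

text \<open>
  \<open>riemann g x p l k i j\<close> is \<open>R\<^sup>l\<^sub>k\<^sub>i\<^sub>j\<close>, where \<open>R(\<partial>i,\<partial>j)\<partial>k = \<Sum>l. R\<^sup>l\<^sub>k\<^sub>i\<^sub>j \<partial>l\<close> and
  \<open>R(X,Y)Z = \<nabla>\<^sub>X \<nabla>\<^sub>Y Z - \<nabla>\<^sub>Y \<nabla>\<^sub>X Z - \<nabla>\<^bsub>[X,Y]\<^esub> Z\<close>; the Ricci tensor is \<open>Ric(Y,Z) = trace (X \<mapsto> R(X,Y)Z)\<close>,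
  so both are positive on the unit sphere.
\<close>

definition riemann ::
  "('m, 'n::finite) tensor2 \<Rightarrow> ('m, 'n) chart \<Rightarrow> 'm \<Rightarrow> 'n \<Rightarrow> 'n \<Rightarrow> 'n \<Rightarrow> 'n \<Rightarrow> real" where
  "riemann g x p l k i j =
     pd x i (\<lambda>q. christoffel g x q l j k) p - pd x j (\<lambda>q. christoffel g x q l i k) p +
     (\<Sum>m\<in>UNIV. christoffel g x p l i m * christoffel g x p m j k -
                christoffel g x p l j m * christoffel g x p m i k)"

definition curvature ::
  "('m, 'n::finite) tensor2 \<Rightarrow> ('m, 'n) chart \<Rightarrow> 'm \<Rightarrow> real ^ 'n \<Rightarrow> real ^ 'n \<Rightarrow> real ^ 'n \<Rightarrow> real ^ 'n"
  where
  "curvature g x p u v w = (\<chi> l. \<Sum>i\<in>UNIV. \<Sum>j\<in>UNIV. \<Sum>k\<in>UNIV.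
     riemann g x p l k i j * u $ i * v $ j * w $ k)"

definition ricci :: "('m, 'n::finite) tensor2 \<Rightarrow> ('m, 'n) tensor2" where
  "ricci g x p = (\<chi> j k. \<Sum>i\<in>UNIV. riemann g x p i k i j)"

definition area2 ::
  "('m, 'n::finite) tensor2 \<Rightarrow> ('m, 'n) chart \<Rightarrow> 'm \<Rightarrow> real ^ 'n \<Rightarrow> real ^ 'n \<Rightarrow> real" where
  "area2 g x p v w = ip g x p v v * ip g x p w w - (ip g x p v w)\<^sup>2"

definition sectional_curvature ::
  "('m, 'n::finite) tensor2 \<Rightarrow> ('m, 'n) chart \<Rightarrow> 'm \<Rightarrow> real ^ 'n \<Rightarrow> real ^ 'n \<Rightarrow> real" where
  "sectional_curvature g x p v w = ip g x p (curvature g x p v w w) v / area2 g x p v w"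

text \<open>The vectors \<open>v, w\<close> span a nondegenerate plane iff \<open>area2 g x p v w \<noteq> 0\<close>.\<close>

definition constant_sectional_curvature ::
  "('m, 'n::finite) chart set \<Rightarrow> ('m, 'n) tensor2 \<Rightarrow> real \<Rightarrow> bool" where
  "constant_sectional_curvature A g c \<longleftrightarrow>
     (\<forall>x\<in>A. \<forall>p\<in>cdom x. \<forall>v w. area2 g x p v w \<noteq> 0 \<longrightarrow> sectional_curvature g x p v w = c)"

definition hessian ::
  "('m, 'n::finite) tensor2 \<Rightarrow> ('m \<Rightarrow> real) \<Rightarrow> ('m, 'n) tensor2" where
  "hessian g f x p = (\<chi> i j. pd x i (pd x j f) p - (\<Sum>k\<in>UNIV. christoffel g x p k i j * pd x k f p))"

definition lie_derivative ::
  "('m, 'n::finite) vfield \<Rightarrow> ('m, 'n) tensor2 \<Rightarrow> ('m, 'n) tensor2" where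
  "lie_derivative X g x p = (\<chi> i j. \<Sum>k\<in>UNIV.
     X x p $ k * pd x k (\<lambda>q. g x q $ i $ j) p +
     g x p $ k $ j * pd x i (\<lambda>q. X x q $ k) p +
     g x p $ i $ k * pd x j (\<lambda>q. X x q $ k) p)"

definition geodesic ::
  "('m::topological_space, 'n::finite) chart set \<Rightarrow> ('m, 'n) tensor2 \<Rightarrow> (real \<Rightarrow> 'm) \<Rightarrow> bool" where
  "geodesic A g \<gamma> \<longleftrightarrow> continuous_on UNIV \<gamma> \<and>
     (\<forall>x\<in>A. \<forall>t. \<gamma> t \<in> cdom x \<longrightarrow>
        (let v = (\<lambda>s. vector_derivative (cmap x \<circ> \<gamma>) (at s)) in
           (cmap x \<circ> \<gamma>) differentiable (at t) \<and>
           (v has_vector_derivative - christoffel_form g x (\<gamma> t) (v t) (v t)) (at t)))"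

definition complete_metric ::
  "('m::topological_space, 'n::finite) chart set \<Rightarrow> ('m, 'n) tensor2 \<Rightarrow> bool" where
  "complete_metric A g \<longleftrightarrow> (\<forall>x\<in>A. \<forall>p\<in>cdom x. \<forall>v. \<exists>\<gamma>.
     geodesic A g \<gamma> \<and> \<gamma> 0 = p \<and> vector_derivative (cmap x \<circ> \<gamma>) (at 0) = v)"


section \<open>Conformal fields, Ricci almost solitons, concircular fields\<close>

definition conformal_vector_field ::
  "('m, 'n::finite) chart set \<Rightarrow> ('m, 'n) tensor2 \<Rightarrow> ('m, 'n) vfield \<Rightarrow> ('m \<Rightarrow> real) \<Rightarrow> bool" where
  "conformal_vector_field A g X \<sigma> \<longleftrightarrow> vector_field A X \<and> smooth_fun A \<sigma> \<and>
     (\<forall>x\<in>A. \<forall>p\<in>cdom x. lie_derivative X g x p = (2 * \<sigma> p) *\<^sub>R g x p)"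

definition ricci_almost_soliton ::
  "('m, 'n::finite) chart set \<Rightarrow> ('m, 'n) tensor2 \<Rightarrow> ('m, 'n) vfield \<Rightarrow> ('m \<Rightarrow> real) \<Rightarrow> bool" where
  "ricci_almost_soliton A g X l \<longleftrightarrow> vector_field A X \<and>
     (\<forall>x\<in>A. \<forall>p\<in>cdom x. ricci g x p + (1 / 2) *\<^sub>R lie_derivative X g x p = l p *\<^sub>R g x p)"

definition proper_ricci_almost_soliton ::
  "('m, 'n::finite) chart set \<Rightarrow> ('m, 'n) tensor2 \<Rightarrow> ('m, 'n) vfield \<Rightarrow> ('m \<Rightarrow> real) \<Rightarrow> bool" where
  "proper_ricci_almost_soliton A g X l \<longleftrightarrow>
     ricci_almost_soliton A g X l \<and> \<not> (\<exists>a. \<forall>p. l p = a)"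

definition special_scalar_concircular ::
  "('m, 'n::finite) chart set \<Rightarrow> ('m, 'n) tensor2 \<Rightarrow> ('m \<Rightarrow> real) \<Rightarrow> bool" where
  "special_scalar_concircular A g f \<longleftrightarrow> smooth_fun A f \<and>
     (\<exists>k b. \<forall>x\<in>A. \<forall>p\<in>cdom x. hessian g f x p = (- k * f p + b) *\<^sub>R g x p)"


section \<open>Hypersurfaces\<close>

definition isometric_immersion ::
  "('m::topological_space, 'n::finite) chart set \<Rightarrow> ('m, 'n) tensor2 \<Rightarrow>
   ('q::topological_space, 'k::finite) chart set \<Rightarrow> ('q, 'k) tensor2 \<Rightarrow> ('m \<Rightarrow> 'q) \<Rightarrow> bool" where
  "isometric_immersion A g B h F \<longleftrightarrow> smooth_map A B F \<and>
     (\<forall>x\<in>A. \<forall>y\<in>B. \<forall>p\<in>cdom x \<inter> F -` cdom y.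
        inj (cderiv x (cmap y \<circ> F) p) \<and>
        (\<forall>v w. ip h y (F p) (cderiv x (cmap y \<circ> F) p v) (cderiv x (cmap y \<circ> F) p w) = ip g x p v w))"

text \<open>
  A vector field along \<open>F\<close> (a section of the pulled back tangent bundle): \<open>N y p\<close> are the components
  of a vector at \<open>F p\<close> with respect to the chart \<open>y\<close> of the target.
\<close>

type_synonym ('m, 'q, 'k) field_along = "('q, 'k) chart \<Rightarrow> 'm \<Rightarrow> real ^ 'k"

definition vector_field_along ::
  "('m, 'n::finite) chart set \<Rightarrow> ('q, 'k::finite) chart set \<Rightarrow> ('m \<Rightarrow> 'q) \<Rightarrow>
   ('m, 'q, 'k) field_along \<Rightarrow> bool" where
  "vector_field_along A B F N \<longleftrightarrow>
     (\<forall>x\<in>A. \<forall>y\<in>B. smooth_in x (F -` cdom y) (N y)) \<and>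
     (\<forall>y\<in>B. \<forall>z\<in>B. \<forall>p\<in>F -` (cdom y \<inter> cdom z). N z p = cderiv y (cmap z) (F p) (N y p))"

definition unit_normal_field ::
  "('m, 'n::finite) chart set \<Rightarrow> ('q, 'k::finite) chart set \<Rightarrow> ('q, 'k) tensor2 \<Rightarrow> ('m \<Rightarrow> 'q) \<Rightarrow>
   real \<Rightarrow> ('m, 'q, 'k) field_along \<Rightarrow> bool" where
  "unit_normal_field A B h F \<epsilon> N \<longleftrightarrow> \<epsilon> \<in> {1, -1} \<and> vector_field_along A B F N \<and>
     (\<forall>y\<in>B. \<forall>p\<in>F -` cdom y. ip h y (F p) (N y p) (N y p) = \<epsilon>) \<and>
     (\<forall>x\<in>A. \<forall>y\<in>B. \<forall>p\<in>cdom x \<inter> F -` cdom y. \<forall>v.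
        ip h y (F p) (cderiv x (cmap y \<circ> F) p v) (N y p) = 0)"

text \<open>The derivative of \<open>N\<close> in the direction \<open>v\<close> for the pullback by \<open>F\<close> of the Levi-Civita
  connection of \<open>h\<close>.\<close>

definition covariant_derivative_along ::
  "('q, 'k::finite) tensor2 \<Rightarrow> ('m \<Rightarrow> 'q) \<Rightarrow> ('m, 'n::finite) chart \<Rightarrow> ('q, 'k) chart \<Rightarrow>
   ('m, 'q, 'k) field_along \<Rightarrow> 'm \<Rightarrow> real ^ 'n \<Rightarrow> real ^ 'k" where
  "covariant_derivative_along h F x y N p v =
     cderiv x (N y) p v + christoffel_form h y (F p) (cderiv x (cmap y \<circ> F) p v) (N y p)"

definition weingarten_operator ::
  "('m, 'n::finite) chart set \<Rightarrow> ('q, 'k::finite) chart set \<Rightarrow> ('q, 'k) tensor2 \<Rightarrow> ('m \<Rightarrow> 'q) \<Rightarrow>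
   ('m, 'q, 'k) field_along \<Rightarrow> ('m, 'n) tensor2 \<Rightarrow> bool" where
  "weingarten_operator A B h F N S \<longleftrightarrow>
     (\<forall>x\<in>A. \<forall>y\<in>B. \<forall>p\<in>cdom x \<inter> F -` cdom y. \<forall>v.
        covariant_derivative_along h F x y N p v = - cderiv x (cmap y \<circ> F) p (S x p *v v))"

text \<open>Lowering an index: the \<open>(0,2)\<close>-tensor \<open>(X, Y) \<mapsto> g(S X, Y)\<close>.\<close>

definition lower_index ::
  "('m, 'n::finite) tensor2 \<Rightarrow> ('m, 'n) tensor2 \<Rightarrow> ('m, 'n) tensor2" where
  "lower_index g S x p = (\<chi> i j. ip g x p (S x p *v axis i 1) (axis j 1))"

definition angle_function ::
  "('q, 'k::finite) chart set \<Rightarrow> ('q, 'k) tensor2 \<Rightarrow> ('m \<Rightarrow> 'q) \<Rightarrow> ('q, 'k) vfield \<Rightarrow>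
   ('m, 'q, 'k) field_along \<Rightarrow> ('m \<Rightarrow> real) \<Rightarrow> bool" where
  "angle_function B h F W N C \<longleftrightarrow>
     (\<forall>y\<in>B. \<forall>p\<in>F -` cdom y. C p = ip h y (F p) (W y (F p)) (N y p))"

definition tangent_component ::
  "('m, 'n::finite) chart set \<Rightarrow> ('q, 'k::finite) chart set \<Rightarrow> ('m \<Rightarrow> 'q) \<Rightarrow> real \<Rightarrow>
   ('q, 'k) vfield \<Rightarrow> ('m, 'q, 'k) field_along \<Rightarrow> ('m \<Rightarrow> real) \<Rightarrow> ('m, 'n) vfield \<Rightarrow> bool" where
  "tangent_component A B F \<epsilon> W N C V \<longleftrightarrow> vector_field A V \<and>
     (\<forall>x\<in>A. \<forall>y\<in>B. \<forall>p\<in>cdom x \<inter> F -` cdom y.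
        W y (F p) = cderiv x (cmap y \<circ> F) p (V x p) + (\<epsilon> * C p) *\<^sub>R N y p)"


section \<open>The Christoffel symbols determine the torsion-free metric connection\<close>

lemma pd_cong_on_chart:
  assumes "is_chart x" "p \<in> cdom x" "\<And>q. q \<in> cdom x \<Longrightarrow> f q = f' q"
  shows "pd x i f p = pd x i f' p"
proof -
  have o: "open (cmap x ` cdom x)" and m: "cmap x p \<in> cmap x ` cdom x"
    using assms by (auto simp: is_chart_def)
  have eq: "(f \<circ> cinv x) u = (f' \<circ> cinv x) u" if "u \<in> cmap x ` cdom x" for u
    using that assms(3) by (simp add: cinv_def inv_into_into)
  have "((f \<circ> cinv x) has_derivative D) (at (cmap x p)) \<longleftrightarrow>
        ((f' \<circ> cinv x) has_derivative D) (at (cmap x p))" for D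
    using eq has_derivative_transform_within_open[OF _ o m] by metis
  then show ?thesis
    by (simp add: pd_def cderiv_def frechet_derivative_def)
qed

theorem christoffel_levi_civita:
  fixes \<Gamma> :: "'n::finite \<Rightarrow> 'n \<Rightarrow> 'n \<Rightarrow> real"
  assumes "smooth_atlas A" "semi_riemannian_metric A g" "x \<in> A" "p \<in> cdom x"
  shows "\<Gamma> = christoffel g x p \<longleftrightarrow>
    (\<forall>k i j. \<Gamma> k i j = \<Gamma> k j i) \<and>
    (\<forall>k i j. pd x k (\<lambda>q. g x q $ i $ j) p =
       (\<Sum>l\<in>UNIV. \<Gamma> l k i * g x p $ l $ j) + (\<Sum>l\<in>UNIV. \<Gamma> l k j * g x p $ i $ l))"
    (is "_ \<longleftrightarrow> ?sym \<and> ?met")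
proof -
  let ?G = "g x p" and ?H = "matrix_inv (g x p)"
  define d where "d k i j = pd x k (\<lambda>q. g x q $ i $ j) p" for k i j
  have gs: "g x q $ i $ j = g x q $ j $ i" if "q \<in> cdom x" for q i j
    using that assms by (auto simp: semi_riemannian_metric_def symmetric_tensor2_def)
  have ch: "is_chart x" using assms by (auto simp: smooth_atlas_def)
  have ds: "d k i j = d k j i" for k i j
    unfolding d_def by (rule pd_cong_on_chart[OF ch assms(4)]) (rule gs)
  have nd: "v = 0" if "\<And>w. ip g x p v w = 0" for v
    using that assms unfolding semi_riemannian_metric_def by blast
  have "v = 0" if "?G *v v = 0" for v
  proof (rule nd)
    fix w
    have "ip g x p v w = (\<Sum>j\<in>UNIV. (\<Sum>i\<in>UNIV. ?G $ j $ i * v $ i) * w $ j)"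
      unfolding ip_def sum_distrib_right
      by (subst sum.swap) (simp add: gs[OF assms(4)])
    also have "\<dots> = (\<Sum>j\<in>UNIV. (?G *v v) $ j * w $ j)"
      by (simp add: matrix_vector_mult_def)
    finally show "ip g x p v w = 0" using that by simp
  qed
  then have "invertible ?G"
    by (simp add: invertible_left_inverse matrix_left_invertible_ker)
  then have inv: "?G ** ?H = mat 1" "?H ** ?G = mat 1"
    by (auto simp: matrix_inv_def invertible_def intro: someI2_ex)
  have GH: "(\<Sum>k\<in>UNIV. ?G $ m $ k * ?H $ k $ l) = (if m = l then 1 else 0)" for m l
    using arg_cong[OF inv(1), of "\<lambda>M. M $ m $ l"] by (simp add: matrix_matrix_mult_def mat_def)
  have HG: "(\<Sum>k\<in>UNIV. ?H $ m $ k * ?G $ k $ l) = (if m = l then 1 else 0)" for m l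
    using arg_cong[OF inv(2), of "\<lambda>M. M $ m $ l"] by (simp add: matrix_matrix_mult_def mat_def)
  define low where "low i j l = (d i j l + d j i l - d l i j) / 2" for i j l
  have chr: "christoffel g x p k i j = (\<Sum>l\<in>UNIV. ?H $ k $ l * low i j l)" for k i j
    by (simp add: christoffel_def low_def d_def sum_distrib_left field_simps)
  have low: "(\<Sum>k\<in>UNIV. ?G $ m $ k * christoffel g x p k i j) = low i j m" for m i j
  proof -
    have "(\<Sum>k\<in>UNIV. ?G $ m $ k * christoffel g x p k i j) =
          (\<Sum>l\<in>UNIV. \<Sum>k\<in>UNIV. ?G $ m $ k * (?H $ k $ l * low i j l))"
      unfolding chr sum_distrib_left by (rule sum.swap)
    also have "\<dots> = (\<Sum>l\<in>UNIV. (\<Sum>k\<in>UNIV. ?G $ m $ k * ?H $ k $ l) * low i j l)"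
      by (simp add: sum_distrib_right mult.assoc)
    also have "\<dots> = low i j m" by (simp add: GH if_distrib[of "\<lambda>t. t * _"] cong: if_cong)
    finally show ?thesis .
  qed
  show ?thesis
  proof
    assume \<Gamma>: "\<Gamma> = christoffel g x p"
    have ?sym by (simp add: \<Gamma> chr low_def ds add.commute)
    moreover have ?met
    proof (intro allI)
      fix k i j
      have "(\<Sum>l\<in>UNIV. \<Gamma> l k i * ?G $ l $ j) = low k i j"
        using low[of j k i] by (simp add: \<Gamma> gs[OF assms(4), of j] mult.commute)
      moreover have "(\<Sum>l\<in>UNIV. \<Gamma> l k j * ?G $ i $ l) = low k j i"
        using low[of i k j] by (simp add: \<Gamma> mult.commute)
      moreover have "low k i j + low k j i = d k i j"
        using ds[of k j i] ds[of i k j] ds[of j k i] by (simp add: low_def field_simps)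
      ultimately show "pd x k (\<lambda>q. g x q $ i $ j) p =
          (\<Sum>l\<in>UNIV. \<Gamma> l k i * ?G $ l $ j) + (\<Sum>l\<in>UNIV. \<Gamma> l k j * ?G $ i $ l)"
        by (simp add: d_def)
    qed
    ultimately show "?sym \<and> ?met" ..
  next
    assume "?sym \<and> ?met"
    then have sym: "\<Gamma> k i j = \<Gamma> k j i" for k i j by blast
    define e where "e k i j = (\<Sum>l\<in>UNIV. ?G $ j $ l * \<Gamma> l k i)" for k i j
    have met: "d k i j = e k i j + e k j i" for k i j
      using \<open>?sym \<and> ?met\<close> by (simp add: d_def e_def gs[OF assms(4), of _ j] mult.commute)
    have es: "e k i j = e i k j" for k i j by (simp add: e_def sym[of _ k i])
    have el: "e i j m = low i j m" for i j m
      using es[of i j m] es[of i m j] es[of j m i] by (simp add: low_def met)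
    show "\<Gamma> = christoffel g x p"
    proof (intro ext)
      fix k i j
      have "christoffel g x p k i j = (\<Sum>l\<in>UNIV. \<Sum>m\<in>UNIV. ?H $ k $ l * (?G $ l $ m * \<Gamma> m i j))"
        by (simp add: chr el[symmetric] e_def sum_distrib_left)
      also have "\<dots> = (\<Sum>m\<in>UNIV. (\<Sum>l\<in>UNIV. ?H $ k $ l * ?G $ l $ m) * \<Gamma> m i j)"
        by (subst sum.swap) (simp add: sum_distrib_right mult.assoc)
      also have "\<dots> = \<Gamma> k i j" by (simp add: HG if_distrib[of "\<lambda>t. t * _"] cong: if_cong)
      finally show "\<Gamma> k i j = christoffel g x p k i j" by simp
    qed
  qed
qed

end

theory Submission
  imports Defs
begin

text \<open>
  Write \<open>\<A>\<close> for the second fundamental form and \<open>\<psi> = \<sigma> - \<lambda>\<close>. The proof shows that \<open>M\<close> is totally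
  umbilical, hence of constant curvature, and then integrates the Hessian of the angle function \<open>C\<close>.

  Umbilicity. Decomposing the conformal field as \<open>V + \<epsilon> C N\<close> gives
  \<open>(1/2) L\<^sub>V g = \<sigma> g + \<epsilon> C \<A>\<close> (\<open>conformal_tangential_part\<close>). With \<open>Ric = \<mu> \<A>\<close> the soliton
  equation turns into \<open>(\<mu> + \<epsilon> C) \<A> = - \<psi> g\<close> (\<open>soliton_shape\<close>). Where \<open>\<psi> \<noteq> 0\<close> this says that
  \<open>\<A>\<close> is a multiple of \<open>g\<close>; the set is dense and the condition is closed, so \<open>\<A> = H g\<close> everywhere
  (\<open>shape_proportional\<close>).

  Constant curvature. In an ambient space of constant curvature \<open>c\<close> and for \<open>n \<ge> 2\<close>, the Codazzi
  equation forces \<open>dH = 0\<close> (\<open>H_deriv_0\<close>), and by the Gauss equation \<open>M\<close> has constant curvature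
  \<open>k = c + \<epsilon> H\<^sup>2\<close> (\<open>gauss_equation\<close>).

  The Hessian. The second covariant derivative of a conformal field is determined by its conformal
  factor and the curvature (\<open>cov2_conformal\<close>). Evaluated on tangent vectors and \<open>N\<close>, this yields
  \<open>Hess C = \<phi> g\<close> with \<open>\<phi> = - (N\<sigma> + c C + H \<sigma> + \<epsilon> H\<^sup>2 C)\<close> (\<open>hessian_angle\<close>). One could now compute
  \<open>d(N\<sigma> + H \<sigma>) = 0\<close> from the Hessian of \<open>\<sigma>\<close>, which needs third derivatives of the conformal field.
  It is shorter to use the Ricci identity for \<open>dC\<close> on \<open>M\<close>: on a space of constant curvature \<open>k\<close> and
  dimension at least two, \<open>Hess C = \<phi> g\<close> alone implies \<open>d\<phi> = - k dC\<close>
  (\<open>concircular_factor_deriv\<close>). Hence \<open>\<phi> + k C\<close> is a constant \<open>b\<close> on the connected manifold \<open>M\<close>,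
  and \<open>Hess C = (- k C + b) g\<close>.

  The local part is carried out without indices, for a metric with connection on an open subset of
  a Euclidean space (\<open>metric_connection\<close>) and for hypersurfaces between two such
  (\<open>hypersurface\<close>, \<open>umbilical_hypersurface\<close>); its engine is \<open>curvature_along\<close>. Charts enter only
  to translate the component definitions into this setting and to check that \<open>H\<close> and \<open>\<phi>\<close>
  do not depend on them.
\<close>

section \<open>Calculus of iterated directional derivatives\<close>

abbreviation dder :: "('a::real_normed_vector \<Rightarrow> 'b::real_normed_vector) \<Rightarrow> 'a \<Rightarrow> 'a \<Rightarrow> 'b" where
  "dder f u \<equiv> frechet_derivative f (at u)"

lemma dder_eqI: "(f has_derivative f') (at u) \<Longrightarrow> dder f u = f'"
  using frechet_derivative_at by metis

lemma dder_works: "f differentiable (at u) \<Longrightarrow> (f has_derivative dder f u) (at u)"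
  by (simp add: frechet_derivative_works)

lemma linear_eq_sum_Basis:
  fixes L :: "'a::euclidean_space \<Rightarrow> 'b::real_vector"
  assumes "linear L"
  shows "L v = (\<Sum>i\<in>Basis. (v \<bullet> i) *\<^sub>R L i)"
proof -
  have "L (\<Sum>i\<in>Basis. (v \<bullet> i) *\<^sub>R i) = (\<Sum>i\<in>Basis. (v \<bullet> i) *\<^sub>R L i)"
    by (simp add: linear_sum[OF assms] linear_scale[OF assms])
  then show ?thesis by (simp only: euclidean_representation)
qed

lemma dder_cong_open:
  assumes "open S" "u \<in> S" "\<And>w. w \<in> S \<Longrightarrow> f w = f' w"
  shows "dder f u = dder f' u"
proof -
  have "(f has_derivative d) (at u) \<longleftrightarrow> (f' has_derivative d) (at u)" for d
    using assms has_derivative_transform_within_open[OF _ assms(1,2)] by metis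
  then show ?thesis by (simp add: frechet_derivative_def)
qed

lemma differentiable_cong_open:
  assumes "open S" "u \<in> S" "\<And>w. w \<in> S \<Longrightarrow> f w = f' w" "f differentiable (at u)"
  shows "f' differentiable (at u)"
proof -
  from assms(4) obtain d where "(f has_derivative d) (at u)" unfolding differentiable_def ..
  then have "(f' has_derivative d) (at u)"
    by (rule has_derivative_transform_within_open[OF _ assms(1,2)]) (rule assms(3))
  then show ?thesis unfolding differentiable_def by blast
qed

subsection \<open>Differentiability classes\<close>

lemma Ck_on_cong:
  assumes "open S" "\<And>u. u \<in> S \<Longrightarrow> f u = f' u" "Ck_on n S f"
  shows "Ck_on n S f'"
  using assms(2,3)
proof (induction n arbitrary: f f')
  case 0
  then show ?case by (simp cong: continuous_on_cong)
next
  case (Suc n)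
  have "f' differentiable (at u)" if "u \<in> S" for u
    using differentiable_cong_open[OF assms(1) that, of f f'] Suc.prems that by simp
  moreover have "Ck_on n S (\<lambda>u. dder f' u v)" for v
  proof (rule Suc.IH)
    show "Ck_on n S (\<lambda>u. dder f u v)" using Suc.prems by simp
    show "dder f u v = dder f' u v" if "u \<in> S" for u
      using dder_cong_open[OF assms(1) that Suc.prems(1)] by simp
  qed
  ultimately show ?case by simp
qed

lemma Ck_on_Suc_imp_Ck_on: "Ck_on (Suc n) S f \<Longrightarrow> Ck_on n S f"
proof (induction n arbitrary: f)
  case 0
  then have "f differentiable (at u within S)" if "u \<in> S" for u
    using that differentiable_at_withinI by auto
  then show ?case by (simp add: differentiable_imp_continuous_on differentiable_on_def)
next
  case (Suc n)
  have "Ck_on (Suc n) S (\<lambda>u. dder f u v)" for v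
    using Suc.prems unfolding Ck_on.simps(2)[of "Suc n"] by blast
  then have "Ck_on n S (\<lambda>u. dder f u v)" for v by (rule Suc.IH)
  moreover have "\<forall>u\<in>S. f differentiable (at u)"
    using Suc.prems unfolding Ck_on.simps(2)[of "Suc n"] by blast
  ultimately show ?case unfolding Ck_on.simps(2)[of n] by blast
qed

lemma Ck_on_le: "Ck_on n S f \<Longrightarrow> m \<le> n \<Longrightarrow> Ck_on m S f"
proof (induction n)
  case (Suc n)
  then show ?case using Ck_on_Suc_imp_Ck_on[of n S f] by (cases "m = Suc n") auto
qed simp

lemma Ck_on_subset: "Ck_on n S f \<Longrightarrow> T \<subseteq> S \<Longrightarrow> Ck_on n T f"
proof (induction n arbitrary: f)
  case 0
  then show ?case using continuous_on_subset by auto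
next
  case (Suc n)
  then show ?case by (auto simp: subset_iff)
qed

text \<open>
  The angle function is smooth only through its local expressions, one for each chart of the
  ambient space; this glues them.
\<close>

lemma Ck_on_locally:
  assumes "\<And>u. u \<in> S \<Longrightarrow> \<exists>T. open T \<and> u \<in> T \<and> Ck_on n T f"
  shows "Ck_on n S f"
  using assms
proof (induction n arbitrary: f)
  case 0
  have "isCont f u" if "u \<in> S" for u
    using 0[OF that] continuous_on_eq_continuous_at by auto
  then show ?case by (simp add: continuous_at_imp_continuous_on)
next
  case (Suc n)
  have "Ck_on n S (\<lambda>u. dder f u v)" for v
  proof (rule Suc.IH)
    fix u assume "u \<in> S"
    from Suc.prems[OF this] show "\<exists>T. open T \<and> u \<in> T \<and> Ck_on n T (\<lambda>u. dder f u v)" by auto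
  qed
  moreover have "f differentiable (at u)" if "u \<in> S" for u using Suc.prems[OF that] by auto
  ultimately show ?case by simp
qed

lemma Ck_on_differentiable: "Ck_on n S f \<Longrightarrow> 0 < n \<Longrightarrow> u \<in> S \<Longrightarrow> f differentiable (at u)"
  by (cases n) auto

lemma Ck_on_dder: "Ck_on (Suc n) S f \<Longrightarrow> Ck_on n S (\<lambda>u. dder f u v)"
  by simp

lemma Ck_on_const: "Ck_on n S (\<lambda>u. c)"
  by (induction n arbitrary: c) auto

lemma Ck_on_add:
  assumes "open S" "Ck_on n S f" "Ck_on n S f'"
  shows "Ck_on n S (\<lambda>u. f u + f' u)"
  using assms(2,3)
proof (induction n arbitrary: f f')
  case 0
  then show ?case using continuous_on_add[of S f f'] by simp
next
  case (Suc n)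
  have "Ck_on n S (\<lambda>u. dder (\<lambda>u. f u + f' u) u v)" for v
  proof (rule Ck_on_cong[OF assms(1)])
    show "Ck_on n S (\<lambda>u. dder f u v + dder f' u v)" using Suc by simp
    show "dder f u v + dder f' u v = dder (\<lambda>u. f u + f' u) u v" if "u \<in> S" for u
      using Suc.prems that has_derivative_add[OF dder_works dder_works, of f u f']
      by (simp add: dder_eqI)
  qed
  then show ?case using Suc.prems by auto
qed

lemma Ck_on_sum:
  assumes "open S" "\<And>i. i \<in> I \<Longrightarrow> Ck_on n S (f i)"
  shows "Ck_on n S (\<lambda>u. \<Sum>i\<in>I. f i u)"
  using assms(2)
proof (induction I rule: infinite_finite_induct)
  case (insert i I)
  have "Ck_on n S (\<lambda>u. f i u + (\<Sum>i\<in>I. f i u))"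
    by (rule Ck_on_add[OF assms(1)]) (use insert in blast)+
  then show ?case using insert.hyps by simp
next
  case (infinite I)
  then show ?case using Ck_on_const[of n S 0] by (simp only: sum.infinite not_False_eq_True)
next
  case empty
  show ?case using Ck_on_const[of n S 0] by (simp only: sum.empty)
qed

lemma Ck_on_scaleR:
  fixes r :: "'a::real_normed_vector \<Rightarrow> real"
  assumes "open S" "Ck_on n S r" "Ck_on n S f"
  shows "Ck_on n S (\<lambda>u. r u *\<^sub>R f u)"
  using assms(2,3)
proof (induction n arbitrary: r f)
  case 0
  then show ?case using continuous_on_scaleR[of S r f] by simp
next
  case (Suc n)
  have "Ck_on n S (\<lambda>u. dder (\<lambda>u. r u *\<^sub>R f u) u v)" for v
  proof (rule Ck_on_cong[OF assms(1)])
    show "Ck_on n S (\<lambda>u. r u *\<^sub>R dder f u v + dder r u v *\<^sub>R f u)"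
      using Suc.prems Ck_on_Suc_imp_Ck_on[of n S r] Ck_on_Suc_imp_Ck_on[of n S f]
      by (intro Ck_on_add[OF assms(1)] Suc.IH) auto
    show "r u *\<^sub>R dder f u v + dder r u v *\<^sub>R f u = dder (\<lambda>u. r u *\<^sub>R f u) u v" if "u \<in> S" for u
      using Suc.prems that has_derivative_scaleR[OF dder_works dder_works, of r u f]
      by (simp add: dder_eqI)
  qed
  then show ?case using Suc.prems by auto
qed

lemma Ck_on_mult:
  fixes r s :: "'a::real_normed_vector \<Rightarrow> real"
  assumes "open S" "Ck_on n S r" "Ck_on n S s"
  shows "Ck_on n S (\<lambda>u. r u * s u)"
  using Ck_on_scaleR[OF assms] by simp

lemma Ck_on_bounded_linear:
  assumes "open S" "bounded_linear L" "Ck_on n S f"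
  shows "Ck_on n S (\<lambda>u. L (f u))"
  using assms(3)
proof (induction n arbitrary: f)
  case 0
  then show ?case using assms(2) by (auto intro: bounded_linear.continuous_on)
next
  case (Suc n)
  have der: "((\<lambda>u. L (f u)) has_derivative (\<lambda>v. L (dder f u v))) (at u)" if "u \<in> S" for u
    using Suc.prems that by (intro bounded_linear.has_derivative[OF assms(2)] dder_works) auto
  have "Ck_on n S (\<lambda>u. dder (\<lambda>u. L (f u)) u v)" for v
  proof (rule Ck_on_cong[OF assms(1)])
    show "Ck_on n S (\<lambda>u. L (dder f u v))" using Suc by simp
  qed (simp add: dder_eqI[OF der])
  then show ?case using der by (auto simp: differentiable_def)
qed

text \<open>
  Expanding \<open>dder k (f u) (dder f u v)\<close> in the standard basis reduces the chain rule to sums and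
  products of functions that are covered by the induction hypothesis.
\<close>

lemma Ck_on_compose:
  fixes f :: "'a::real_normed_vector \<Rightarrow> 'b::euclidean_space"
  assumes "open S" "Ck_on n T k" "Ck_on n S f" "f ` S \<subseteq> T"
  shows "Ck_on n S (\<lambda>u. k (f u))"
  using assms(2,3)
proof (induction n arbitrary: k)
  case 0
  then show ?case using assms(4) continuous_on_compose2[of T k S f] by simp
next
  case (Suc n)
  have der: "((\<lambda>u. k (f u)) has_derivative (\<lambda>v. dder k (f u) (dder f u v))) (at u)" if "u \<in> S" for u
  proof (rule has_derivative_compose[where g = k])
    show "(f has_derivative dder f u) (at u)"
      using Suc.prems that by (intro dder_works) simp
    show "(k has_derivative dder k (f u)) (at (f u))"
      using Suc.prems that assms(4) by (intro dder_works) auto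
  qed
  have "Ck_on n S (\<lambda>u. dder (\<lambda>u. k (f u)) u v)" for v
  proof (rule Ck_on_cong[OF assms(1)])
    show "Ck_on n S (\<lambda>u. \<Sum>i\<in>Basis. (dder f u v \<bullet> i) *\<^sub>R dder k (f u) i)"
    proof (intro Ck_on_sum Ck_on_scaleR assms(1))
      fix i :: 'b
      show "Ck_on n S (\<lambda>u. dder f u v \<bullet> i)"
        by (rule Ck_on_bounded_linear[OF assms(1) bounded_linear_inner_left]) (use Suc.prems in simp)
      show "Ck_on n S (\<lambda>u. dder k (f u) i)"
        using Suc.prems Ck_on_Suc_imp_Ck_on[of n S f] by (intro Suc.IH) auto
    qed
    fix u assume u: "u \<in> S"
    then have "linear (dder k (f u))"
      using Suc.prems assms(4) by (intro linear_frechet_derivative) auto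
    then have "(\<Sum>i\<in>Basis. (dder f u v \<bullet> i) *\<^sub>R dder k (f u) i) = dder k (f u) (dder f u v)"
      by (rule linear_eq_sum_Basis[symmetric])
    then show "(\<Sum>i\<in>Basis. (dder f u v \<bullet> i) *\<^sub>R dder k (f u) i) = dder (\<lambda>u. k (f u)) u v"
      by (simp add: dder_eqI[OF der[OF u]])
  qed
  then show ?case using der by (auto simp: differentiable_def)
qed

subsection \<open>Symmetry of second derivatives\<close>

text \<open>
  The second difference of \<open>f\<close> over a small parallelogram is symmetric in its sides, and two
  applications of the mean value theorem write it as a mixed second derivative at a nearby point.
  Doing this in both orders and letting the parallelogram shrink gives Schwarz's theorem.
\<close>

lemma second_difference_mean_value:
  fixes f :: "'a::real_normed_vector \<Rightarrow> real"
  assumes "0 < t" and in_S: "\<And>r s. r \<in> {0..t} \<Longrightarrow> s \<in> {0..t} \<Longrightarrow> u + r *\<^sub>R a + s *\<^sub>R b \<in> S"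
    and "Ck_on 2 S f"
  obtains r s where "r \<in> {0..t}" "s \<in> {0..t}"
    "f (u + t *\<^sub>R a + t *\<^sub>R b) - f (u + t *\<^sub>R a) - f (u + t *\<^sub>R b) + f u =
       t * t * dder (\<lambda>w. dder f w a) (u + r *\<^sub>R a + s *\<^sub>R b) b"
proof -
  have f: "(f has_derivative dder f w) (at w)"
    and fa: "((\<lambda>w. dder f w a) has_derivative dder (\<lambda>w. dder f w a) w) (at w)" if "w \<in> S" for w
    using assms(3) that by (auto simp: numeral_2_eq_2 intro!: dder_works)
  have along_a: "((\<lambda>r. f (u + r *\<^sub>R a + s *\<^sub>R b)) has_derivative
      (\<lambda>d. d * dder f (u + r *\<^sub>R a + s *\<^sub>R b) a)) (at r within T)"
    if "r \<in> {0..t}" "s \<in> {0..t}" for r s T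
  proof -
    have "((\<lambda>r. f (u + r *\<^sub>R a + s *\<^sub>R b)) has_derivative
        (\<lambda>d. dder f (u + r *\<^sub>R a + s *\<^sub>R b) (d *\<^sub>R a))) (at r within T)"
      by (rule has_derivative_compose[where g = f and f = "\<lambda>r. u + r *\<^sub>R a + s *\<^sub>R b"])
        (auto intro!: derivative_eq_intros f[OF in_S[OF that]])
    then show ?thesis
      using linear_scale[OF has_derivative_linear[OF f[OF in_S[OF that]]]] by simp
  qed
  have along_b: "((\<lambda>s. dder f (u + r *\<^sub>R a + s *\<^sub>R b) a) has_derivative
      (\<lambda>d. d * dder (\<lambda>w. dder f w a) (u + r *\<^sub>R a + s *\<^sub>R b) b)) (at s within T)"
    if "r \<in> {0..t}" "s \<in> {0..t}" for r s T
  proof -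
    have "((\<lambda>s. dder f (u + r *\<^sub>R a + s *\<^sub>R b) a) has_derivative
        (\<lambda>d. dder (\<lambda>w. dder f w a) (u + r *\<^sub>R a + s *\<^sub>R b) (d *\<^sub>R b))) (at s within T)"
      by (rule has_derivative_compose[where g = "\<lambda>w. dder f w a" and f = "\<lambda>s. u + r *\<^sub>R a + s *\<^sub>R b"])
        (auto intro!: derivative_eq_intros fa[OF in_S[OF that]])
    then show ?thesis
      using linear_scale[OF has_derivative_linear[OF fa[OF in_S[OF that]]]] by simp
  qed
  define k where "k r = f (u + r *\<^sub>R a + t *\<^sub>R b) - f (u + r *\<^sub>R a + 0 *\<^sub>R b)" for r
  have "(k has_derivative (\<lambda>d. d * dder f (u + r *\<^sub>R a + t *\<^sub>R b) a
      - d * dder f (u + r *\<^sub>R a + 0 *\<^sub>R b) a)) (at r within {0..t})" if "0 \<le> r" "r \<le> t" for r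
    unfolding k_def using that \<open>0 < t\<close> by (intro has_derivative_diff along_a) auto
  from mvt_very_simple[OF less_imp_le[OF \<open>0 < t\<close>] this] obtain r where r: "r \<in> {0..t}"
    "k t - k 0 = t * dder f (u + r *\<^sub>R a + t *\<^sub>R b) a - t * dder f (u + r *\<^sub>R a + 0 *\<^sub>R b) a"
    by auto
  from mvt_very_simple[OF less_imp_le[OF \<open>0 < t\<close>] along_b[OF r(1)]] obtain s where
    s: "s \<in> {0..t}" "dder f (u + r *\<^sub>R a + t *\<^sub>R b) a - dder f (u + r *\<^sub>R a + 0 *\<^sub>R b) a =
       t * dder (\<lambda>w. dder f w a) (u + r *\<^sub>R a + s *\<^sub>R b) b"
    by auto
  have "k t - k 0 = t * (t * dder (\<lambda>w. dder f w a) (u + r *\<^sub>R a + s *\<^sub>R b) b)"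
    unfolding r(2) s(2)[symmetric] by (simp add: right_diff_distrib)
  then show ?thesis by (intro that[OF r(1) s(1)]) (simp add: k_def algebra_simps)
qed

lemma dder_commute_real:
  fixes f :: "'a::real_normed_vector \<Rightarrow> real"
  assumes "open S" "u \<in> S" "Ck_on 2 S f"
  shows "dder (\<lambda>w. dder f w a) u b = dder (\<lambda>w. dder f w b) u a"
proof (rule ccontr)
  define A where "A w = dder (\<lambda>w. dder f w a) w b" for w
  define B where "B w = dder (\<lambda>w. dder f w b) w a" for w
  assume "\<not> ?thesis"
  then have e: "0 < \<bar>A u - B u\<bar> / 2" (is "0 < ?e") by (simp add: A_def B_def)
  have "isCont A u" "isCont B u"
    using assms
    by (simp_all add: numeral_2_eq_2 A_def[abs_def] B_def[abs_def] continuous_on_eq_continuous_at)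
  then obtain d1 d2 where d: "0 < d1" "0 < d2"
    "\<And>w. dist w u < d1 \<Longrightarrow> dist (A w) (A u) < ?e" "\<And>w. dist w u < d2 \<Longrightarrow> dist (B w) (B u) < ?e"
    using e unfolding continuous_at_eps_delta by metis
  obtain d3 where d3: "0 < d3" "\<And>w. dist w u < d3 \<Longrightarrow> w \<in> S"
    using assms(1,2) by (metis open_dist)
  define d where "d = min d1 (min d2 d3)"
  have "0 < d" using d d3 by (simp add: d_def)
  define t where "t = d / (norm a + norm b + 1)"
  have nn: "0 < norm a + norm b + 1"
    using norm_ge_zero[of a] norm_ge_zero[of b] by linarith
  then have "0 < t" using \<open>0 < d\<close> by (simp add: t_def)
  have near: "dist (u + r *\<^sub>R a + s *\<^sub>R b) u < d" if "r \<in> {0..t}" "s \<in> {0..t}" for r s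
  proof -
    have "dist (u + r *\<^sub>R a + s *\<^sub>R b) u \<le> \<bar>r\<bar> * norm a + \<bar>s\<bar> * norm b"
      using norm_triangle_ineq[of "r *\<^sub>R a" "s *\<^sub>R b"] by (simp add: dist_norm add.assoc)
    also have "\<dots> \<le> t * norm a + t * norm b"
      using that by (intro add_mono mult_right_mono) auto
    also have "\<dots> < t * (norm a + norm b + 1)"
      using \<open>0 < t\<close> by (simp add: algebra_simps)
    also have "\<dots> = d" using nn by (simp add: t_def)
    finally show ?thesis .
  qed
  have in_S: "u + r *\<^sub>R a + s *\<^sub>R b \<in> S" if "r \<in> {0..t}" "s \<in> {0..t}" for r s
    using near[OF that] by (intro d3(2)) (simp add: d_def)
  then have in_S': "u + r *\<^sub>R b + s *\<^sub>R a \<in> S" if "r \<in> {0..t}" "s \<in> {0..t}" for r s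
    using that by (metis add.assoc add.commute)
  obtain r s where rs: "r \<in> {0..t}" "s \<in> {0..t}"
    "f (u + t *\<^sub>R a + t *\<^sub>R b) - f (u + t *\<^sub>R a) - f (u + t *\<^sub>R b) + f u =
       t * t * A (u + r *\<^sub>R a + s *\<^sub>R b)"
    unfolding A_def
    by (rule second_difference_mean_value[OF \<open>0 < t\<close> _ assms(3), of u a b])
      (rule in_S)
  obtain r' s' where rs': "r' \<in> {0..t}" "s' \<in> {0..t}"
    "f (u + t *\<^sub>R b + t *\<^sub>R a) - f (u + t *\<^sub>R b) - f (u + t *\<^sub>R a) + f u =
       t * t * B (u + r' *\<^sub>R b + s' *\<^sub>R a)"
    unfolding B_def
    by (rule second_difference_mean_value[OF \<open>0 < t\<close> _ assms(3), of u b a])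
      (rule in_S')
  have "t * t * A (u + r *\<^sub>R a + s *\<^sub>R b) = t * t * B (u + s' *\<^sub>R a + r' *\<^sub>R b)"
    using rs(3) rs'(3) by (simp add: algebra_simps)
  then have "A (u + r *\<^sub>R a + s *\<^sub>R b) = B (u + s' *\<^sub>R a + r' *\<^sub>R b)" using \<open>0 < t\<close> by simp
  moreover have "dist (A (u + r *\<^sub>R a + s *\<^sub>R b)) (A u) < ?e"
    by (rule d(3)) (use near[OF rs(1,2)] in \<open>simp add: d_def\<close>)
  moreover have "dist (B (u + s' *\<^sub>R a + r' *\<^sub>R b)) (B u) < ?e"
    by (rule d(4)) (use near[OF rs'(2,1)] in \<open>simp add: d_def\<close>)
  moreover have False if "x = y" "\<bar>x - p\<bar> < \<bar>p - q\<bar> / 2" "\<bar>y - q\<bar> < \<bar>p - q\<bar> / 2" for x y p q :: real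
    using that abs_triangle_ineq4[of "x - p" "x - q"] by (simp add: abs_minus_commute)
  ultimately show False
    unfolding dist_real_def by blast
qed

text \<open>Schwarz's theorem, reduced to scalar functions by pairing with vectors.\<close>

lemma dder_commute:
  fixes f :: "'a::real_normed_vector \<Rightarrow> 'b::real_inner"
  assumes "open S" "u \<in> S" "Ck_on 2 S f"
  shows "dder (\<lambda>w. dder f w a) u b = dder (\<lambda>w. dder f w b) u a"
proof -
  have "dder (\<lambda>w. dder f w a) u b \<bullet> z = dder (\<lambda>w. dder f w b) u a \<bullet> z" for z
  proof -
    have *: "dder (\<lambda>w. f w \<bullet> z) w a = dder f w a \<bullet> z" if "w \<in> S" for w a
      using assms that
      by (subst dder_eqI[OF has_derivative_inner_left[OF dder_works]])
        (auto intro: Ck_on_differentiable)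
    have **: "dder (\<lambda>w. dder (\<lambda>w. f w \<bullet> z) w a) u b = dder (\<lambda>w. dder f w a) u b \<bullet> z" for a b
    proof -
      have "dder (\<lambda>w. dder (\<lambda>w. f w \<bullet> z) w a) u = dder (\<lambda>w. dder f w a \<bullet> z) u"
        by (rule dder_cong_open[OF assms(1,2) *])
      also have "\<dots> = (\<lambda>b. dder (\<lambda>w. dder f w a) u b \<bullet> z)"
        using assms
        by (intro dder_eqI has_derivative_inner_left dder_works) (simp add: numeral_2_eq_2)
      finally show ?thesis by (rule fun_cong)
    qed
    have "Ck_on 2 S (\<lambda>w. f w \<bullet> z)"
      by (rule Ck_on_bounded_linear[OF assms(1) bounded_linear_inner_left assms(3)])
    from dder_commute_real[OF assms(1,2) this, of a b] show ?thesis by (simp add: **)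
  qed
  then show ?thesis using vector_eq_rdot by blast
qed

subsection \<open>Families of linear and bilinear maps\<close>

text \<open>
  The product rule for \<open>w \<mapsto> T w (X w)\<close>. Differentiability of \<open>T\<close> is asked only argument by
  argument, which is how component functions of tensors and differentials come; in finite dimension
  an expansion of the argument in a basis makes this enough.
\<close>

lemma has_derivative_linear_family:
  fixes T :: "'w::real_normed_vector \<Rightarrow> 'b::euclidean_space \<Rightarrow> 'd::real_normed_vector"
  assumes "open S" "u \<in> S" and lin: "\<And>w. w \<in> S \<Longrightarrow> linear (T w)"
    and diff: "\<And>e. (\<lambda>w. T w e) differentiable (at u)"
    and X: "(X has_derivative X') (at u)"
  shows "((\<lambda>w. T w (X w)) has_derivative (\<lambda>d. dder (\<lambda>w. T w (X u)) u d + T u (X' d))) (at u)"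
proof -
  have expand: "T w e = (\<Sum>i\<in>Basis. (e \<bullet> i) *\<^sub>R T w i)" if "w \<in> S" for w e
    by (rule linear_eq_sum_Basis[OF lin[OF that]])
  have fix_arg: "((\<lambda>w. T w e) has_derivative (\<lambda>d. \<Sum>i\<in>Basis. (e \<bullet> i) *\<^sub>R dder (\<lambda>w. T w i) u d)) (at u)" for e
    by (rule has_derivative_transform_within_open[OF _ assms(1,2) expand[symmetric]])
      (intro has_derivative_sum has_derivative_scaleR_right dder_works diff)
  have "((\<lambda>w. \<Sum>i\<in>Basis. (X w \<bullet> i) *\<^sub>R T w i) has_derivative
      (\<lambda>d. \<Sum>i\<in>Basis. (X u \<bullet> i) *\<^sub>R dder (\<lambda>w. T w i) u d + (X' d \<bullet> i) *\<^sub>R T u i)) (at u)"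
    by (intro has_derivative_sum has_derivative_scaleR has_derivative_inner_left dder_works diff X)
  then have "((\<lambda>w. T w (X w)) has_derivative
      (\<lambda>d. \<Sum>i\<in>Basis. (X u \<bullet> i) *\<^sub>R dder (\<lambda>w. T w i) u d + (X' d \<bullet> i) *\<^sub>R T u i)) (at u)"
    by (rule has_derivative_transform_within_open[OF _ assms(1,2) expand[symmetric]])
  then show ?thesis
    unfolding dder_eqI[OF fix_arg[of "X u"]]
    by (simp only: sum.distrib expand[OF assms(2), symmetric])
qed

lemma has_derivative_bilinear_family:
  fixes T :: "'w::real_normed_vector \<Rightarrow> 'b::euclidean_space \<Rightarrow> 'c::euclidean_space \<Rightarrow> 'd::real_normed_vector"
  assumes bil: "\<And>w. bilinear (T w)"
    and diff: "\<And>b c. (\<lambda>w. T w b c) differentiable (at (f u))"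
    and f: "(f has_derivative f') (at u)"
    and X: "(X has_derivative X') (at u)" and Y: "(Y has_derivative Y') (at u)"
  shows "((\<lambda>w. T (f w) (X w) (Y w)) has_derivative
    (\<lambda>d. dder (\<lambda>w. T w (X u) (Y u)) (f u) (f' d) + T (f u) (X' d) (Y u) + T (f u) (X u) (Y' d))) (at u)"
proof -
  have lin: "linear (\<lambda>b. T w b c)" "linear (\<lambda>c. T w b c)" for w b c
    using bil by (auto simp: bilinear_def)
  have comp: "((\<lambda>w. T (f w) b c) has_derivative (\<lambda>d. dder (\<lambda>w. T w b c) (f u) (f' d))) (at u)" for b c
    by (rule has_derivative_compose[where g = "\<lambda>w. T w b c", OF f dder_works[OF diff]])
  have inner: "((\<lambda>w. T (f w) b (Y w)) has_derivative
      (\<lambda>d. dder (\<lambda>w. T w b (Y u)) (f u) (f' d) + T (f u) b (Y' d))) (at u)" for b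
  proof -
    have "(\<lambda>w. T (f w) b c) differentiable (at u)" for c
      using comp differentiable_def by blast
    from has_derivative_linear_family[OF open_UNIV UNIV_I lin(2) this Y]
    show ?thesis unfolding dder_eqI[OF comp] .
  qed
  have diff_inner: "(\<lambda>w. T (f w) b (Y w)) differentiable (at u)" for b
    using inner differentiable_def by blast
  show ?thesis
    using has_derivative_linear_family[OF open_UNIV UNIV_I lin(1) diff_inner X]
    unfolding dder_eqI[OF inner] by (simp only: ac_simps)
qed

section \<open>Metrics with a torsion-free metric connection on open sets\<close>

text \<open>
  Tensor calculus on an open set, free of indices: \<open>h u\<close> is the metric and \<open>\<Gamma> u a b\<close> the
  Christoffel form, that is \<open>\<nabla>\<^sub>a b\<close> for constant fields \<open>a, b\<close>. Bilinearity is asked at every \<open>u\<close>,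
  inside \<open>U\<close> or not, because forms given by component matrices have it and it keeps side conditions
  out of the calculations.
\<close>

locale metric_connection =
  fixes U :: "'a::euclidean_space set" and h :: "'a \<Rightarrow> 'a \<Rightarrow> 'a \<Rightarrow> real"
    and \<Gamma> :: "'a \<Rightarrow> 'a \<Rightarrow> 'a \<Rightarrow> 'a"
  assumes open_dom: "open U"
    and bilinear_h: "bilinear (h u)"
    and bilinear_\<Gamma>: "bilinear (\<Gamma> u)"
    and h_sym: "u \<in> U \<Longrightarrow> h u a b = h u b a"
    and h_nondegenerate: "u \<in> U \<Longrightarrow> (\<And>b. h u a b = 0) \<Longrightarrow> a = 0"
    and \<Gamma>_sym: "u \<in> U \<Longrightarrow> \<Gamma> u a b = \<Gamma> u b a"
    and h_C2: "Ck_on 2 U (\<lambda>u. h u a b)"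
    and \<Gamma>_differentiable: "u \<in> U \<Longrightarrow> (\<lambda>u. \<Gamma> u a b) differentiable (at u)"
    and metric: "u \<in> U \<Longrightarrow> dder (\<lambda>u. h u b c) u a = h u (\<Gamma> u a b) c + h u b (\<Gamma> u a c)"
begin

lemmas h_simps = bilinear_ladd[OF bilinear_h] bilinear_radd[OF bilinear_h]
  bilinear_lsub[OF bilinear_h] bilinear_rsub[OF bilinear_h]
  bilinear_lmul[OF bilinear_h] bilinear_rmul[OF bilinear_h]
  bilinear_lneg[OF bilinear_h] bilinear_rneg[OF bilinear_h]
  bilinear_lzero[OF bilinear_h] bilinear_rzero[OF bilinear_h] real_scaleR_def

lemmas \<Gamma>_simps = bilinear_ladd[OF bilinear_\<Gamma>] bilinear_radd[OF bilinear_\<Gamma>]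
  bilinear_lsub[OF bilinear_\<Gamma>] bilinear_rsub[OF bilinear_\<Gamma>]
  bilinear_lmul[OF bilinear_\<Gamma>] bilinear_rmul[OF bilinear_\<Gamma>]
  bilinear_lneg[OF bilinear_\<Gamma>] bilinear_rneg[OF bilinear_\<Gamma>]
  bilinear_lzero[OF bilinear_\<Gamma>] bilinear_rzero[OF bilinear_\<Gamma>]

lemma h_differentiable: "u \<in> U \<Longrightarrow> (\<lambda>u. h u a b) differentiable (at u)"
  by (rule Ck_on_differentiable[OF h_C2]) auto

lemma h_eqI: "u \<in> U \<Longrightarrow> (\<And>b. h u a b = h u a' b) \<Longrightarrow> a = a'"
  using h_nondegenerate[of u "a - a'"] by (simp add: h_simps)

text \<open>
  The pullback connection: \<open>cov f X u a\<close> is \<open>\<nabla>\<^sub>a X\<close> for a vector field \<open>X\<close> along the map \<open>f\<close>. The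
  choice \<open>f = (\<lambda>w. w)\<close> gives the connection itself. Treating both at once means that the
  Leibniz rule and the curvature identity are proved only once for the ambient space, for the
  hypersurface and for ambient fields along the hypersurface.
\<close>

definition cov :: "('b::real_normed_vector \<Rightarrow> 'a) \<Rightarrow> ('b \<Rightarrow> 'a) \<Rightarrow> 'b \<Rightarrow> 'b \<Rightarrow> 'a" where
  "cov f X u a = dder X u a + \<Gamma> (f u) (dder f u a) (X u)"

lemma cov_cong_open:
  "open S \<Longrightarrow> u \<in> S \<Longrightarrow> (\<And>w. w \<in> S \<Longrightarrow> X w = Y w) \<Longrightarrow> cov f X u a = cov f Y u a"
  using dder_cong_open[of S u X Y] by (simp add: cov_def)

lemma cov_const: "cov f (\<lambda>w. b) u a = \<Gamma> (f u) (dder f u a) b"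
  by (simp add: cov_def)

lemma cov_add:
  "X differentiable (at u) \<Longrightarrow> Y differentiable (at u) \<Longrightarrow>
    cov f (\<lambda>w. X w + Y w) u a = cov f X u a + cov f Y u a"
  by (simp add: cov_def dder_eqI[OF has_derivative_add[OF dder_works dder_works]] \<Gamma>_simps)

lemma cov_scaleR:
  "r differentiable (at u) \<Longrightarrow> X differentiable (at u) \<Longrightarrow>
    cov f (\<lambda>w. r w *\<^sub>R X w) u a = r u *\<^sub>R cov f X u a + dder r u a *\<^sub>R X u"
  by (simp add: cov_def dder_eqI[OF has_derivative_scaleR[OF dder_works dder_works]] \<Gamma>_simps
      algebra_simps)

lemma linear_cov:
  assumes "f differentiable (at u)" "X differentiable (at u)"
  shows "linear (cov f X u)"
  using linear_frechet_derivative[OF assms(1)] linear_frechet_derivative[OF assms(2)]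
  unfolding cov_def by (auto intro!: linearI simp: linear_add linear_scale \<Gamma>_simps algebra_simps)

lemma has_derivative_h_along:
  assumes "f u \<in> U" "f differentiable (at u)" "X differentiable (at u)" "Y differentiable (at u)"
  shows "((\<lambda>w. h (f w) (X w) (Y w)) has_derivative
    (\<lambda>d. h (f u) (cov f X u d) (Y u) + h (f u) (X u) (cov f Y u d))) (at u)"
  using has_derivative_bilinear_family[OF bilinear_h h_differentiable[OF assms(1)]
      dder_works[OF assms(2)] dder_works[OF assms(3)] dder_works[OF assms(4)]]
  by (simp add: metric[OF assms(1)] cov_def h_simps algebra_simps)

definition curv :: "'a \<Rightarrow> 'a \<Rightarrow> 'a \<Rightarrow> 'a \<Rightarrow> 'a" where
  "curv u a b w = dder (\<lambda>v. \<Gamma> v b w) u a - dder (\<lambda>v. \<Gamma> v a w) u b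
     + \<Gamma> u a (\<Gamma> u b w) - \<Gamma> u b (\<Gamma> u a w)"

lemma has_derivative_cov:
  assumes "open S" "u \<in> S" "f ` S \<subseteq> U" "Ck_on 2 S f" "Ck_on 2 S X"
  shows "((\<lambda>w. cov f X w a) has_derivative (\<lambda>d. dder (\<lambda>w. dder X w a) u d +
    (dder (\<lambda>v. \<Gamma> v (dder f u a) (X u)) (f u) (dder f u d) +
     \<Gamma> (f u) (dder (\<lambda>w. dder f w a) u d) (X u) + \<Gamma> (f u) (dder f u a) (dder X u d)))) (at u)"
proof -
  have "f u \<in> U" using assms by auto
  have f: "f differentiable (at u)" "(\<lambda>w. dder f w a) differentiable (at u)"
    and X: "X differentiable (at u)" "(\<lambda>w. dder X w a) differentiable (at u)"
    using assms(2,4,5) by (auto simp: numeral_2_eq_2)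
  show ?thesis
    unfolding cov_def
    using has_derivative_add[OF dder_works[OF X(2)] has_derivative_bilinear_family[OF bilinear_\<Gamma>
        \<Gamma>_differentiable[OF \<open>f u \<in> U\<close>] dder_works[OF f(1)] dder_works[OF f(2)] dder_works[OF X(1)]]] .
qed

lemma differentiable_cov:
  assumes "open S" "u \<in> S" "f ` S \<subseteq> U" "Ck_on 2 S f" "Ck_on 2 S X"
  shows "(\<lambda>w. cov f X w a) differentiable (at u)"
  using has_derivative_cov[OF assms] differentiable_def by blast

text \<open>
  Covariant derivatives of a field along a map commute up to curvature. Applied to the unit normal
  this is the Codazzi equation, to the tangent frame the Gauss equation, and to a vector field along
  the identity the Ricci identity.
\<close>

lemma curvature_along:
  fixes f :: "'b::real_normed_vector \<Rightarrow> 'a"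
  assumes "open S" "u \<in> S" "f ` S \<subseteq> U" "Ck_on 2 S f" "Ck_on 2 S X"
  shows "cov f (\<lambda>w. cov f X w a) u d - cov f (\<lambda>w. cov f X w d) u a =
    curv (f u) (dder f u d) (dder f u a) (X u)"
proof -
  have "cov f (\<lambda>w. cov f X w a) u d = dder (\<lambda>w. dder X w a) u d +
    (dder (\<lambda>v. \<Gamma> v (dder f u a) (X u)) (f u) (dder f u d) +
     \<Gamma> (f u) (dder (\<lambda>w. dder f w a) u d) (X u) + \<Gamma> (f u) (dder f u a) (dder X u d)) +
    \<Gamma> (f u) (dder f u d) (dder X u a + \<Gamma> (f u) (dder f u a) (X u))" for a d
    by (subst cov_def, subst dder_eqI[OF has_derivative_cov[OF assms]]) (simp add: cov_def)
  then show ?thesis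
    using dder_commute[OF assms(1,2,4), of a d] dder_commute[OF assms(1,2,5), of a d]
    by (simp add: curv_def \<Gamma>_simps)
qed

subsection \<open>Symmetries of the curvature\<close>

lemma curv_linear:
  assumes "u \<in> U"
  shows "linear (\<lambda>a. curv u a b w)" "linear (\<lambda>b. curv u a b w)" "linear (\<lambda>w. curv u a b w)"
proof -
  note diff = \<Gamma>_differentiable[OF assms]
  note lin = linear_frechet_derivative[OF diff]
  have add: "dder (\<lambda>v. \<Gamma> v a w + \<Gamma> v a' w') u = (\<lambda>d. dder (\<lambda>v. \<Gamma> v a w) u d + dder (\<lambda>v. \<Gamma> v a' w') u d)"
    for a a' w w'
    by (rule dder_eqI[OF has_derivative_add[OF dder_works[OF diff] dder_works[OF diff]]])
  have scale: "dder (\<lambda>v. r *\<^sub>R \<Gamma> v a w) u = (\<lambda>d. r *\<^sub>R dder (\<lambda>v. \<Gamma> v a w) u d)" for a r w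
    by (rule dder_eqI[OF has_derivative_scaleR_right[OF dder_works[OF diff]]])
  note simps = curv_def \<Gamma>_simps add scale linear_add[OF lin] linear_scale[OF lin] algebra_simps
  show "linear (\<lambda>a. curv u a b w)" by (rule linearI) (simp_all add: simps)
  show "linear (\<lambda>b. curv u a b w)" by (rule linearI) (simp_all add: simps)
  show "linear (\<lambda>w. curv u a b w)" by (rule linearI) (simp_all add: simps)
qed

lemma curv_antisym: "curv u a b w = - curv u b a w"
  by (simp add: curv_def)

lemma curv_bianchi: "u \<in> U \<Longrightarrow> curv u a b w + curv u b w a + curv u w a b = 0"
proof -
  assume u: "u \<in> U"
  have "dder (\<lambda>v. \<Gamma> v a b) u = dder (\<lambda>v. \<Gamma> v b a) u" for a b
    by (rule dder_cong_open[OF open_dom u]) (rule \<Gamma>_sym)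
  from this[of a b] this[of a w] this[of b w] show ?thesis
    by (simp add: curv_def \<Gamma>_sym[OF u, of b a] \<Gamma>_sym[OF u, of w a] \<Gamma>_sym[OF u, of w b])
qed

text \<open>
  Second derivatives of the function \<open>v \<mapsto> h v w z\<close> commute, and in terms of the connection their
  commutator is \<open>h(R(a,b)w, z) + h(w, R(a,b)z)\<close>.
\<close>

lemma curv_metric_antisym:
  assumes u: "u \<in> U"
  shows "h u (curv u a b w) z = - h u (curv u a b z) w"
proof -
  have "dder (\<lambda>v. dder (\<lambda>v. h v w z) v b) u a =
     h u (dder (\<lambda>v. \<Gamma> v b w) u a + \<Gamma> u a (\<Gamma> u b w)) z + h u (\<Gamma> u b w) (\<Gamma> u a z) +
     (h u (\<Gamma> u a w) (\<Gamma> u b z) + h u w (dder (\<lambda>v. \<Gamma> v b z) u a + \<Gamma> u a (\<Gamma> u b z)))" for a b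
  proof -
    have "dder (\<lambda>v. dder (\<lambda>v. h v w z) v b) u = dder (\<lambda>v. h v (\<Gamma> v b w) z + h v w (\<Gamma> v b z)) u"
      by (rule dder_cong_open[OF open_dom u]) (rule metric)
    also have "\<dots> = (\<lambda>d. h u (cov (\<lambda>w. w) (\<lambda>v. \<Gamma> v b w) u d) z + h u (\<Gamma> u b w) (cov (\<lambda>w. w) (\<lambda>v. z) u d) +
      (h u (cov (\<lambda>w. w) (\<lambda>v. w) u d) (\<Gamma> u b z) + h u w (cov (\<lambda>w. w) (\<lambda>v. \<Gamma> v b z) u d)))"
      using u by (intro dder_eqI has_derivative_add has_derivative_h_along) (auto intro: \<Gamma>_differentiable)
    finally show ?thesis by (simp add: cov_def)
  qed
  from this[of b a] this[of a b] dder_commute[OF open_dom u h_C2, of w z a b] show ?thesis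
    by (simp add: curv_def h_simps h_sym[OF u, of w])
qed

end

text \<open>
  A tensor with the symmetries of a curvature tensor is determined by its sectional values: they
  give \<open>K a b b z = 0\<close> by polarization and pair symmetry, so \<open>K\<close> is antisymmetric in its first
  three arguments, and then the Bianchi identity reads \<open>3 K = 0\<close>.
\<close>

lemma curvature_like_eq_0:
  fixes K :: "'a::ab_group_add \<Rightarrow> 'a \<Rightarrow> 'a \<Rightarrow> 'a \<Rightarrow> real"
  assumes add: "\<And>a a' b w z. K (a + a') b w z = K a b w z + K a' b w z"
      "\<And>a b b' w z. K a (b + b') w z = K a b w z + K a b' w z"
      "\<And>a b w w' z. K a b (w + w') z = K a b w z + K a b w' z"
      "\<And>a b w z z'. K a b w (z + z') = K a b w z + K a b w z'"
    and as1: "\<And>a b w z. K a b w z = - K b a w z" and as2: "\<And>a b w z. K a b w z = - K a b z w"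
    and bianchi: "\<And>a b w z. K a b w z + K b w a z + K w a b z = 0"
    and sec: "\<And>a b. K a b b a = 0"
  shows "K a b w z = 0"
proof -
  have pair: "K a b w z = K w z a b" for a b w z
    using bianchi[of a b w z] bianchi[of b w z a] bianchi[of w z a b] bianchi[of z a b w]
      as1[of w a b z] as2[of b w z a] as2[of w z b a] as1[of z b w a] as2[of b z w a]
      as1[of z a w b] as2[of a z w b] as2[of a w z b] as1[of z a b w] as2[of a b z w]
    by linarith
  have zero: "K a b b z = 0" for a b z
  proof -
    have "K a b b z + K z b b a = 0"
      using sec[of "a + z" b] sec[of a b] sec[of z b] by (simp add: add)
    moreover have "K z b b a = K a b b z"
      using pair[of z b b a] as1[of b a z b] as2[of a b z b] by linarith
    ultimately show ?thesis by linarith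
  qed
  have swap: "K a b w z = - K a w b z" for a b w z
    using zero[of a "b + w" z] zero[of a b z] zero[of a w z] by (simp add: add)
  show ?thesis
    using bianchi[of a b w z] swap[of a b w z] as1[of a w b z] swap[of w a b z] swap[of b w a z]
      as1[of b a w z] by linarith
qed

context metric_connection begin

text \<open>
  Sectional curvature is only given on nondegenerate planes. Along a line towards one such
  plane \<open>(a\<^sub>0, b\<^sub>0)\<close>, the area is a nonzero polynomial \<open>p\<close> and the deviation from constant curvature is
  a polynomial \<open>q\<close> that vanishes where \<open>p\<close> does not; hence \<open>q p = 0\<close> and \<open>q = 0\<close>, which covers the
  degenerate planes too.
\<close>

lemma constant_curvature:
  assumes u: "u \<in> U"
    and sec: "\<And>a b. h u a a * h u b b - (h u a b)\<^sup>2 \<noteq> 0 \<Longrightarrow>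
      h u (curv u a b b) a = c * (h u a a * h u b b - (h u a b)\<^sup>2)"
    and ndg: "h u a0 a0 * h u b0 b0 - (h u a0 b0)\<^sup>2 \<noteq> 0"
  shows "curv u a b w = c *\<^sub>R (h u b w *\<^sub>R a - h u a w *\<^sub>R b)"
proof (rule h_eqI[OF u])
  fix z
  define K where "K a b w z = h u (curv u a b w) z - c * (h u b w * h u a z - h u a w * h u b z)"
    for a b w z
  note lin = curv_linear[OF u]
  have K_add: "K (a + a') b w z = K a b w z + K a' b w z" "K a (b + b') w z = K a b w z + K a b' w z"
      "K a b (w + w') z = K a b w z + K a b w' z" "K a b w (z + z') = K a b w z + K a b w z'"
    for a a' b b' w w' z z'
    unfolding K_def
    by (simp_all add: linear_add[OF lin(1)] linear_add[OF lin(2)] linear_add[OF lin(3)] h_simps algebra_simps)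
  have K_scale: "K (r *\<^sub>R a) b w z = r * K a b w z" "K a (r *\<^sub>R b) w z = r * K a b w z"
      "K a b (r *\<^sub>R w) z = r * K a b w z" "K a b w (r *\<^sub>R z) = r * K a b w z" for r a b w z
    unfolding K_def
    by (simp_all add: linear_scale[OF lin(1)] linear_scale[OF lin(2)] linear_scale[OF lin(3)] h_simps algebra_simps)
  have "K a b b a = 0" for a b
  proof -
    define q where "q = [:K a b b a,
      K a0 b b a + K a b0 b a + K a b b0 a + K a b b a0,
      K a0 b0 b a + K a0 b b0 a + K a0 b b a0 + K a b0 b0 a + K a b0 b a0 + K a b b0 a0,
      K a b0 b0 a0 + K a0 b b0 a0 + K a0 b0 b a0 + K a0 b0 b0 a,
      K a0 b0 b0 a0:]"
    have q: "poly q t = K (a + t *\<^sub>R a0) (b + t *\<^sub>R b0) (b + t *\<^sub>R b0) (a + t *\<^sub>R a0)" for t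
      unfolding q_def by (simp add: K_add K_scale algebra_simps)
    define p where "p = [:h u a a, 2 * h u a a0, h u a0 a0:] * [:h u b b, 2 * h u b b0, h u b0 b0:] -
      [:h u a b, h u a b0 + h u a0 b, h u a0 b0:]\<^sup>2"
    have p: "poly p t = h u (a + t *\<^sub>R a0) (a + t *\<^sub>R a0) * h u (b + t *\<^sub>R b0) (b + t *\<^sub>R b0) -
        (h u (a + t *\<^sub>R a0) (b + t *\<^sub>R b0))\<^sup>2" for t
      unfolding p_def by (simp add: h_simps h_sym[OF u, of a0 a] h_sym[OF u, of b0 b] algebra_simps)
    have "poly (q * p) t = 0" for t
      using sec[of "a + t *\<^sub>R a0" "b + t *\<^sub>R b0"]
      by (auto simp: q p K_def power2_eq_square h_sym[OF u, of "b + t *\<^sub>R b0" "a + t *\<^sub>R a0"])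
    then have "q * p = 0" using poly_all_0_iff_0 by blast
    moreover have "p \<noteq> 0"
    proof
      assume "p = 0"
      then have "coeff p (Suc (Suc (Suc (Suc 0)))) = 0" by simp
      then show False using ndg by (simp add: p_def power2_eq_square mult.commute)
    qed
    ultimately have "q = 0" by simp
    then show ?thesis by (simp add: q_def)
  qed
  then have "K a b w z = 0"
  proof (rule curvature_like_eq_0[where K = K, rotated -1])
    show "K a b w z = - K b a w z" for a b w z
      unfolding K_def by (subst curv_antisym) (simp add: h_simps algebra_simps)
    show "K a b w z = - K a b z w" for a b w z
      unfolding K_def by (subst curv_metric_antisym[OF u]) (simp add: h_simps algebra_simps)
    show "K a b w z + K b w a z + K w a b z = 0" for a b w z
      using arg_cong[OF curv_bianchi[OF u, of a b w], of "\<lambda>v. h u v z"]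
      by (simp add: K_def h_simps h_sym[OF u, of b a] h_sym[OF u, of w a] h_sym[OF u, of w b] algebra_simps)
  qed (rule K_add)+
  then show "h u (curv u a b w) z = h u (c *\<^sub>R (h u b w *\<^sub>R a - h u a w *\<^sub>R b)) z"
    by (simp add: K_def h_simps)
qed

subsection \<open>Conformal vector fields\<close>

text \<open>
  The second covariant derivative \<open>\<nabla>\<^sup>2\<^bsub>a,b\<^esub> V\<close>.
\<close>

definition cov2 :: "('a \<Rightarrow> 'a) \<Rightarrow> 'a \<Rightarrow> 'a \<Rightarrow> 'a \<Rightarrow> 'a" where
  "cov2 V u a b = cov (\<lambda>w. w) (\<lambda>w. cov (\<lambda>w. w) V w b) u a - cov (\<lambda>w. w) V u (\<Gamma> u a b)"

lemma cov2_antisym: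
  assumes "u \<in> U" "Ck_on 2 U V"
  shows "cov2 V u a b - cov2 V u b a = curv u a b (V u)"
proof -
  have "Ck_on 2 U (\<lambda>w. w)"
    by (auto simp: numeral_2_eq_2)
  from curvature_along[OF open_dom assms(1) _ this assms(2), of b a] show ?thesis
    by (simp add: cov2_def \<Gamma>_sym[OF assms(1), of b a])
qed

lemma cov2_conformal_sym:
  assumes u: "u \<in> U" and V: "Ck_on 2 U V" and s: "s differentiable (at u)"
    and conf: "\<And>w a b. w \<in> U \<Longrightarrow>
      h w (cov (\<lambda>w. w) V w a) b + h w a (cov (\<lambda>w. w) V w b) = 2 * s w * h w a b"
  shows "h u (cov2 V u a b) z + h u b (cov2 V u a z) = 2 * dder s u a * h u b z"
proof -
  have C2_id: "Ck_on 2 U (\<lambda>w. w)"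
    by (auto simp: numeral_2_eq_2)
  have diff: "(\<lambda>w. cov (\<lambda>w. w) V w b) differentiable (at u)" for b
    using differentiable_cov[OF open_dom u _ C2_id V] by simp
  let ?P = "\<lambda>w. cov (\<lambda>w. w) V w"
  have lhs: "dder (\<lambda>w. h w (?P w b) z + h w b (?P w z)) u =
    (\<lambda>d. h u (cov (\<lambda>w. w) (\<lambda>w. ?P w b) u d) z + h u (?P u b) (cov (\<lambda>w. w) (\<lambda>w. z) u d) +
      (h u (cov (\<lambda>w. w) (\<lambda>w. b) u d) (?P u z) + h u b (cov (\<lambda>w. w) (\<lambda>w. ?P w z) u d)))"
    using u diff by (intro dder_eqI has_derivative_add has_derivative_h_along) auto
  have rhs: "dder (\<lambda>w. 2 * s w * h w b z) u =
     (\<lambda>d. 2 * s u * dder (\<lambda>w. h w b z) u d + 2 * dder s u d * h u b z)"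
    by (intro dder_eqI has_derivative_mult has_derivative_mult_right dder_works s h_differentiable u)
  have "dder (\<lambda>w. h w (?P w b) z + h w b (?P w z)) u = dder (\<lambda>w. 2 * s w * h w b z) u"
    by (rule dder_cong_open[OF open_dom u conf])
  from fun_cong[OF this[unfolded lhs rhs], of a]
  have "h u (cov (\<lambda>w. w) (\<lambda>w. ?P w b) u a) z + h u (?P u b) (\<Gamma> u a z) +
      (h u (\<Gamma> u a b) (?P u z) + h u b (cov (\<lambda>w. w) (\<lambda>w. ?P w z) u a)) =
      2 * s u * (h u (\<Gamma> u a b) z + h u b (\<Gamma> u a z)) + 2 * dder s u a * h u b z"
    by (simp add: cov_const metric[OF u])
  with conf[OF u, of "\<Gamma> u a b" z] conf[OF u, of b "\<Gamma> u a z"] show ?thesis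
    by (simp add: cov2_def h_simps algebra_simps)
qed

text \<open>
  The symmetric part of \<open>\<nabla>\<^sup>2V\<close> in its last two slots comes from the derivative of the conformal
  factor and the antisymmetric part in its first two slots from the curvature. As for the
  Levi-Civita connection, these two pieces determine the whole tensor.
\<close>

lemma cov2_conformal:
  assumes u: "u \<in> U" and V: "Ck_on 2 U V" and s: "s differentiable (at u)"
    and conf: "\<And>w a b. w \<in> U \<Longrightarrow>
      h w (cov (\<lambda>w. w) V w a) b + h w a (cov (\<lambda>w. w) V w b) = 2 * s w * h w a b"
    and R: "\<And>a b w. curv u a b w = c *\<^sub>R (h u b w *\<^sub>R a - h u a w *\<^sub>R b)"
  shows "h u (cov2 V u a b) z = dder s u a * h u b z + dder s u b * h u a z - dder s u z * h u a b
    + c * (h u (V u) b * h u a z - h u (V u) z * h u a b)"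
proof -
  have sym: "h u (cov2 V u a b) z + h u (cov2 V u a z) b = 2 * dder s u a * h u b z" for a b z
    using cov2_conformal_sym[OF u V s conf, of a b z] by (simp add: h_sym[OF u, of b "cov2 V u a z"])
  have asym: "h u (cov2 V u a b) z - h u (cov2 V u b a) z =
      c * (h u (V u) b * h u a z - h u (V u) a * h u b z)" for a b z
    using arg_cong[OF cov2_antisym[OF u V, of a b], of "\<lambda>v. h u v z"] h_sym[OF u, of "V u"]
    by (simp add: R h_simps)
  from sym[of a b z] sym[of b a z] sym[of z a b] asym[of a b z] asym[of a z b] asym[of b z a]
  show ?thesis
    by (simp add: h_sym[OF u, of b a] h_sym[OF u, of z a] h_sym[OF u, of z b] algebra_simps)
qed

lemma cov_compose:
  assumes "f differentiable (at u)" "X differentiable (at (f u))"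
  shows "cov f (\<lambda>w. X (f w)) u a = cov (\<lambda>w. w) X (f u) (dder f u a)"
  using dder_eqI[OF has_derivative_compose[OF dder_works[OF assms(1)] dder_works[OF assms(2)]]]
  by (simp add: cov_def)

text \<open>The product rule for the endomorphism \<open>\<nabla>V\<close> applied to a field along a map.\<close>

lemma cov_endomorphism_along:
  assumes "open S" "u \<in> S" "f ` S \<subseteq> U" "f differentiable (at u)"
    and V: "Ck_on 2 U V" and Y: "Y differentiable (at u)"
  shows "cov f (\<lambda>w. cov (\<lambda>w. w) V (f w) (Y w)) u a =
    cov2 V (f u) (dder f u a) (Y u) + cov (\<lambda>w. w) V (f u) (cov f Y u a)"
proof -
  let ?P = "cov (\<lambda>w. w) V"
  have fu: "f u \<in> U" using assms by auto
  have C2_id: "Ck_on 2 U (\<lambda>w. w)"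
    by (auto simp: numeral_2_eq_2)
  have lin: "linear (?P v)" if "v \<in> U" for v
    using that V by (intro linear_cov) (auto intro: Ck_on_differentiable)
  have diff: "(\<lambda>v. ?P v y) differentiable (at (f u))" for y
    using differentiable_cov[OF open_dom fu _ C2_id V] by simp
  have comp: "((\<lambda>w. ?P (f w) y) has_derivative (\<lambda>d. dder (\<lambda>v. ?P v y) (f u) (dder f u d))) (at u)" for y
    using has_derivative_compose[OF dder_works[OF assms(4)] dder_works[OF diff]] .
  have "((\<lambda>w. ?P (f w) (Y w)) has_derivative
      (\<lambda>d. dder (\<lambda>w. ?P (f w) (Y u)) u d + ?P (f u) (dder Y u d))) (at u)"
  proof (rule has_derivative_linear_family[OF assms(1,2)])
    show "linear (?P (f w))" if "w \<in> S" for w using lin that assms(3) by blast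
    show "(\<lambda>w. ?P (f w) y) differentiable (at u)" for y using comp differentiable_def by blast
  qed (rule dder_works[OF Y])
  then have "dder (\<lambda>w. ?P (f w) (Y w)) u a =
      dder (\<lambda>v. ?P v (Y u)) (f u) (dder f u a) + ?P (f u) (dder Y u a)"
    by (simp add: dder_eqI dder_eqI[OF comp])
  then show ?thesis
    using linear_add[OF lin[OF fu], of "dder Y u a"]
    by (simp add: cov2_def cov_def[of f] cov_def[of "\<lambda>w. w" "\<lambda>w. ?P w (Y u)"])
qed

text \<open>
  Differentiating \<open>Hess C = \<phi> g\<close> once more and commuting the derivatives (the Ricci identity for
  \<open>dC\<close>) relates \<open>d\<phi>\<close> to the curvature; on a space of constant curvature \<open>k\<close> this is
  \<open>d\<phi> = - k dC\<close>.
\<close>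

lemma concircular_factor_deriv:
  assumes u: "u \<in> U" and C: "Ck_on 3 U C" and \<phi>: "\<phi> differentiable (at u)"
    and hess: "\<And>w a b. w \<in> U \<Longrightarrow> dder (\<lambda>w. dder C w b) w a - dder C w (\<Gamma> w a b) = \<phi> w * h w a b"
    and R: "\<And>a b w. curv u a b w = k *\<^sub>R (h u b w *\<^sub>R a - h u a w *\<^sub>R b)"
    and ab: "h u a b = 0" "h u a a \<noteq> 0"
  shows "dder \<phi> u b = - k * dder C u b"
proof -
  have C2: "Ck_on 2 U (\<lambda>w. dder C w b)" for b
    using C by (simp add: numeral_3_eq_3 numeral_2_eq_2)
  have C_diff: "C differentiable (at w)" if "w \<in> U" for w
    using C that by (rule_tac Ck_on_differentiable) auto
  note lin = linear_frechet_derivative[OF C_diff]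
  have dC_diff: "(\<lambda>w. dder C w b) differentiable (at w)" if "w \<in> U" for w b
    using C2 that by (rule_tac Ck_on_differentiable) auto
  have third: "dder (\<lambda>w. dder (\<lambda>w. dder C w b) w a) u d =
      (\<phi> u * h u d (\<Gamma> u a b) + dder C u (\<Gamma> u d (\<Gamma> u a b))) + dder C u (dder (\<lambda>w. \<Gamma> w a b) u d)
      + (\<phi> u * (h u (\<Gamma> u d a) b + h u a (\<Gamma> u d b)) + dder \<phi> u d * h u a b)" for a b d
  proof -
    have "dder (\<lambda>w. dder (\<lambda>w. dder C w b) w a) u = dder (\<lambda>w. dder C w (\<Gamma> w a b) + \<phi> w * h w a b) u"
      by (rule dder_cong_open[OF open_dom u]) (use hess in \<open>simp add: algebra_simps\<close>)
    also have "\<dots> = (\<lambda>d. (dder (\<lambda>w. dder C w (\<Gamma> u a b)) u d + dder C u (dder (\<lambda>w. \<Gamma> w a b) u d))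
        + (\<phi> u * dder (\<lambda>w. h w a b) u d + dder \<phi> u d * h u a b))"
      by (intro dder_eqI has_derivative_add has_derivative_linear_family[OF open_dom u lin]
          has_derivative_mult dder_works dC_diff u \<phi> \<Gamma>_differentiable h_differentiable)
    finally show ?thesis
      using hess[OF u, of "\<Gamma> u a b" d] by (simp add: metric[OF u] algebra_simps)
  qed
  have "dder C u (curv u d a b) + dder \<phi> u d * h u a b - dder \<phi> u a * h u d b = 0" for a b d
    using third[of b a d] third[of b d a] dder_commute[OF open_dom u C2[of b], of a d]
    by (simp add: curv_def linear_add[OF lin[OF u]] linear_diff[OF lin[OF u]]
        \<Gamma>_sym[OF u, of d a] h_sym[OF u, of d] algebra_simps)
  from this[of b a a] have "h u a a * (dder \<phi> u b + k * dder C u b) = 0"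
    using ab by (simp add: R h_sym[OF u, of b a] linear_scale[OF lin[OF u]] linear_diff[OF lin[OF u]]
        algebra_simps)
  with ab show ?thesis by simp
qed

end

section \<open>Riemannian hypersurfaces\<close>

text \<open>
  A Riemannian hypersurface in coordinates: \<open>f\<close> is the immersion, \<open>dder f u\<close> its differential, \<open>N\<close> a
  unit normal field and \<open>e = \<plusminus>1\<close> its causal character. The prefixes \<open>M\<close> and \<open>Amb\<close> refer to the
  connection of the hypersurface and of the ambient space.
\<close>

locale hypersurface =
  M: metric_connection U g \<Gamma> + Amb: metric_connection W h \<Gamma>'
  for U :: "'a::euclidean_space set" and g \<Gamma>
    and W :: "'b::euclidean_space set" and h \<Gamma>' +
  fixes f :: "'a \<Rightarrow> 'b" and N :: "'a \<Rightarrow> 'b" and e :: real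
  assumes codim: "DIM('b) = DIM('a) + 1"
    and f_into: "f ` U \<subseteq> W"
    and f_C3: "Ck_on 3 U f" and N_C2: "Ck_on 2 U N"
    and g_pos: "u \<in> U \<Longrightarrow> a \<noteq> 0 \<Longrightarrow> 0 < g u a a"
    and isometric: "u \<in> U \<Longrightarrow> h (f u) (dder f u a) (dder f u b) = g u a b"
    and normal: "u \<in> U \<Longrightarrow> h (f u) (dder f u a) (N u) = 0"
    and unit: "u \<in> U \<Longrightarrow> h (f u) (N u) (N u) = e"
    and e_sq: "e * e = 1"
begin

lemma f_mem: "u \<in> U \<Longrightarrow> f u \<in> W"
  using f_into by auto

lemma f_C2: "Ck_on 2 U f"
  using Ck_on_le[OF f_C3] by simp

lemma df_C2: "Ck_on 2 U (\<lambda>w. dder f w a)"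
  using f_C3 by (simp add: numeral_3_eq_3 numeral_2_eq_2)

lemma differentiable_at_dom:
  assumes "u \<in> U"
  shows "f differentiable (at u)" "N differentiable (at u)" "(\<lambda>w. dder f w a) differentiable (at u)"
  using Ck_on_differentiable[OF f_C3 _ assms] Ck_on_differentiable[OF N_C2 _ assms]
    Ck_on_differentiable[OF df_C2 _ assms] by simp_all

lemma linear_df: "u \<in> U \<Longrightarrow> linear (dder f u)"
  by (intro linear_frechet_derivative differentiable_at_dom)

lemma normal': "u \<in> U \<Longrightarrow> h (f u) (N u) (dder f u a) = 0"
  using normal Amb.h_sym[OF f_mem] by metis

text \<open>
  Tangent space and \<open>N\<close> together span the ambient space by a dimension count, so what remains of
  \<open>z\<close> after removing its normal part is orthogonal to everything.
\<close>

lemma normal_vector: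
  assumes u: "u \<in> U" and orth: "\<And>a. h (f u) z (dder f u a) = 0"
  shows "z = (e * h (f u) z (N u)) *\<^sub>R N u"
proof -
  let ?J = "dder f u"
  define z' where "z' = z - (e * h (f u) z (N u)) *\<^sub>R N u"
  have J0: "a = 0" if "?J a = 0" for a
    using isometric[OF u, of a a] g_pos[OF u, of a] that by (auto simp: Amb.h_simps)
  have "inj ?J"
    using linear_injective_0[OF linear_df[OF u]] J0 by blast
  then have "dim (range ?J) = DIM('a)"
    using dim_image_eq[OF linear_df[OF u], of UNIV] by (simp add: inj_on_subset)
  moreover have "N u \<notin> range ?J"
  proof
    assume "N u \<in> range ?J"
    then obtain a where "N u = ?J a" by auto
    then show False using normal[OF u, of a] unit[OF u] e_sq by simp
  qed
  then have "N u \<notin> span (range ?J)"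
    using linear_subspace_image[OF linear_df[OF u] subspace_UNIV] by (metis span_eq_iff)
  ultimately have "dim (insert (N u) (range ?J)) = DIM('b)"
    by (simp add: dim_insert codim)
  then have span: "span (insert (N u) (range ?J)) = UNIV"
    by (simp only: dim_eq_full)
  have "z' = 0"
  proof (rule Amb.h_nondegenerate[OF f_mem[OF u]])
    fix b
    have "b \<in> span (insert (N u) (range ?J))" using span by simp
    then show "h (f u) z' b = 0"
    proof (rule span_induct)
      show "subspace {b. h (f u) z' b = 0}" by (simp add: subspace_def Amb.h_simps)
      fix x assume "x \<in> insert (N u) (range ?J)"
      then show "h (f u) z' x = 0"
      proof
        assume "x = N u"
        then show ?thesis using e_sq by (simp add: z'_def Amb.h_simps unit[OF u] algebra_simps)
      next
        assume "x \<in> range ?J"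
        then show ?thesis using orth by (auto simp: z'_def Amb.h_simps normal'[OF u])
      qed
    qed
  qed
  then show ?thesis by (simp add: z'_def)
qed

subsection \<open>The Gauss formula\<close>

lemma cov_df_sym:
  assumes u: "u \<in> U"
  shows "Amb.cov f (\<lambda>w. dder f w b) u a = Amb.cov f (\<lambda>w. dder f w a) u b"
  using dder_commute[OF M.open_dom u f_C2, of a b]
  by (simp add: Amb.cov_def Amb.\<Gamma>_sym[OF f_mem[OF u], of "dder f u a"])

text \<open>
  The tangential part of the ambient derivative of the frame is symmetric and metric, so it agrees
  with \<open>\<Gamma>\<close> by the usual uniqueness argument: the difference is a trilinear form that is symmetric in
  one pair of slots and antisymmetric in another.
\<close>

lemma cov_df_tangential:
  assumes u: "u \<in> U"
  shows "h (f u) (Amb.cov f (\<lambda>w. dder f w b) u a) (dder f u c) = g u (\<Gamma> u a b) c"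
proof -
  define q where "q a b c = h (f u) (Amb.cov f (\<lambda>w. dder f w b) u a) (dder f u c) - g u (\<Gamma> u a b) c" for a b c
  have sym: "q a b c = q b a c" for a b c
    using cov_df_sym[OF u, of a b] M.\<Gamma>_sym[OF u, of a b] by (simp add: q_def)
  have antisym: "q a b c = - q a c b" for a b c
  proof -
    have "dder (\<lambda>w. h (f w) (dder f w b) (dder f w c)) u = dder (\<lambda>w. g w b c) u"
      by (rule dder_cong_open[OF M.open_dom u]) (rule isometric)
    moreover have "dder (\<lambda>w. h (f w) (dder f w b) (dder f w c)) u =
       (\<lambda>d. h (f u) (Amb.cov f (\<lambda>w. dder f w b) u d) (dder f u c) +
         h (f u) (dder f u b) (Amb.cov f (\<lambda>w. dder f w c) u d))"
      by (intro dder_eqI Amb.has_derivative_h_along f_mem u differentiable_at_dom)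
    ultimately have "h (f u) (Amb.cov f (\<lambda>w. dder f w b) u a) (dder f u c) +
         h (f u) (dder f u b) (Amb.cov f (\<lambda>w. dder f w c) u a) = g u (\<Gamma> u a b) c + g u b (\<Gamma> u a c)"
      by (metis M.metric[OF u])
    then show ?thesis
      using Amb.h_sym[OF f_mem[OF u], of "dder f u b"] M.h_sym[OF u, of b] by (simp add: q_def)
  qed
  have "q a b c = 0"
    using antisym[of a b c] sym[of a c b] antisym[of c a b] sym[of c b a] antisym[of b c a] sym[of b a c]
    by linarith
  then show ?thesis by (simp add: q_def)
qed

lemma h_cov_df_normal:
  assumes u: "u \<in> U"
  shows "h (f u) (Amb.cov f (\<lambda>w. dder f w b) u a) (N u) = - h (f u) (dder f u b) (Amb.cov f N u a)"
proof -
  have "dder (\<lambda>w. h (f w) (dder f w b) (N w)) u = dder (\<lambda>w. 0) u"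
    by (rule dder_cong_open[OF M.open_dom u]) (rule normal)
  moreover have "dder (\<lambda>w. h (f w) (dder f w b) (N w)) u =
     (\<lambda>d. h (f u) (Amb.cov f (\<lambda>w. dder f w b) u d) (N u) + h (f u) (dder f u b) (Amb.cov f N u d))"
    by (intro dder_eqI Amb.has_derivative_h_along f_mem u differentiable_at_dom)
  ultimately show ?thesis by (simp add: fun_eq_iff eq_neg_iff_add_eq_0)
qed

lemma gauss_formula_const:
  assumes u: "u \<in> U"
  shows "Amb.cov f (\<lambda>w. dder f w b) u a =
    dder f u (\<Gamma> u a b) - (e * h (f u) (dder f u b) (Amb.cov f N u a)) *\<^sub>R N u"
proof -
  have "Amb.cov f (\<lambda>w. dder f w b) u a - dder f u (\<Gamma> u a b) =
    (e * h (f u) (Amb.cov f (\<lambda>w. dder f w b) u a - dder f u (\<Gamma> u a b)) (N u)) *\<^sub>R N u"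
    by (rule normal_vector[OF u]) (simp add: Amb.h_simps cov_df_tangential[OF u] isometric[OF u])
  then show ?thesis
    by (simp add: Amb.h_simps normal[OF u] h_cov_df_normal[OF u] algebra_simps)
qed

lemma has_derivative_df_field:
  assumes u: "u \<in> U" and X: "X differentiable (at u)"
  shows "((\<lambda>w. dder f w (X w)) has_derivative
    (\<lambda>a. dder (\<lambda>w. dder f w (X u)) u a + dder f u (dder X u a))) (at u)"
  by (intro has_derivative_linear_family[OF M.open_dom u linear_df] differentiable_at_dom u dder_works X)

text \<open>
  The normal coefficient is the second fundamental form, expressed through the derivative of \<open>N\<close>.
\<close>

lemma gauss_formula:
  assumes u: "u \<in> U" and X: "X differentiable (at u)"
  shows "Amb.cov f (\<lambda>w. dder f w (X w)) u a =
    dder f u (M.cov (\<lambda>w. w) X u a) - (e * h (f u) (dder f u (X u)) (Amb.cov f N u a)) *\<^sub>R N u"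
  using gauss_formula_const[OF u, of "X u" a]
  by (simp add: Amb.cov_def[of f "\<lambda>w. dder f w (X w)"] Amb.cov_def[of f "\<lambda>w. dder f w (X u)"] M.cov_def
      dder_eqI[OF has_derivative_df_field[OF assms]] linear_add[OF linear_df[OF u]] algebra_simps)

text \<open>
  The left hand side is the Lie derivative of the induced metric along the tangential part \<open>V\<close> of a
  conformal field: besides the conformal factor it sees the shape operator, because the normal part
  \<open>e C N\<close> of the field has tangential derivative \<open>- e C S\<close>.
\<close>

lemma conformal_tangential_part:
  assumes u: "u \<in> U"
    and Y: "Y differentiable (at (f u))"
    and conf: "\<And>a b. h (f u) (Amb.cov (\<lambda>w. w) Y (f u) a) b + h (f u) a (Amb.cov (\<lambda>w. w) Y (f u) b) =
      2 * s * h (f u) a b"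
    and V: "V differentiable (at u)"
    and split: "\<And>w. w \<in> U \<Longrightarrow> Y (f w) = dder f w (V w) + (e * h (f w) (Y (f w)) (N w)) *\<^sub>R N w"
    and S: "\<And>a. Amb.cov f N u a = - dder f u (S a)"
  shows "g u (M.cov (\<lambda>w. w) V u a) b + g u a (M.cov (\<lambda>w. w) V u b) =
    2 * s * g u a b + 2 * e * h (f u) (Y (f u)) (N u) * g u (S a) b"
proof -
  have Yf: "(\<lambda>w. Y (f w)) differentiable (at u)"
    using has_derivative_compose[OF dder_works[OF differentiable_at_dom(1)[OF u]] dder_works[OF Y]]
      differentiable_def by blast
  define C where "C w = e * h (f w) (Y (f w)) (N w)" for w
  have C: "C differentiable (at u)"
    using Amb.has_derivative_h_along[OF f_mem[OF u] differentiable_at_dom(1)[OF u] Yf differentiable_at_dom(2)[OF u]]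
    unfolding C_def using differentiable_def differentiable_mult[OF differentiable_const] by blast
  have CN: "(\<lambda>w. C w *\<^sub>R N w) differentiable (at u)"
    using C differentiable_at_dom(2)[OF u] by simp
  have dfV: "(\<lambda>w. dder f w (V w)) differentiable (at u)"
    using has_derivative_df_field[OF u V] differentiable_def by blast
  have *: "h (f u) (Amb.cov (\<lambda>w. w) Y (f u) (dder f u a)) (dder f u b) =
      g u (M.cov (\<lambda>w. w) V u a) b - C u * g u (S a) b" for a b
  proof -
    have "Amb.cov (\<lambda>w. w) Y (f u) (dder f u a) = Amb.cov f (\<lambda>w. Y (f w)) u a"
      by (rule Amb.cov_compose[OF differentiable_at_dom(1)[OF u] Y, symmetric])
    also have "\<dots> = Amb.cov f (\<lambda>w. dder f w (V w) + C w *\<^sub>R N w) u a"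
      by (rule Amb.cov_cong_open[OF M.open_dom u]) (use split in \<open>simp add: C_def\<close>)
    also have "\<dots> = Amb.cov f (\<lambda>w. dder f w (V w)) u a + Amb.cov f (\<lambda>w. C w *\<^sub>R N w) u a"
      by (rule Amb.cov_add[OF dfV CN])
    finally show ?thesis
      by (simp add: gauss_formula[OF u V] Amb.cov_scaleR[OF C differentiable_at_dom(2)[OF u]]
          Amb.h_simps isometric[OF u] normal'[OF u] S)
  qed
  have "g u (S a) b = g u (S b) a"
    using cov_df_sym[OF u, of a b] h_cov_df_normal[OF u, of a b] h_cov_df_normal[OF u, of b a]
    by (simp add: S Amb.h_simps isometric[OF u] M.h_sym[OF u, of b] M.h_sym[OF u, of a "S b"])
  then show ?thesis
    using conf[of "dder f u a" "dder f u b"] *[of a b] *[of b a] Amb.h_sym[OF f_mem[OF u], of "dder f u a"]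
      M.h_sym[OF u, of a]
    by (simp add: isometric[OF u] C_def algebra_simps)
qed

end

lemma exists_not_in_line:
  fixes d :: "'a::euclidean_space"
  assumes "DIM('a) \<ge> 2"
  obtains a where "a \<notin> span {d}"
proof -
  have "dim (span {d}) \<le> 1" using dim_le_card'[of "{d}"] by simp
  then have "span {d} \<noteq> UNIV"
    using assms dim_UNIV[where 'a = 'a]
    by (metis not_less_eq_eq numeral_2_eq_2 One_nat_def dual_order.trans)
  then show ?thesis using that by auto
qed

subsection \<open>Umbilical hypersurfaces of spaces of constant curvature\<close>

locale umbilical_hypersurface = hypersurface U g \<Gamma> W h \<Gamma>' f N e
  for U :: "'a::euclidean_space set" and g \<Gamma>
    and W :: "'b::euclidean_space set" and h \<Gamma>' f N e +
  fixes H :: "'a \<Rightarrow> real" and c :: real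
  assumes dim_ge_2: "DIM('a) \<ge> 2"
    and umbilical: "u \<in> U \<Longrightarrow> Amb.cov f N u a = - (H u *\<^sub>R dder f u a)"
    and ambient_curv: "u \<in> U \<Longrightarrow> Amb.curv (f u) x y z = c *\<^sub>R (h (f u) y z *\<^sub>R x - h (f u) x z *\<^sub>R y)"
begin

lemma H_differentiable:
  assumes u: "u \<in> U"
  shows "H differentiable (at u)"
proof -
  obtain a :: 'a where a: "a \<noteq> 0" using nonzero_Basis nonempty_Basis by blast
  have "(\<lambda>w. Amb.cov f N w a) differentiable (at u)"
    by (rule Amb.differentiable_cov[OF M.open_dom u f_into f_C2 N_C2])
  from Amb.has_derivative_h_along[OF f_mem[OF u] differentiable_at_dom(1)[OF u] this differentiable_at_dom(3)[OF u]]
  have "(\<lambda>w. h (f w) (Amb.cov f N w a) (dder f w a)) differentiable (at u)"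
    using differentiable_def by blast
  then have "(\<lambda>w. - h (f w) (Amb.cov f N w a) (dder f w a) / g w a a) differentiable (at u)"
    using M.h_differentiable[OF u] g_pos[OF u a] by (intro differentiable_divide differentiable_minus) auto
  then show ?thesis
    by (rule differentiable_cong_open[OF M.open_dom u, rotated])
      (use g_pos[OF _ a] in \<open>force simp: umbilical Amb.h_simps isometric\<close>)
qed

text \<open>
  Codazzi: the ambient curvature maps two tangent vectors and \<open>N\<close> to zero, which forces
  \<open>dH(d) a = dH(a) d\<close>. In dimension at least two there is an \<open>a\<close> independent of \<open>d\<close>.
\<close>

lemma H_deriv_0:
  assumes u: "u \<in> U"
  shows "dder H u = (\<lambda>d. 0)"
proof
  fix d
  show "dder H u d = 0"
  proof (cases "d = 0")
    case True
    then show ?thesis using linear_0[OF linear_frechet_derivative[OF H_differentiable[OF u]]] by simp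
  next
    case False
    obtain a where a: "a \<notin> span {d}" using exists_not_in_line[OF dim_ge_2] .
    have mH: "(\<lambda>w. - H w) differentiable (at u)" "dder (\<lambda>w. - H w) u = (\<lambda>d. - dder H u d)"
      using H_differentiable[OF u] dder_eqI[OF has_derivative_minus[OF dder_works]] by auto
    have cc: "Amb.cov f (\<lambda>w. Amb.cov f N w a) u d = - (H u *\<^sub>R Amb.cov f (\<lambda>w. dder f w a) u d) - dder H u d *\<^sub>R dder f u a" for a d
    proof -
      have "Amb.cov f (\<lambda>w. Amb.cov f N w a) u d = Amb.cov f (\<lambda>w. (- H w) *\<^sub>R dder f w a) u d"
        by (rule Amb.cov_cong_open[OF M.open_dom u]) (simp add: umbilical)
      also have "\<dots> = (- H u) *\<^sub>R Amb.cov f (\<lambda>w. dder f w a) u d + dder (\<lambda>w. - H w) u d *\<^sub>R dder f u a"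
        by (rule Amb.cov_scaleR[OF mH(1) differentiable_at_dom(3)[OF u]])
      finally show ?thesis by (simp add: mH(2))
    qed
    from Amb.curvature_along[OF M.open_dom u f_into f_C2 N_C2, of a d]
    have "dder f u (dder H u a *\<^sub>R d - dder H u d *\<^sub>R a) = 0"
      by (simp add: cc ambient_curv[OF u] normal[OF u] cov_df_sym[OF u, of d a]
          linear_diff[OF linear_df[OF u]] linear_scale[OF linear_df[OF u]] algebra_simps)
    then have "g u (dder H u a *\<^sub>R d - dder H u d *\<^sub>R a) (dder H u a *\<^sub>R d - dder H u d *\<^sub>R a) = 0"
      by (simp add: isometric[OF u, symmetric] Amb.h_simps)
    then have eq: "dder H u d *\<^sub>R a = dder H u a *\<^sub>R d"
      using g_pos[OF u, of "dder H u a *\<^sub>R d - dder H u d *\<^sub>R a"] by fastforce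
    show ?thesis
    proof (rule ccontr)
      assume nz: "dder H u d \<noteq> 0"
      then have "a = inverse (dder H u d) *\<^sub>R (dder H u d *\<^sub>R a)" by simp
      also have "\<dots> = (inverse (dder H u d) * dder H u a) *\<^sub>R d" unfolding eq by simp
      finally show False using a by (metis span_base span_scale insertI1)
    qed
  qed
qed

lemma gauss_formula_umbilical:
  assumes u: "u \<in> U"
  shows "Amb.cov f (\<lambda>w. dder f w b) u a = dder f u (\<Gamma> u a b) + (e * H u * g u a b) *\<^sub>R N u"
  by (simp add: gauss_formula_const[OF u] umbilical[OF u] Amb.h_simps isometric[OF u] M.h_sym[OF u, of b a])

text \<open>
  Differentiating the Gauss formula of an umbilical hypersurface once more and antisymmetrizing; only
  tangential components matter, so the derivative of the normal coefficient drops out.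
\<close>

lemma gauss_equation:
  assumes u: "u \<in> U"
  shows "M.curv u d a b = (c + e * (H u)\<^sup>2) *\<^sub>R (g u a b *\<^sub>R d - g u d b *\<^sub>R a)"
proof (rule M.h_eqI[OF u])
  fix z
  have \<Gamma>ab: "(\<lambda>w. \<Gamma> w a b) differentiable (at u)" for a b by (rule M.\<Gamma>_differentiable[OF u])
  have coeff: "((\<lambda>w. e * H w * g w a b) has_derivative (\<lambda>d. e * H u * dder (\<lambda>w. g w a b) u d + e * dder H u d * g u a b)) (at u)" for a b
    by (intro has_derivative_mult has_derivative_mult_right dder_works H_differentiable u M.h_differentiable)
  then have coeff_diff: "(\<lambda>w. e * H w * g w a b) differentiable (at u)" for a b
    using differentiable_def by blast
  have df\<Gamma>: "(\<lambda>w. dder f w (\<Gamma> w a b)) differentiable (at u)" for a b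
    using has_derivative_df_field[OF u \<Gamma>ab] differentiable_def by blast
  have coeff_N: "(\<lambda>w. (e * H w * g w a b) *\<^sub>R N w) differentiable (at u)" for a b
    using has_derivative_scaleR[OF coeff dder_works[OF differentiable_at_dom(2)[OF u]]] differentiable_def by blast
  have key: "h (f u) (Amb.cov f (\<lambda>w. Amb.cov f (\<lambda>w. dder f w b) w a) u d) (dder f u z) =
     g u (M.cov (\<lambda>w. w) (\<lambda>w. \<Gamma> w a b) u d) z - e * (H u)\<^sup>2 * g u a b * g u d z" for a d
  proof -
    have "Amb.cov f (\<lambda>w. Amb.cov f (\<lambda>w. dder f w b) w a) u d =
       Amb.cov f (\<lambda>w. dder f w (\<Gamma> w a b) + (e * H w * g w a b) *\<^sub>R N w) u d"
      by (rule Amb.cov_cong_open[OF M.open_dom u]) (rule gauss_formula_umbilical)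
    also have "\<dots> = Amb.cov f (\<lambda>w. dder f w (\<Gamma> w a b)) u d + Amb.cov f (\<lambda>w. (e * H w * g w a b) *\<^sub>R N w) u d"
      by (rule Amb.cov_add[OF df\<Gamma> coeff_N])
    finally show ?thesis
      by (simp add: gauss_formula[OF u \<Gamma>ab] Amb.cov_scaleR[OF coeff_diff differentiable_at_dom(2)[OF u]]
          Amb.h_simps isometric[OF u] normal'[OF u] umbilical[OF u] power2_eq_square)
  qed
  have C2_id: "Ck_on 2 U (\<lambda>w. w)"
    by (auto simp: numeral_2_eq_2)
  have M: "M.cov (\<lambda>w. w) (\<lambda>w. \<Gamma> w a b) u d - M.cov (\<lambda>w. w) (\<lambda>w. \<Gamma> w d b) u a = M.curv u d a b"
    using M.curvature_along[OF M.open_dom u _ C2_id Ck_on_const, of b a d] by (simp add: M.cov_const)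
  have "h (f u) (Amb.cov f (\<lambda>w. Amb.cov f (\<lambda>w. dder f w b) w a) u d) (dder f u z) -
      h (f u) (Amb.cov f (\<lambda>w. Amb.cov f (\<lambda>w. dder f w b) w d) u a) (dder f u z) =
      h (f u) (Amb.curv (f u) (dder f u d) (dder f u a) (dder f u b)) (dder f u z)"
    using Amb.curvature_along[OF M.open_dom u f_into f_C2 df_C2, of b a d] by (simp add: Amb.h_simps[symmetric])
  then have "g u (M.curv u d a b) z = c * (g u a b * g u d z - g u d b * g u a z)
      + e * (H u)\<^sup>2 * g u a b * g u d z - e * (H u)\<^sup>2 * g u d b * g u a z"
    unfolding key ambient_curv[OF u] M[symmetric]
    by (simp add: Amb.h_simps M.h_simps isometric[OF u])
  then show "g u (M.curv u d a b) z = g u ((c + e * (H u)\<^sup>2) *\<^sub>R (g u a b *\<^sub>R d - g u d b *\<^sub>R a)) z"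
    by (simp add: M.h_simps algebra_simps)
qed

subsection \<open>The angle function of a conformal field\<close>

text \<open>
  The gradient of \<open>C = h(Y, N)\<close> consists of a term in \<open>\<nabla>Y\<close> and a multiple of the tangential part of
  \<open>Y\<close>. In the Hessian, the first derivatives of \<open>Y\<close> that survive enter symmetrized, so the
  conformal equation turns them into \<open>s\<close>, and the normal component of \<open>\<nabla>\<^sup>2Y\<close> on tangent vectors is a multiple of the metric because
  the ambient curvature is constant. So the Hessian is pointwise proportional to \<open>g\<close>.
\<close>

lemma hessian_angle:
  assumes u: "u \<in> U" and Y: "Ck_on 2 W Y" and s: "\<And>v. v \<in> W \<Longrightarrow> s differentiable (at v)"
    and conf: "\<And>v a b. v \<in> W \<Longrightarrow>
      h v (Amb.cov (\<lambda>w. w) Y v a) b + h v a (Amb.cov (\<lambda>w. w) Y v b) = 2 * s v * h v a b"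
    and C: "\<And>w. w \<in> U \<Longrightarrow> C w = h (f w) (Y (f w)) (N w)"
  shows "dder (\<lambda>w. dder C w b) u a - dder C u (\<Gamma> u a b) =
    - (dder s (f u) (N u) + c * C u + H u * s (f u) + e * (H u)\<^sup>2 * C u) * g u a b"
proof -
  let ?P = "Amb.cov (\<lambda>w. w) Y"
  have Y_diff: "Y differentiable (at v)" if "v \<in> W" for v
    using Y that by (rule_tac Ck_on_differentiable) auto
  have Yf: "(\<lambda>w. Y (f w)) differentiable (at w)" if "w \<in> U" for w
    using has_derivative_compose[OF dder_works[OF differentiable_at_dom(1)[OF that]] dder_works[OF Y_diff[OF f_mem[OF that]]]]
      differentiable_def by blast
  have dC: "dder C w b = h (f w) (?P (f w) (dder f w b)) (N w) - H w * h (f w) (Y (f w)) (dder f w b)" if w: "w \<in> U" for w b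
  proof -
    have "dder C w = dder (\<lambda>w. h (f w) (Y (f w)) (N w)) w"
      by (rule dder_cong_open[OF M.open_dom w]) (rule C)
    also have "\<dots> = (\<lambda>d. h (f w) (Amb.cov f (\<lambda>w. Y (f w)) w d) (N w) + h (f w) (Y (f w)) (Amb.cov f N w d))"
      by (intro dder_eqI Amb.has_derivative_h_along f_mem w differentiable_at_dom Yf)
    finally show ?thesis
      by (simp add: umbilical[OF w] Amb.h_simps Amb.cov_compose[OF differentiable_at_dom(1)[OF w] Y_diff[OF f_mem[OF w]]])
  qed
  have P_lin: "linear (?P (f u))"
    by (intro Amb.linear_cov Y_diff f_mem u) simp
  have C2_id: "Ck_on 2 W (\<lambda>w. w)"
    by (auto simp: numeral_2_eq_2)
  have PJ: "(\<lambda>w. ?P (f w) (dder f w b)) differentiable (at u)"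
  proof -
    have lin: "linear (?P (f w))" if "w \<in> U" for w
      using that by (intro Amb.linear_cov Y_diff f_mem) auto
    have "(\<lambda>v. ?P v y) differentiable (at (f u))" for y
      using Amb.differentiable_cov[OF Amb.open_dom f_mem[OF u] _ C2_id Y] by simp
    then have "(\<lambda>w. ?P (f w) y) differentiable (at u)" for y
      using has_derivative_compose[OF dder_works[OF differentiable_at_dom(1)[OF u]] dder_works, of "\<lambda>v. ?P v y"]
        differentiable_def by blast
    from has_derivative_linear_family[OF M.open_dom u lin this dder_works[OF differentiable_at_dom(3)[OF u]]]
    show ?thesis using differentiable_def by blast
  qed
  have "dder (\<lambda>w. dder C w b) u = dder (\<lambda>w. h (f w) (?P (f w) (dder f w b)) (N w) - H w * h (f w) (Y (f w)) (dder f w b)) u"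
    by (rule dder_cong_open[OF M.open_dom u]) (rule dC)
  also have "\<dots> = (\<lambda>d. (h (f u) (Amb.cov f (\<lambda>w. ?P (f w) (dder f w b)) u d) (N u) +
         h (f u) (?P (f u) (dder f u b)) (Amb.cov f N u d)) -
      (H u * (h (f u) (Amb.cov f (\<lambda>w. Y (f w)) u d) (dder f u b) +
         h (f u) (Y (f u)) (Amb.cov f (\<lambda>w. dder f w b) u d)) + dder H u d * h (f u) (Y (f u)) (dder f u b)))"
    by (intro dder_eqI has_derivative_diff has_derivative_mult Amb.has_derivative_h_along f_mem u
        differentiable_at_dom Yf PJ dder_works H_differentiable)
  finally have second: "dder (\<lambda>w. dder C w b) u a =
      h (f u) (Amb.cov2 Y (f u) (dder f u a) (dder f u b)) (N u)
      + h (f u) (?P (f u) (dder f u (\<Gamma> u a b))) (N u)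
      + e * H u * g u a b * h (f u) (?P (f u) (N u)) (N u)
      - H u * h (f u) (?P (f u) (dder f u b)) (dder f u a)
      - H u * h (f u) (?P (f u) (dder f u a)) (dder f u b)
      - H u * h (f u) (Y (f u)) (dder f u (\<Gamma> u a b)) - e * (H u)\<^sup>2 * g u a b * C u"
    by (simp add: Amb.cov_endomorphism_along[OF M.open_dom u f_into differentiable_at_dom(1)[OF u] Y differentiable_at_dom(3)[OF u]]
        gauss_formula_umbilical[OF u] umbilical[OF u] H_deriv_0[OF u] Amb.h_simps C[OF u] linear_add[OF P_lin] linear_scale[OF P_lin]
        Amb.cov_compose[OF differentiable_at_dom(1)[OF u] Y_diff[OF f_mem[OF u]]] power2_eq_square algebra_simps)
  have first: "dder C u (\<Gamma> u a b) = h (f u) (?P (f u) (dder f u (\<Gamma> u a b))) (N u) - H u * h (f u) (Y (f u)) (dder f u (\<Gamma> u a b))"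
    by (rule dC[OF u])
  have PN: "h (f u) (?P (f u) (N u)) (N u) = s (f u) * e"
    using conf[OF f_mem[OF u], of "N u" "N u"] Amb.h_sym[OF f_mem[OF u], of "N u" "?P (f u) (N u)"] by (simp add: unit[OF u])
  have PJ_sym: "h (f u) (?P (f u) (dder f u b)) (dder f u a) + h (f u) (?P (f u) (dder f u a)) (dder f u b) = 2 * s (f u) * g u a b"
    using conf[OF f_mem[OF u], of "dder f u a" "dder f u b"] Amb.h_sym[OF f_mem[OF u], of "dder f u a" "?P (f u) (dder f u b)"]
    by (simp add: isometric[OF u])
  have Q: "h (f u) (Amb.cov2 Y (f u) (dder f u a) (dder f u b)) (N u) = - dder s (f u) (N u) * g u a b - c * C u * g u a b"
    using Amb.cov2_conformal[OF f_mem[OF u] Y s[OF f_mem[OF u]] conf ambient_curv[OF u], of "dder f u a" "dder f u b" "N u"]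
    by (simp add: normal[OF u] isometric[OF u] C[OF u])
  have eNN: "e * H u * g u a b * (s (f u) * e) = H u * g u a b * s (f u)"
  proof -
    have "e * H u * g u a b * (s (f u) * e) = (e * e) * (H u * g u a b * s (f u))" by algebra
    then show ?thesis by (simp only: e_sq mult_1)
  qed
  have "dder (\<lambda>w. dder C w b) u a - dder C u (\<Gamma> u a b) =
      h (f u) (Amb.cov2 Y (f u) (dder f u a) (dder f u b)) (N u)
      + e * H u * g u a b * h (f u) (?P (f u) (N u)) (N u)
      - H u * (h (f u) (?P (f u) (dder f u b)) (dder f u a) + h (f u) (?P (f u) (dder f u a)) (dder f u b))
      - e * (H u)\<^sup>2 * g u a b * C u"
    unfolding second first by (simp add: algebra_simps)
  then show ?thesis
    unfolding Q PN PJ_sym eNN by (simp add: algebra_simps)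
qed

text \<open>
  By the Gauss equation the hypersurface has constant curvature \<open>c + e H\<^sup>2\<close>, so the Ricci identity
  integrates the factor \<open>\<phi>\<close> in \<open>Hess C = \<phi> g\<close>.
\<close>

lemma hessian_factor_affine:
  assumes u: "u \<in> U" and C: "Ck_on 3 U C"
    and hess: "\<And>w a b. w \<in> U \<Longrightarrow> dder (\<lambda>w. dder C w b) w a - dder C w (\<Gamma> w a b) = \<phi> w * g w a b"
  shows "((\<lambda>w. \<phi> w + (c + e * (H w)\<^sup>2) * C w) has_derivative (\<lambda>d. 0)) (at u)"
proof -
  have C2: "Ck_on 2 U (\<lambda>w. dder C w b)" for b
    using C by (simp add: numeral_3_eq_3 numeral_2_eq_2)
  have C_diff: "C differentiable (at w)" if "w \<in> U" for w
    using C that by (rule_tac Ck_on_differentiable) auto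
  have dC_diff: "(\<lambda>w. dder C w b) differentiable (at u)" for b
    by (rule Ck_on_differentiable[OF C2 _ u]) simp
  have ddC_diff: "(\<lambda>w. dder (\<lambda>w. dder C w b) w a) differentiable (at u)" for a b
    using C2[of b] u by (simp add: numeral_2_eq_2)
  obtain a0 :: 'a where a0: "a0 \<noteq> 0" using nonzero_Basis nonempty_Basis by blast
  have "(\<lambda>w. dder C w (\<Gamma> w a0 a0)) differentiable (at u)"
    using has_derivative_linear_family[OF M.open_dom u linear_frechet_derivative[OF C_diff] dC_diff
        dder_works[OF M.\<Gamma>_differentiable[OF u]]] differentiable_def by blast
  then have "(\<lambda>w. (dder (\<lambda>w. dder C w a0) w a0 - dder C w (\<Gamma> w a0 a0)) / g w a0 a0) differentiable (at u)"
    using M.h_differentiable[OF u] g_pos[OF u a0] ddC_diff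
    by (intro differentiable_divide differentiable_diff) auto
  then have \<phi>: "\<phi> differentiable (at u)"
    by (rule differentiable_cong_open[OF M.open_dom u, rotated])
      (use g_pos[OF _ a0] in \<open>force simp: hess\<close>)
  have R: "M.curv u a b w = (c + e * (H u)\<^sup>2) *\<^sub>R (g u b w *\<^sub>R a - g u a w *\<^sub>R b)" for a b w
    by (rule gauss_equation[OF u])
  have eq: "dder \<phi> u d + (c + e * (H u)\<^sup>2) * dder C u d = 0" for d
  proof (cases "d = 0")
    case True
    then show ?thesis
      using linear_0[OF linear_frechet_derivative[OF \<phi>]] linear_0[OF linear_frechet_derivative[OF C_diff[OF u]]]
      by simp
  next
    case False
    obtain a' where a': "a' \<notin> span {d}" using exists_not_in_line[OF dim_ge_2] .
    \<comment> \<open>the component of \<open>a'\<close> orthogonal to \<open>d\<close>\<close>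
    define a where "a = a' - (g u a' d / g u d d) *\<^sub>R d"
    have "(g u a' d / g u d d) *\<^sub>R d \<in> span {d}" by (intro span_scale span_base) simp
    then have "a \<noteq> 0" using a' by (auto simp: a_def)
    then have "g u a a \<noteq> 0" using g_pos[OF u] by fastforce
    moreover have "g u a d = 0" using g_pos[OF u False] by (simp add: a_def M.h_simps)
    ultimately have "dder \<phi> u d = - (c + e * (H u)\<^sup>2) * dder C u d"
      by (intro M.concircular_factor_deriv[OF u C \<phi> hess R])
    then show ?thesis by (simp add: algebra_simps)
  qed
  have "((\<lambda>w. H w * H w) has_derivative (\<lambda>d. 0)) (at u)"
    using has_derivative_mult[OF dder_works dder_works, OF H_differentiable H_differentiable, OF u u]
    by (simp add: H_deriv_0[OF u])
  from has_derivative_mult[OF has_derivative_add[OF has_derivative_const has_derivative_mult_right[OF this]] dder_works[OF C_diff[OF u]], of c e]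
  have "((\<lambda>w. (c + e * (H w)\<^sup>2) * C w) has_derivative (\<lambda>d. (c + e * (H u)\<^sup>2) * dder C u d)) (at u)"
    by (simp add: power2_eq_square)
  from has_derivative_add[OF dder_works[OF \<phi>] this] show ?thesis by (simp add: eq)
qed

end

section \<open>Tensor calculus in a chart\<close>

lemma linear_axis_eqI:
  fixes L L' :: "real ^ 'n \<Rightarrow> 'b::real_vector"
  assumes "linear L" "linear L'" "\<And>i. L (axis i 1) = L' (axis i 1)"
  shows "L v = L' v"
proof -
  have "L b = L' b" if "b \<in> Basis" for b
    using that assms(3) by (auto simp: Basis_vec_def)
  then show ?thesis using linear_eq_stdbasis[OF assms(1,2)] by metis
qed

lemma linear_vec_nth_sum: "linear L \<Longrightarrow> L v = (\<Sum>i\<in>UNIV. v $ i *\<^sub>R L (axis i 1))"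
  for L :: "real ^ 'n \<Rightarrow> 'b::real_vector"
  by (rule linear_axis_eqI)
    (auto intro!: linearI simp: sum.distrib scaleR_add_left scaleR_sum_right axis_def if_distrib[of "\<lambda>t. t *\<^sub>R _"] cong: if_cong)

subsection \<open>Inverse matrices\<close>

lemma differentiable_det:
  fixes M :: "'a::real_normed_vector \<Rightarrow> real ^ 'n ^ 'n"
  assumes "\<And>i j. (\<lambda>u. M u $ i $ j) differentiable (at u)"
  shows "(\<lambda>u. det (M u)) differentiable (at u)"
proof -
  have "((\<lambda>u. det (M u)) has_derivative
    (\<lambda>d. \<Sum>p | p permutes UNIV. of_int (sign p) *
      (\<Sum>i\<in>UNIV. dder (\<lambda>u. M u $ i $ p i) u d * (\<Prod>j\<in>UNIV - {i}. M u $ j $ p j)))) (at u)"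
    unfolding det_def
    by (intro has_derivative_sum has_derivative_mult_right has_derivative_prod dder_works assms)
  then show ?thesis using differentiable_def by blast
qed

lemma matrix_inv_right:
  assumes "invertible M"
  shows "M ** matrix_inv M = mat 1"
  using assms by (auto simp: matrix_inv_def invertible_def intro: someI2_ex)

text \<open>
  By Cramer's rule the entries of the inverse are quotients of determinants. This makes the
  Christoffel symbols, which involve the inverse metric, differentiable.
\<close>

lemma differentiable_matrix_inv:
  fixes M :: "'a::real_normed_vector \<Rightarrow> real ^ 'n ^ 'n"
  assumes "open S" "u \<in> S" and inv: "\<And>w. w \<in> S \<Longrightarrow> invertible (M w)"
    and diff: "\<And>i j. (\<lambda>w. M w $ i $ j) differentiable (at u)"
  shows "(\<lambda>w. matrix_inv (M w) $ k $ l) differentiable (at u)"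
proof (rule differentiable_cong_open[OF assms(1,2)])
  fix w assume "w \<in> S"
  note i = inv[OF this]
  have "M w *v (matrix_inv (M w) *v axis l 1) = axis l 1"
    by (simp add: matrix_vector_mul_assoc matrix_inv_right[OF i])
  moreover have "det (M w) \<noteq> 0" using i invertible_det_nz by blast
  ultimately have "matrix_inv (M w) *v axis l 1 =
      (\<chi> k. det (\<chi> i j. if j = k then axis l 1 $ i else M w $ i $ j) / det (M w))"
    using cramer by blast
  from arg_cong[OF this, of "\<lambda>v. v $ k"]
  show "det (\<chi> i j. if j = k then axis l 1 $ i else M w $ i $ j) / det (M w) = matrix_inv (M w) $ k $ l"
    by (simp add: matrix_vector_mult_basis column_def)
next
  have "(\<lambda>w. (\<chi> i j. if j = k then axis l 1 $ i else M w $ i $ j) $ i $ j) differentiable (at u)" for i j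
    using diff[of i j] by (cases "j = k") simp_all
  then have "(\<lambda>w. det (\<chi> i j. if j = k then axis l 1 $ i else M w $ i $ j)) differentiable (at u)"
    by (rule differentiable_det)
  moreover have "det (M u) \<noteq> 0" using inv[OF assms(2)] invertible_det_nz by blast
  ultimately show "(\<lambda>w. det (\<chi> i j. if j = k then axis l 1 $ i else M w $ i $ j) / det (M w)) differentiable (at u)"
    using differentiable_det[OF diff] by (intro differentiable_divide)
qed

subsection \<open>Charts\<close>

lemma cinv_cmap: "is_chart x \<Longrightarrow> p \<in> cdom x \<Longrightarrow> cinv x (cmap x p) = p"
  by (auto simp: is_chart_def homeomorphism_def)

lemma cmap_cinv: "is_chart x \<Longrightarrow> u \<in> cmap x ` cdom x \<Longrightarrow> cmap x (cinv x u) = u"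
  by (auto simp: is_chart_def homeomorphism_def)

lemma cinv_in_cdom: "is_chart x \<Longrightarrow> u \<in> cmap x ` cdom x \<Longrightarrow> cinv x u \<in> cdom x"
  by (auto simp: is_chart_def homeomorphism_def)

lemma open_chart_image:
  assumes "is_chart x" "open T"
  shows "open (cmap x ` (cdom x \<inter> T))"
proof -
  have "cmap x ` (cdom x \<inter> T) = cmap x ` cdom x \<inter> cinv x -` T"
    using cinv_cmap[OF assms(1)] by force
  moreover have "open (cmap x ` cdom x \<inter> cinv x -` T)"
    using assms by (intro continuous_open_preimage) (auto simp: is_chart_def homeomorphism_def)
  ultimately show ?thesis by simp
qed

lemma atlas_chart: "smooth_atlas A \<Longrightarrow> x \<in> A \<Longrightarrow> is_chart x"
  by (auto simp: smooth_atlas_def)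

lemma pd_conv_dder: "pd x i k p = dder (\<lambda>u. k (cinv x u)) (cmap x p) (axis i 1)"
  by (simp add: pd_def cderiv_def o_def)

lemma cderiv_conv_dder: "cderiv x k p = dder (\<lambda>u. k (cinv x u)) (cmap x p)"
  by (auto simp: cderiv_def o_def)

lemma smooth_in_Ck_on: "smooth_in x U k \<Longrightarrow> Ck_on n (cmap x ` (cdom x \<inter> U)) (\<lambda>u. k (cinv x u))"
  by (simp add: smooth_in_def smooth_on_def o_def)

lemma bilinear_ip: "bilinear (ip g x p)"
  unfolding bilinear_def ip_def
  by (auto intro!: linearI simp: sum.distrib distrib_left distrib_right sum_distrib_left mult_ac)

lemma bilinear_christoffel_form: "bilinear (christoffel_form g x p)"
  unfolding bilinear_def christoffel_form_def
  by (auto intro!: linearI simp: vec_eq_iff sum.distrib distrib_left distrib_right sum_distrib_left mult_ac)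

lemma ip_axis: "ip g x p (axis i 1) (axis j 1) = g x p $ i $ j"
  by (simp add: ip_def axis_def if_distrib[of "\<lambda>t. t * _"] if_distrib[of "\<lambda>t. _ * t"] cong: if_cong)

lemma ip_axis_right: "ip g x p v (axis j 1) = (\<Sum>i\<in>UNIV. g x p $ i $ j * v $ i)"
  by (simp add: ip_def axis_def if_distrib[of "\<lambda>t. _ * t"] cong: if_cong)

lemma ip_axis_left: "ip g x p (axis i 1) w = (\<Sum>j\<in>UNIV. g x p $ i $ j * w $ j)"
  by (simp add: ip_def axis_def if_distrib[of "\<lambda>t. _ * t"] if_distrib[of "\<lambda>t. t * _"] sum.swap[of _ UNIV UNIV] cong: if_cong)

lemma christoffel_form_axis: "christoffel_form g x p (axis i 1) (axis j 1) = (\<chi> k. christoffel g x p k i j)"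
  by (simp add: christoffel_form_def vec_eq_iff axis_def if_distrib[of "\<lambda>t. t * _"] if_distrib[of "\<lambda>t. _ * t"] cong: if_cong)

lemma bilinear_axis_eqI:
  fixes T T' :: "real ^ 'n \<Rightarrow> real ^ 'm \<Rightarrow> 'b::real_vector"
  assumes "bilinear T" "bilinear T'" "\<And>i j. T (axis i 1) (axis j 1) = T' (axis i 1) (axis j 1)"
  shows "T v w = T' v w"
proof (rule linear_axis_eqI[where L = "\<lambda>v. T v w"])
  show "T (axis i 1) w = T' (axis i 1) w" for i
    by (rule linear_axis_eqI) (use assms in \<open>auto simp: bilinear_def\<close>)
qed (use assms in \<open>auto simp: bilinear_def\<close>)

subsection \<open>A semi-Riemannian metric in a chart\<close>

text \<open>
  The link between component tensors and the coordinate-free calculus: in one fixed chart, curvature,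
  Lie derivative and Hessian are compared on coordinate vectors, where both sides reduce to the
  same expression in the components.
\<close>

locale metric_chart =
  fixes A :: "('m::topological_space, 'n::finite) chart set" and g :: "('m, 'n) tensor2"
    and x :: "('m, 'n) chart"
  assumes atlas: "smooth_atlas A" and metric: "semi_riemannian_metric A g" and x: "x \<in> A"
begin

abbreviation "D \<equiv> cmap x ` cdom x"
abbreviation "h u \<equiv> ip g x (cinv x u)"
abbreviation "\<Gamma> u \<equiv> christoffel_form g x (cinv x u)"

lemma chart: "is_chart x" by (rule atlas_chart[OF atlas x])

lemma open_D: "open D" using chart by (simp add: is_chart_def)

lemma g_sym: "p \<in> cdom x \<Longrightarrow> g x p $ i $ j = g x p $ j $ i"
  using metric x by (auto simp: semi_riemannian_metric_def symmetric_tensor2_def)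

lemma g_Ck: "Ck_on n D (\<lambda>u. g x (cinv x u) $ i $ j)"
proof -
  have "Ck_on n D (\<lambda>u. g x (cinv x u))"
    using metric x smooth_in_Ck_on[of x UNIV "g x" n]
    by (auto simp: semi_riemannian_metric_def tensor2_field_def)
  then show ?thesis
    by (intro Ck_on_bounded_linear[OF open_D, where L = "\<lambda>v. v $ j"]
        Ck_on_bounded_linear[OF open_D, where L = "\<lambda>v. v $ i"] bounded_linear_vec_nth)
qed

lemma g_differentiable: "u \<in> D \<Longrightarrow> (\<lambda>u. g x (cinv x u) $ i $ j) differentiable (at u)"
  using Ck_on_differentiable[OF g_Ck[of 1]] by simp

lemma h_Ck: "Ck_on n D (\<lambda>u. h u a b)"
  unfolding ip_def by (intro Ck_on_sum Ck_on_mult g_Ck Ck_on_const open_D)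

lemma nondegenerate: "p \<in> cdom x \<Longrightarrow> (\<And>w. ip g x p v w = 0) \<Longrightarrow> v = 0"
  using metric x unfolding semi_riemannian_metric_def by blast

lemma g_invertible:
  assumes "p \<in> cdom x"
  shows "invertible (g x p)"
proof -
  have "v = 0" if "g x p *v v = 0" for v
  proof (rule nondegenerate[OF assms])
    fix w
    have "ip g x p v w = (\<Sum>j\<in>UNIV. (g x p *v v) $ j * w $ j)"
      unfolding ip_def matrix_vector_mult_def
      by (subst sum.swap) (simp add: g_sym[OF assms] sum_distrib_right)
    then show "ip g x p v w = 0" using that by simp
  qed
  then show ?thesis by (simp add: invertible_left_inverse matrix_left_invertible_ker)
qed

lemma christoffel_differentiable:
  assumes u: "u \<in> D"
  shows "(\<lambda>u. christoffel g x (cinv x u) k i j) differentiable (at u)"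
proof -
  have pd_diff: "(\<lambda>u. pd x i (\<lambda>q. g x q $ j $ l) (cinv x u)) differentiable (at u)" for i j l
  proof (rule differentiable_cong_open[OF open_D u])
    show "dder (\<lambda>u. g x (cinv x u) $ j $ l) w (axis i 1) = pd x i (\<lambda>q. g x q $ j $ l) (cinv x w)"
      if "w \<in> D" for w using cmap_cinv[OF chart that] by (simp add: pd_conv_dder)
    show "(\<lambda>w. dder (\<lambda>u. g x (cinv x u) $ j $ l) w (axis i 1)) differentiable (at u)"
      by (rule Ck_on_differentiable[OF Ck_on_dder[OF g_Ck[of "Suc 1"]] _ u]) simp
  qed
  have "(\<lambda>u. matrix_inv (g x (cinv x u)) $ k $ l) differentiable (at u)" for l
    by (rule differentiable_matrix_inv[OF open_D u])
      (auto intro: g_invertible g_differentiable[OF u] cinv_in_cdom[OF chart])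
  then have "((\<lambda>u. christoffel g x (cinv x u) k i j) has_derivative (\<lambda>d. 1 / 2 * (\<Sum>l\<in>UNIV.
      matrix_inv (g x (cinv x u)) $ k $ l * (dder (\<lambda>u. pd x i (\<lambda>q. g x q $ j $ l) (cinv x u)) u d +
        dder (\<lambda>u. pd x j (\<lambda>q. g x q $ i $ l) (cinv x u)) u d -
        dder (\<lambda>u. pd x l (\<lambda>q. g x q $ i $ j) (cinv x u)) u d) +
      dder (\<lambda>u. matrix_inv (g x (cinv x u)) $ k $ l) u d * (pd x i (\<lambda>q. g x q $ j $ l) (cinv x u) +
        pd x j (\<lambda>q. g x q $ i $ l) (cinv x u) - pd x l (\<lambda>q. g x q $ i $ j) (cinv x u))))) (at u)"
    unfolding christoffel_def
    by (intro has_derivative_mult_right has_derivative_sum has_derivative_mult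
        has_derivative_diff has_derivative_add dder_works pd_diff)
  then show ?thesis using differentiable_def by blast
qed

lemma \<Gamma>_differentiable:
  assumes u: "u \<in> D"
  shows "(\<lambda>u. \<Gamma> u a b) differentiable (at u)"
proof -
  have "\<Gamma> u a b = (\<Sum>k\<in>UNIV. (\<Sum>i\<in>UNIV. \<Sum>j\<in>UNIV. christoffel g x (cinv x u) k i j * a $ i * b $ j) *\<^sub>R axis k 1)" for u
    by (simp add: christoffel_form_def vec_eq_iff axis_def if_distrib[of "\<lambda>t. _ * t"] cong: if_cong)
  moreover have "((\<lambda>u. \<Sum>k\<in>UNIV. (\<Sum>i\<in>UNIV. \<Sum>j\<in>UNIV. christoffel g x (cinv x u) k i j * a $ i * b $ j) *\<^sub>R (axis k 1 :: real ^ 'n))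
      has_derivative (\<lambda>d. \<Sum>k\<in>UNIV. (\<Sum>i\<in>UNIV. \<Sum>j\<in>UNIV. dder (\<lambda>u. christoffel g x (cinv x u) k i j) u d * a $ i * b $ j) *\<^sub>R axis k 1)) (at u)"
    by (intro has_derivative_sum has_derivative_scaleR_left has_derivative_mult_left
        dder_works christoffel_differentiable u)
  ultimately show ?thesis unfolding differentiable_def by auto
qed

lemma christoffel_properties:
  assumes "p \<in> cdom x"
  shows "christoffel g x p k i j = christoffel g x p k j i"
    and "pd x k (\<lambda>q. g x q $ i $ j) p =
       (\<Sum>l\<in>UNIV. christoffel g x p l k i * g x p $ l $ j) + (\<Sum>l\<in>UNIV. christoffel g x p l k j * g x p $ i $ l)"
  using christoffel_levi_civita[OF atlas metric x assms, of "christoffel g x p"] by blast+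

lemma \<Gamma>_sym:
  assumes u: "u \<in> D"
  shows "\<Gamma> u a b = \<Gamma> u b a"
proof (rule bilinear_axis_eqI[where T' = "\<lambda>a b. \<Gamma> u b a"])
  show "bilinear (\<Gamma> u)" by (rule bilinear_christoffel_form)
  then show "bilinear (\<lambda>a b. \<Gamma> u b a)" by (simp add: bilinear_def)
  show "\<Gamma> u (axis i 1) (axis j 1) = \<Gamma> u (axis j 1) (axis i 1)" for i j
    using christoffel_properties(1)[OF cinv_in_cdom[OF chart u]] by (simp add: christoffel_form_axis)
qed

text \<open>
  On coordinate vectors this is the characterization of the Christoffel symbols as the torsion-free
  metric connection; both sides are linear in all three arguments.
\<close>

lemma compatible:
  assumes u: "u \<in> D"
  shows "dder (\<lambda>u. h u b c) u a = h u (\<Gamma> u a b) c + h u b (\<Gamma> u a c)"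
proof -
  note bi = bilinear_ip[of g x "cinv x u"] and bc = bilinear_christoffel_form[of g x "cinv x u"]
  note simps = bilinear_ladd[OF bi] bilinear_radd[OF bi] bilinear_lmul[OF bi] bilinear_rmul[OF bi]
    bilinear_ladd[OF bc] bilinear_radd[OF bc] bilinear_lmul[OF bc] bilinear_rmul[OF bc]
  have diff: "(\<lambda>u. h u b c) differentiable (at u)" for b c
    using Ck_on_differentiable[OF h_Ck[of 1] _ u] by simp
  have ip_simps: "ip g x q (v + v') w = ip g x q v w + ip g x q v' w" "ip g x q w (v + v') = ip g x q w v + ip g x q w v'"
    "ip g x q (r *\<^sub>R v) w = r *\<^sub>R ip g x q v w" "ip g x q w (r *\<^sub>R v) = r *\<^sub>R ip g x q w v" for q v v' w r
    using bilinear_ip[of g x q] by (rule bilinear_ladd bilinear_radd bilinear_lmul bilinear_rmul)+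
  have add: "dder (\<lambda>v. h v a w + h v a' w') u = (\<lambda>d. dder (\<lambda>v. h v a w) u d + dder (\<lambda>v. h v a' w') u d)" for a a' w w'
    by (rule dder_eqI[OF has_derivative_add[OF dder_works[OF diff] dder_works[OF diff]]])
  have scale: "dder (\<lambda>v. r *\<^sub>R h v a w) u = (\<lambda>d. r *\<^sub>R dder (\<lambda>v. h v a w) u d)" for a r w
    by (rule dder_eqI[OF has_derivative_scaleR_right[OF dder_works[OF diff]]])
  have lin_b: "linear (\<lambda>b. dder (\<lambda>u. h u b c) u a)" for a c
    by (rule linearI) (simp_all only: ip_simps add scale)
  have lin_c: "linear (\<lambda>c. dder (\<lambda>u. h u b c) u a)" for a b
    by (rule linearI) (simp_all only: ip_simps add scale)
  have axes: "dder (\<lambda>u. h u (axis i 1) (axis j 1)) u (axis k 1) =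
      h u (\<Gamma> u (axis k 1) (axis i 1)) (axis j 1) + h u (axis i 1) (\<Gamma> u (axis k 1) (axis j 1))" for i j k
  proof -
    have "dder (\<lambda>u. h u (axis i 1) (axis j 1)) u (axis k 1) = pd x k (\<lambda>q. g x q $ i $ j) (cinv x u)"
      by (simp only: ip_axis pd_conv_dder cmap_cinv[OF chart u])
    also have "\<dots> = (\<Sum>l\<in>UNIV. christoffel g x (cinv x u) l k i * g x (cinv x u) $ l $ j) +
        (\<Sum>l\<in>UNIV. christoffel g x (cinv x u) l k j * g x (cinv x u) $ i $ l)"
      by (rule christoffel_properties(2)[OF cinv_in_cdom[OF chart u]])
    finally show ?thesis
      by (simp add: ip_axis_left ip_axis_right christoffel_form_axis mult.commute)
  qed
  have lin: "linear (\<lambda>a. h u (\<Gamma> u a b) c + h u b (\<Gamma> u a c))"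
    "linear (\<lambda>b. h u (\<Gamma> u a b) c + h u b (\<Gamma> u a c))"
    "linear (\<lambda>c. h u (\<Gamma> u a b) c + h u b (\<Gamma> u a c))" for a b c
    by (rule linearI; simp add: simps algebra_simps)+
  have "dder (\<lambda>u. h u (axis i 1) (axis j 1)) u a =
      h u (\<Gamma> u a (axis i 1)) (axis j 1) + h u (axis i 1) (\<Gamma> u a (axis j 1))" for i j
    by (rule linear_axis_eqI[OF linear_frechet_derivative[OF diff] lin(1) axes])
  then have "dder (\<lambda>u. h u b (axis j 1)) u a = h u (\<Gamma> u a b) (axis j 1) + h u b (\<Gamma> u a (axis j 1))" for j
    by (rule linear_axis_eqI[OF lin_b lin(2)])
  then show ?thesis by (rule linear_axis_eqI[OF lin_c lin(3)])
qed

lemma h_sym: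
  assumes u: "u \<in> D"
  shows "h u a b = h u b a"
proof (rule bilinear_axis_eqI[where T' = "\<lambda>a b. h u b a"])
  show "bilinear (h u)" by (rule bilinear_ip)
  then show "bilinear (\<lambda>a b. h u b a)" by (simp add: bilinear_def)
  show "h u (axis i 1) (axis j 1) = h u (axis j 1) (axis i 1)" for i j
    using g_sym[OF cinv_in_cdom[OF chart u]] by (simp add: ip_axis)
qed

lemma metric_connection_subset:
  assumes "open U" "U \<subseteq> D"
  shows "metric_connection U h \<Gamma>"
proof
  show "Ck_on 2 U (\<lambda>u. h u a b)" for a b by (rule Ck_on_subset[OF h_Ck assms(2)])
  show "a = 0" if "u \<in> U" "\<And>b. h u a b = 0" for u a
    using nondegenerate[OF cinv_in_cdom[OF chart]] that assms(2) by blast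
qed (use assms h_sym \<Gamma>_sym \<Gamma>_differentiable compatible in \<open>auto intro: bilinear_ip bilinear_christoffel_form\<close>)

sublocale metric_connection D h \<Gamma>
  by (rule metric_connection_subset[OF open_D order_refl])

lemma curvature_conv_curv:
  assumes p: "p \<in> cdom x"
  shows "curvature g x p a b w = curv (cmap x p) a b w"
proof -
  let ?u = "cmap x p"
  have u: "?u \<in> D" and cu: "cinv x ?u = p" using p cinv_cmap[OF chart p] by auto
  have lin: "linear (\<lambda>a. curvature g x p a b w)" "linear (\<lambda>b. curvature g x p a b w)" "linear (\<lambda>w. curvature g x p a b w)" for a b w
    unfolding curvature_def
    by (auto intro!: linearI simp: vec_eq_iff sum.distrib distrib_left distrib_right sum_distrib_left mult_ac)
  have axes: "curvature g x p (axis i 1) (axis j 1) (axis k 1) = curv ?u (axis i 1) (axis j 1) (axis k 1)" for i j k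
  proof -
    have comp: "dder (\<lambda>v. \<Gamma> v (axis j 1) (axis k 1)) ?u a $ l = dder (\<lambda>v. christoffel g x (cinv x v) l j k) ?u a" for j k l a
    proof -
      have "((\<lambda>v. \<Gamma> v (axis j 1) (axis k 1) $ l) has_derivative (\<lambda>a. dder (\<lambda>v. \<Gamma> v (axis j 1) (axis k 1)) ?u a $ l)) (at ?u)"
        by (rule bounded_linear.has_derivative[OF bounded_linear_vec_nth dder_works[OF \<Gamma>_differentiable[OF u]]])
      from dder_eqI[OF this] show ?thesis by (simp add: christoffel_form_axis)
    qed
    have "curvature g x p (axis i 1) (axis j 1) (axis k 1) $ l = riemann g x p l k i j" for l
      by (simp add: curvature_def axis_def if_distrib[of "\<lambda>t. t * _"] if_distrib[of "\<lambda>t. _ * t"] cong: if_cong)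
    moreover have "christoffel_form g x p (axis i 1) v $ l = (\<Sum>m\<in>UNIV. christoffel g x p l i m * v $ m)" for i v l
      by (simp add: christoffel_form_def axis_def if_distrib[of "\<lambda>t. t * _"] if_distrib[of "\<lambda>t. _ * t"] sum.swap[of _ UNIV UNIV] cong: if_cong)
    ultimately show ?thesis
      by (simp add: vec_eq_iff curv_def comp[unfolded christoffel_form_axis] riemann_def pd_conv_dder cu christoffel_form_axis sum_subtractf)
  qed
  have "curvature g x p a (axis j 1) (axis k 1) = curv ?u a (axis j 1) (axis k 1)" for j k
    by (rule linear_axis_eqI[OF lin(1) curv_linear(1)[OF u] axes])
  then have "curvature g x p a b (axis k 1) = curv ?u a b (axis k 1)" for k
    by (rule linear_axis_eqI[OF lin(2) curv_linear(2)[OF u]])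
  then show ?thesis by (rule linear_axis_eqI[OF lin(3) curv_linear(3)[OF u]])
qed

lemma lie_derivative_axis:
  assumes p: "p \<in> cdom x" and V: "(\<lambda>u. V x (cinv x u)) differentiable (at (cmap x p))"
  shows "lie_derivative V g x p $ i $ j =
    ip g x p (cov (\<lambda>w. w) (\<lambda>u. V x (cinv x u)) (cmap x p) (axis i 1)) (axis j 1) +
    ip g x p (axis i 1) (cov (\<lambda>w. w) (\<lambda>u. V x (cinv x u)) (cmap x p) (axis j 1))"
proof -
  let ?u = "cmap x p" and ?V = "\<lambda>u. V x (cinv x u)"
  have u: "?u \<in> D" and cu: "cinv x ?u = p" using p cinv_cmap[OF chart p] by auto
  have comp: "dder (\<lambda>u. V x (cinv x u) $ k) ?u a = dder ?V ?u a $ k" for k a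
    using dder_eqI[OF bounded_linear.has_derivative[OF bounded_linear_vec_nth dder_works[OF V]]] by metis
  have "lie_derivative V g x p $ i $ j =
      (\<Sum>k\<in>UNIV. V x p $ k *\<^sub>R dder (\<lambda>u. h u (axis i 1) (axis j 1)) ?u (axis k 1)) +
      ip g x p (dder ?V ?u (axis i 1)) (axis j 1) + ip g x p (axis i 1) (dder ?V ?u (axis j 1))"
    by (simp add: lie_derivative_def pd_conv_dder comp ip_axis sum.distrib
        ip_axis_right[of g x p "dder ?V ?u (axis i 1)"] ip_axis_left[of g x p i "dder ?V ?u (axis j 1)"])
  also have "(\<Sum>k\<in>UNIV. V x p $ k *\<^sub>R dder (\<lambda>u. h u (axis i 1) (axis j 1)) ?u (axis k 1)) =
      dder (\<lambda>u. h u (axis i 1) (axis j 1)) ?u (V x p)"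
    by (rule linear_vec_nth_sum[symmetric]) (intro linear_frechet_derivative h_differentiable u)
  also have "\<dots> = ip g x p (christoffel_form g x p (axis i 1) (V x p)) (axis j 1) +
      ip g x p (axis i 1) (christoffel_form g x p (axis j 1) (V x p))"
    using compatible[OF u, of "axis i 1" "axis j 1" "V x p"] \<Gamma>_sym[OF u] by (simp add: cu)
  finally show ?thesis
    using h_simps(1,2)[of ?u] by (simp add: cov_def cu)
qed

lemma hessian_axis:
  assumes p: "p \<in> cdom x" and C: "(\<lambda>u. C (cinv x u)) differentiable (at (cmap x p))"
  shows "hessian g C x p $ i $ j =
    dder (\<lambda>w. dder (\<lambda>u. C (cinv x u)) w (axis j 1)) (cmap x p) (axis i 1) -
    dder (\<lambda>u. C (cinv x u)) (cmap x p) (christoffel_form g x p (axis i 1) (axis j 1))"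
proof -
  let ?u = "cmap x p" and ?C = "\<lambda>u. C (cinv x u)"
  have u: "?u \<in> D" using p by auto
  have "dder (\<lambda>w. dder ?C (cmap x (cinv x w)) (axis j 1)) ?u = dder (\<lambda>w. dder ?C w (axis j 1)) ?u"
    by (rule dder_cong_open[OF open_D u]) (simp add: cmap_cinv[OF chart])
  moreover have "dder ?C ?u (christoffel_form g x p (axis i 1) (axis j 1)) =
      (\<Sum>k\<in>UNIV. christoffel g x p k i j *\<^sub>R dder ?C ?u (axis k 1))"
    by (subst linear_vec_nth_sum[OF linear_frechet_derivative[OF C]]) (simp add: christoffel_form_axis)
  ultimately show ?thesis by (simp add: hessian_def pd_conv_dder)
qed

end

lemma riemannian_imp_semi_riemannian:
  fixes A :: "('m, 'n::finite) chart set"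
  assumes "riemannian_metric A g"
  shows "semi_riemannian_metric A g"
proof -
  have pos: "ip g x p v v > 0" if "x \<in> A" "p \<in> cdom x" "v \<noteq> 0" for x p v
    using assms that by (auto simp: riemannian_metric_def)
  have "metric_index g x p = 0" if "x \<in> A" "p \<in> cdom x" for x p
  proof -
    have "{dim W |W. subspace W \<and> (\<forall>v\<in>W. v \<noteq> 0 \<longrightarrow> ip g x p v v < 0)} = {0}" (is "?L = _")
    proof
      show "?L \<subseteq> {0}"
      proof
        fix n assume "n \<in> ?L"
        then obtain W where W: "n = dim W" "\<forall>v\<in>W. v \<noteq> 0 \<longrightarrow> ip g x p v v < 0" by blast
        then have "W \<subseteq> {0}" using pos[OF that] by fastforce
        then show "n \<in> {0}" using W(1) by simp
      qed
      have "0 = dim {0 :: real ^ 'n} \<and> subspace {0 :: real ^ 'n} \<and> (\<forall>v\<in>{0}. v \<noteq> 0 \<longrightarrow> ip g x p v v < 0)"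
        by simp
      then show "{0} \<subseteq> ?L" by blast
    qed
    then show ?thesis by (simp add: metric_index_def)
  qed
  moreover have "v = 0" if "x \<in> A" "p \<in> cdom x" "\<forall>w. ip g x p v w = 0" for x p v
    using pos[OF that(1,2)] that(3) by fastforce
  ultimately show ?thesis
    using assms by (auto simp: semi_riemannian_metric_def riemannian_metric_def)
qed

section \<open>The hypersurface in charts\<close>

lemma cderiv_chain:
  assumes "smooth_atlas A" "x \<in> A" "x' \<in> A" "p \<in> cdom x" "p \<in> cdom x'"
    and k: "(\<lambda>u. k (cinv x' u)) differentiable (at (cmap x' p))"
  shows "cderiv x k p v = cderiv x' k p (cderiv x (cmap x') p v)"
proof -
  note x = atlas_chart[OF assms(1,2)] and x' = atlas_chart[OF assms(1,3)]
  let ?S = "cmap x ` (cdom x \<inter> cdom x')" and ?u = "cmap x p"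
  have S: "open ?S" "?u \<in> ?S"
    using open_chart_image[OF x, of "cdom x'"] x' assms(4,5) by (auto simp: is_chart_def)
  have "smooth_on ?S (cmap x' \<circ> cinv x)" using assms(1-3) by (auto simp: smooth_atlas_def)
  then have "Ck_on 1 ?S (\<lambda>u. cmap x' (cinv x u))" by (simp only: smooth_on_def o_def)
  then have t: "(\<lambda>u. cmap x' (cinv x u)) differentiable (at ?u)"
    by (rule Ck_on_differentiable) (use S in auto)
  have "((\<lambda>u. k (cinv x' (cmap x' (cinv x u)))) has_derivative
      (\<lambda>v. dder (\<lambda>u. k (cinv x' u)) (cmap x' p) (dder (\<lambda>u. cmap x' (cinv x u)) ?u v))) (at ?u)"
    using has_derivative_compose[OF dder_works[OF t], where g = "\<lambda>u. k (cinv x' u)"]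
      dder_works[OF k] by (simp add: cinv_cmap[OF x assms(4)])
  then have "((\<lambda>u. k (cinv x u)) has_derivative
      (\<lambda>v. dder (\<lambda>u. k (cinv x' u)) (cmap x' p) (dder (\<lambda>u. cmap x' (cinv x u)) ?u v))) (at ?u)"
    by (rule has_derivative_transform_within_open[OF _ S]) (auto simp: cinv_cmap[OF x] cinv_cmap[OF x'])
  from dder_eqI[OF this] show ?thesis by (simp add: cderiv_conv_dder)
qed

text \<open>
  The geometric data of the theorem, collected so that every construction in coordinates below
  extends this locale by a choice of charts.
\<close>

locale conformal_soliton_hypersurface =
  fixes A :: "('m::topological_space, 'n::finite) chart set"
    and g :: "('m, 'n) tensor2"
    and B :: "('q::topological_space, 'k::finite) chart set"
    and gbar :: "('q, 'k) tensor2"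
    and c :: real
    and F :: "'m \<Rightarrow> 'q"
    and \<epsilon> :: real
    and N :: "('m, 'q, 'k) field_along"
    and S :: "('m, 'n) tensor2"
    and Vbar :: "('q, 'k) vfield"
    and V :: "('m, 'n) vfield"
    and \<sigma> :: "'q \<Rightarrow> real"
    and C lam \<mu> :: "'m \<Rightarrow> real"
  assumes dim_ge_2: "CARD('n) \<ge> 2" and codim: "CARD('k) = CARD('n) + 1"
    and atlas_M: "smooth_atlas A" and connected_M: "connected (UNIV :: 'm set)"
    and metric_M: "riemannian_metric A g"
    and atlas_B: "smooth_atlas B"
    and metric_B: "semi_riemannian_metric B gbar"
    and const_curv: "constant_sectional_curvature B gbar c"
    and immersion: "isometric_immersion A g B gbar F"
    and unit_normal: "unit_normal_field A B gbar F \<epsilon> N"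
    and weingarten: "weingarten_operator A B gbar F N S"
    and conformal: "conformal_vector_field B gbar Vbar \<sigma>"
    and angle: "angle_function B gbar F Vbar N C"
    and tangent: "tangent_component A B F \<epsilon> Vbar N C V"
    and soliton: "ricci_almost_soliton A g V lam"
    and dense: "\<exists>D. closure D = UNIV \<and> (\<forall>p\<in>D. \<sigma> (F p) - lam p \<noteq> 0)"
    and ricci: "\<forall>x\<in>A. \<forall>p\<in>cdom x. ricci g x p = \<mu> p *\<^sub>R lower_index g S x p"
begin

lemma chart_M: "x \<in> A \<Longrightarrow> metric_chart A g x"
  by (intro metric_chart.intro atlas_M riemannian_imp_semi_riemannian metric_M)

lemma chart_B: "y \<in> B \<Longrightarrow> metric_chart B gbar y"
  by (intro metric_chart.intro atlas_B metric_B)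

lemma obtain_charts:
  obtains x y where "x \<in> A" "y \<in> B" "p \<in> cdom x" "F p \<in> cdom y"
proof -
  have "p \<in> (\<Union>x\<in>A. cdom x)" "F p \<in> (\<Union>y\<in>B. cdom y)"
    using atlas_M atlas_B by (auto simp: smooth_atlas_def)
  then show ?thesis using that by blast
qed

lemma g_pos: "x \<in> A \<Longrightarrow> p \<in> cdom x \<Longrightarrow> v \<noteq> 0 \<Longrightarrow> 0 < ip g x p v v"
  using metric_M by (auto simp: riemannian_metric_def)

end

text \<open>
  A chart \<open>x\<close> of the hypersurface together with a chart \<open>y\<close> of the ambient space, on the open set
  \<open>U\<close> of coordinates where the immersion can be read in both. All data become functions on \<open>U\<close> or
  on \<open>W\<close>, to which the coordinate-free results on hypersurfaces apply.
\<close>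

locale soliton_charts = conformal_soliton_hypersurface A g B gbar c F \<epsilon> N S Vbar V \<sigma> C lam \<mu>
  for A :: "('m::topological_space, 'n::finite) chart set" and g
    and B :: "('q::topological_space, 'k::finite) chart set" and gbar c F \<epsilon> N S Vbar V \<sigma> C lam \<mu> +
  fixes x y assumes x: "x \<in> A" and y: "y \<in> B"
begin

abbreviation "U \<equiv> cmap x ` (cdom x \<inter> F -` cdom y)"
abbreviation "W \<equiv> cmap y ` cdom y"
abbreviation "f \<equiv> \<lambda>u. cmap y (F (cinv x u))"
abbreviation "N' \<equiv> \<lambda>u. N y (cinv x u)"
abbreviation "g' \<equiv> \<lambda>u. ip g x (cinv x u)"
abbreviation "\<Gamma>' \<equiv> \<lambda>u. christoffel_form g x (cinv x u)"
abbreviation "h' \<equiv> \<lambda>v. ip gbar y (cinv y v)"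
abbreviation "\<Gamma>bar \<equiv> \<lambda>v. christoffel_form gbar y (cinv y v)"
abbreviation "Y' \<equiv> \<lambda>v. Vbar y (cinv y v)"
abbreviation "V' \<equiv> \<lambda>u. V x (cinv x u)"
abbreviation "C' \<equiv> \<lambda>u. C (cinv x u)"

lemma x_chart: "is_chart x" and y_chart: "is_chart y"
  using atlas_chart[OF atlas_M x] atlas_chart[OF atlas_B y] .

lemma U_point:
  assumes "u \<in> U"
  shows "cinv x u \<in> cdom x" "F (cinv x u) \<in> cdom y" "cmap x (cinv x u) = u"
    "cinv y (f u) = F (cinv x u)"
  using assms by (auto simp: cinv_cmap[OF x_chart] cinv_cmap[OF y_chart])

lemma open_U: "open U"
proof -
  have "continuous_on UNIV F" using immersion by (simp add: isometric_immersion_def smooth_map_def)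
  then have "open (F -` cdom y)"
    using y_chart by (intro open_vimage) (auto simp: is_chart_def)
  then show ?thesis by (rule open_chart_image[OF x_chart])
qed

lemma f_Ck: "Ck_on n U f"
  using immersion x y smooth_in_Ck_on[of x "F -` cdom y" "cmap y \<circ> F" n]
  by (simp add: isometric_immersion_def smooth_map_def)

lemma N_Ck: "Ck_on n U N'"
  using unit_normal x y smooth_in_Ck_on[of x "F -` cdom y" "N y" n]
  by (simp add: unit_normal_field_def vector_field_along_def)

lemma cderiv_immersion: "p \<in> cdom x \<Longrightarrow> cderiv x (cmap y \<circ> F) p = dder f (cmap x p)"
  by (simp add: cderiv_conv_dder)

sublocale H: hypersurface U g' \<Gamma>' W h' \<Gamma>bar f N' \<epsilon>
proof (rule hypersurface.intro)
  show "metric_connection U g' \<Gamma>'"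
    by (rule metric_chart.metric_connection_subset[OF chart_M[OF x] open_U]) auto
  show "metric_connection W h' \<Gamma>bar"
    using y_chart by (intro metric_chart.metric_connection_subset[OF chart_B[OF y]]) (auto simp: is_chart_def)
  show "hypersurface_axioms U g' W h' f N' \<epsilon>"
  proof
    show "DIM(real ^ 'k) = DIM(real ^ 'n) + 1" using codim by simp
    show "f ` U \<subseteq> W" by (auto simp: cinv_cmap[OF x_chart])
    show "Ck_on 3 U f" by (rule f_Ck)
    show "Ck_on 2 U N'" by (rule N_Ck)
    fix u a b assume u: "u \<in> U"
    note p = U_point[OF u]
    show "0 < g' u a a" if "a \<noteq> 0" using g_pos[OF x p(1) that] .
    have "ip gbar y (F (cinv x u)) (cderiv x (cmap y \<circ> F) (cinv x u) a) (cderiv x (cmap y \<circ> F) (cinv x u) b) =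
        g' u a b"
      using immersion x y p(1,2) unfolding isometric_immersion_def by blast
    then show "h' (f u) (dder f u a) (dder f u b) = g' u a b"
      by (simp only: cderiv_immersion[OF p(1)] p(3,4))
    have "ip gbar y (F (cinv x u)) (cderiv x (cmap y \<circ> F) (cinv x u) a) (N y (cinv x u)) = 0"
      using unit_normal x y p(1,2) unfolding unit_normal_field_def by blast
    then show "h' (f u) (dder f u a) (N' u) = 0"
      by (simp only: cderiv_immersion[OF p(1)] p(3,4))
    show "h' (f u) (N' u) (N' u) = \<epsilon>"
      using unit_normal y p by (auto simp: unit_normal_field_def)
  next
    show "\<epsilon> * \<epsilon> = 1" using unit_normal by (auto simp: unit_normal_field_def)
  qed
qed

lemma shape_operator:
  assumes u: "u \<in> U"
  shows "H.Amb.cov f N' u a = - dder f u (S x (cinv x u) *v a)"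
proof -
  note p = U_point[OF u]
  have "covariant_derivative_along gbar F x y N (cinv x u) a = - dder f u (S x (cinv x u) *v a)"
    using weingarten x y p cderiv_immersion[OF p(1)] by (auto simp: weingarten_operator_def)
  then show ?thesis
    by (simp add: covariant_derivative_along_def H.Amb.cov_def cderiv_conv_dder p)
qed

lemma Y_Ck: "Ck_on n W Y'"
  using conformal y smooth_in_Ck_on[of y UNIV "Vbar y" n]
  by (simp add: conformal_vector_field_def vector_field_def)

lemma \<sigma>_differentiable: "v \<in> W \<Longrightarrow> (\<lambda>v. \<sigma> (cinv y v)) differentiable (at v)"
  using conformal y smooth_in_Ck_on[of y UNIV \<sigma> 1] Ck_on_differentiable[of 1 W "\<lambda>v. \<sigma> (cinv y v)" v]
  by (simp add: conformal_vector_field_def smooth_fun_def)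

lemma conformal_chart:
  assumes v: "v \<in> W"
  shows "h' v (H.Amb.cov (\<lambda>w. w) Y' v a) b + h' v a (H.Amb.cov (\<lambda>w. w) Y' v b) = 2 * \<sigma> (cinv y v) * h' v a b"
proof -
  have p: "cinv y v \<in> cdom y" "cmap y (cinv y v) = v"
    using v cinv_in_cdom[OF y_chart] cmap_cinv[OF y_chart] by auto
  have Y: "Y' differentiable (at v)" using Ck_on_differentiable[OF Y_Ck[of 1] _ v] by simp
  have lin: "linear (H.Amb.cov (\<lambda>w. w) Y' v)" by (rule H.Amb.linear_cov[OF _ Y]) simp
  show ?thesis
  proof (rule bilinear_axis_eqI[where T' = "\<lambda>a b. 2 * \<sigma> (cinv y v) * h' v a b"])
    show "bilinear (\<lambda>a b. h' v (H.Amb.cov (\<lambda>w. w) Y' v a) b + h' v a (H.Amb.cov (\<lambda>w. w) Y' v b))"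
      unfolding bilinear_def
      by (auto intro!: linearI simp: linear_add[OF lin] linear_scale[OF lin] H.Amb.h_simps algebra_simps)
    show "bilinear (\<lambda>a b. 2 * \<sigma> (cinv y v) * h' v a b)"
      unfolding bilinear_def by (auto intro!: linearI simp: H.Amb.h_simps algebra_simps)
    fix i j
    have "lie_derivative Vbar gbar y (cinv y v) = (2 * \<sigma> (cinv y v)) *\<^sub>R gbar y (cinv y v)"
      using conformal y p by (auto simp: conformal_vector_field_def)
    then have "lie_derivative Vbar gbar y (cinv y v) $ i $ j = 2 * \<sigma> (cinv y v) * gbar y (cinv y v) $ i $ j"
      by simp
    with metric_chart.lie_derivative_axis[OF chart_B[OF y] p(1), of Vbar i j]
    show "h' v (H.Amb.cov (\<lambda>w. w) Y' v (axis i 1)) (axis j 1) + h' v (axis i 1) (H.Amb.cov (\<lambda>w. w) Y' v (axis j 1)) =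
       2 * \<sigma> (cinv y v) * h' v (axis i 1) (axis j 1)"
      using Y p by (simp add: ip_axis)
  qed
qed

lemma angle_chart: "u \<in> U \<Longrightarrow> C' u = h' (f u) (Y' (f u)) (N' u)"
  using angle y U_point by (auto simp: angle_function_def)

text \<open>
  Insert \<open>Ric = \<mu> \<A>\<close> and the formula for the Lie derivative along the tangential part into the
  soliton equation: it becomes \<open>(\<mu> + \<epsilon> C) \<A> = - \<psi> g\<close>.
\<close>

lemma soliton_shape:
  assumes u: "u \<in> U"
  shows "(\<mu> (cinv x u) + \<epsilon> * C' u) * g' u (S x (cinv x u) *v a) b = (lam (cinv x u) - \<sigma> (F (cinv x u))) * g' u a b"
proof -
  let ?p = "cinv x u"
  note p = U_point[OF u]
  have fu: "f u \<in> W" using p by auto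
  have "Ck_on 1 (cmap x ` cdom x) V'"
    using tangent x smooth_in_Ck_on[of x UNIV "V x" 1] by (simp add: tangent_component_def vector_field_def)
  then have V: "V' differentiable (at u)"
    by (rule Ck_on_differentiable) (use u in auto)
  have "Y' (f w) = dder f w (V' w) + (\<epsilon> * h' (f w) (Y' (f w)) (N' w)) *\<^sub>R N' w" if w: "w \<in> U" for w
    using tangent x y U_point[OF w] angle_chart[OF w] cderiv_immersion[OF U_point(1)[OF w]]
    by (auto simp: tangent_component_def)
  note lie = H.conformal_tangential_part[OF u Ck_on_differentiable[OF Y_Ck[of 1] _ fu] conformal_chart[OF fu] V this
      shape_operator[OF u]]
  show ?thesis
  proof (rule bilinear_axis_eqI[where T = "\<lambda>a b. (\<mu> ?p + \<epsilon> * C' u) * g' u (S x ?p *v a) b"])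
    show "bilinear (\<lambda>a b. (\<mu> ?p + \<epsilon> * C' u) * g' u (S x ?p *v a) b)"
      unfolding bilinear_def
      by (auto intro!: linearI simp: matrix_vector_right_distrib matrix_vector_mult_scaleR H.M.h_simps algebra_simps)
    show "bilinear (\<lambda>a b. (lam ?p - \<sigma> (F ?p)) * g' u a b)"
      unfolding bilinear_def by (auto intro!: linearI simp: H.M.h_simps algebra_simps)
    fix i j
    have "ricci g x ?p + (1 / 2) *\<^sub>R lie_derivative V g x ?p = lam ?p *\<^sub>R g x ?p"
      using soliton x p by (auto simp: ricci_almost_soliton_def)
    moreover have "ricci g x ?p = \<mu> ?p *\<^sub>R lower_index g S x ?p"
      using ricci x p by blast
    ultimately have "\<mu> ?p * lower_index g S x ?p $ i $ j + 1 / 2 * lie_derivative V g x ?p $ i $ j = lam ?p * g x ?p $ i $ j"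
      by (simp add: vec_eq_iff)
    moreover have "lie_derivative V g x ?p $ i $ j =
        2 * \<sigma> (F ?p) * g' u (axis i 1) (axis j 1) + 2 * \<epsilon> * C' u * g' u (S x ?p *v axis i 1) (axis j 1)"
      using metric_chart.lie_derivative_axis[OF chart_M[OF x] p(1), of V i j] V lie[of "axis i 1" "axis j 1"]
      by (simp add: p angle_chart[OF u])
    ultimately show "(\<mu> ?p + \<epsilon> * C' u) * g' u (S x ?p *v axis i 1) (axis j 1) =
        (lam ?p - \<sigma> (F ?p)) * g' u (axis i 1) (axis j 1)"
      by (simp add: lower_index_def ip_axis algebra_simps)
  qed
qed

text \<open>
  Where \<open>\<psi> \<noteq> 0\<close> the previous identity makes the shape operator proportional to the metric; this is a
  closed condition, so it persists on the closure.
\<close>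

lemma shape_proportional:
  assumes u: "u \<in> U" and e: "e \<noteq> 0"
  shows "g' u (S x (cinv x u) *v a) b * g' u e e = g' u (S x (cinv x u) *v e) e * g' u a b"
proof -
  \<comment> \<open>By the Weingarten equation the second fundamental form inherits its continuity from \<open>dN\<close>.\<close>
  define \<kappa> where "\<kappa> a b u = h' (f u) (H.Amb.cov f N' u a) (dder f u b)" for a b u
  have \<kappa>: "\<kappa> a b u = - g' u (S x (cinv x u) *v a) b" if "u \<in> U" for a b u
    using that by (simp add: \<kappa>_def shape_operator H.Amb.h_simps H.isometric)
  have \<kappa>_diff: "\<kappa> a b differentiable (at u)" if u: "u \<in> U" for a b u
    using H.Amb.has_derivative_h_along[OF H.f_mem[OF u] H.differentiable_at_dom(1)[OF u]
        H.Amb.differentiable_cov[OF open_U u H.f_into H.f_C2 H.N_C2] H.differentiable_at_dom(3)[OF u]]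
    unfolding \<kappa>_def using differentiable_def by blast
  define \<Delta> where "\<Delta> w = \<kappa> a b w * g' w e e - \<kappa> e e w * g' w a b" for w
  have "\<Delta> differentiable (at w)" if "w \<in> U" for w
    unfolding \<Delta>_def using that \<kappa>_diff H.M.h_differentiable by simp
  then have cont: "continuous_on U \<Delta>"
    by (meson differentiable_imp_continuous_on differentiable_on_def differentiable_at_withinI)
  have "\<Delta> u = 0"
  proof (rule ccontr)
    assume nz: "\<Delta> u \<noteq> 0"
    obtain D where D: "closure D = UNIV" "\<And>p. p \<in> D \<Longrightarrow> \<sigma> (F p) - lam p \<noteq> 0" using dense by blast
    define G where "G = cdom x \<inter> cmap x -` (U \<inter> \<Delta> -` (- {0}))"
    have "open (U \<inter> \<Delta> -` (- {0}))"
      by (rule continuous_open_preimage[OF cont open_U]) auto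
    then have "open G"
      using x_chart unfolding G_def
      by (rule_tac continuous_open_preimage) (auto simp only: is_chart_def homeomorphism_def)
    moreover have "cinv x u \<in> G" using U_point[OF u] u nz by (simp add: G_def)
    ultimately obtain q where q: "q \<in> D" "q \<in> G"
      using D(1) closure_iff_nhds_not_empty[of "cinv x u" D] by blast
    define w where "w = cmap x q"
    have w: "w \<in> U" "\<Delta> w \<noteq> 0" and qw: "cinv x w = q"
      using q(2) by (auto simp: G_def w_def cinv_cmap[OF x_chart])
    define m where "m = \<mu> q + \<epsilon> * C q"
    have eq: "m * g' w (S x q *v a) b = (lam q - \<sigma> (F q)) * g' w a b" for a b
      using soliton_shape[OF w(1), of a b] by (simp add: m_def qw)
    \<comment> \<open>if \<open>m\<close> vanished, so would \<open>\<psi>(q) g(e,e)\<close>\<close>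
    have "m \<noteq> 0"
      using eq[of e e] D(2)[OF q(1)] H.g_pos[OF w(1) e] by auto
    moreover have "m * \<Delta> w = - (m * g' w (S x q *v a) b) * g' w e e + (m * g' w (S x q *v e) e) * g' w a b"
      by (simp add: \<Delta>_def \<kappa>[OF w(1)] qw algebra_simps)
    then have "m * \<Delta> w = 0" unfolding eq by simp
    ultimately show False using w(2) by simp
  qed
  then show ?thesis by (simp add: \<Delta>_def \<kappa>[OF u])
qed

lemma shape_scalar:
  assumes u: "u \<in> U"
  shows "\<exists>r. \<forall>a. S x (cinv x u) *v a = r *\<^sub>R a"
proof -
  obtain e :: "real ^ 'n" where e: "e \<noteq> 0" using nonzero_Basis nonempty_Basis by blast
  define r where "r = g' u (S x (cinv x u) *v e) e / g' u e e"
  have "S x (cinv x u) *v a = r *\<^sub>R a" for a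
  proof (rule H.M.h_eqI[OF u])
    fix b
    show "g' u (S x (cinv x u) *v a) b = g' u (r *\<^sub>R a) b"
      using shape_proportional[OF u e, of a b] H.g_pos[OF u e] by (simp add: r_def H.M.h_simps field_simps)
  qed
  then show ?thesis by blast
qed

lemma C_Ck: "Ck_on n U C'"
proof (rule Ck_on_cong[OF open_U])
  have comp: "Ck_on n U (\<lambda>u. k (cinv y (f u)) :: real)" if "Ck_on n W (\<lambda>v. k (cinv y v))" for k
    by (rule Ck_on_compose[OF open_U that f_Ck H.f_into])
  show "Ck_on n U (\<lambda>u. h' (f u) (Y' (f u)) (N' u))"
    unfolding ip_def
  proof (intro Ck_on_sum Ck_on_mult open_U)
    show "Ck_on n U (\<lambda>u. gbar y (cinv y (f u)) $ i $ j)" for i j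
      by (rule comp[OF metric_chart.g_Ck[OF chart_B[OF y]]])
    show "Ck_on n U (\<lambda>u. Vbar y (cinv y (f u)) $ i)" for i
      by (rule comp[OF Ck_on_bounded_linear[OF H.Amb.open_dom bounded_linear_vec_nth Y_Ck]])
    show "Ck_on n U (\<lambda>u. N y (cinv x u) $ j)" for j
      by (rule Ck_on_bounded_linear[OF open_U bounded_linear_vec_nth N_Ck])
  qed
qed (simp add: angle_chart)

text \<open>
  A nonzero tangent vector and the normal span the nondegenerate plane from which the
  polynomial argument for constant curvature starts.
\<close>

lemma ambient_constant_curvature:
  assumes u: "u \<in> U"
  shows "H.Amb.curv (f u) a b w = c *\<^sub>R (h' (f u) b w *\<^sub>R a - h' (f u) a w *\<^sub>R b)"
proof -
  note p = U_point[OF u]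
  obtain e :: "real ^ 'n" where e: "e \<noteq> 0" using nonzero_Basis nonempty_Basis by blast
  show ?thesis
  proof (rule H.Amb.constant_curvature[OF H.f_mem[OF u]])
    fix a b
    assume nz: "h' (f u) a a * h' (f u) b b - (h' (f u) a b)\<^sup>2 \<noteq> 0"
    then have "sectional_curvature gbar y (F (cinv x u)) a b = c"
      using const_curv y p by (auto simp: constant_sectional_curvature_def area2_def)
    moreover have "curvature gbar y (F (cinv x u)) a b b = H.Amb.curv (f u) a b b"
      using metric_chart.curvature_conv_curv[OF chart_B[OF y] p(2)] .
    ultimately show "h' (f u) (H.Amb.curv (f u) a b b) a = c * (h' (f u) a a * h' (f u) b b - (h' (f u) a b)\<^sup>2)"
      using nz by (auto simp: sectional_curvature_def area2_def p field_simps)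
  next
    show "h' (f u) (dder f u e) (dder f u e) * h' (f u) (N' u) (N' u) - (h' (f u) (dder f u e) (N' u))\<^sup>2 \<noteq> 0"
      using H.g_pos[OF u e] H.e_sq by (simp add: H.isometric[OF u] H.unit[OF u] H.normal[OF u]) auto
  qed
qed

end

section \<open>From charts to the manifold\<close>

context conformal_soliton_hypersurface begin

lemma shape_scalar_global:
  assumes "x \<in> A" "p \<in> cdom x"
  shows "\<exists>r. \<forall>a. S x p *v a = r *\<^sub>R a"
proof -
  obtain y where yB: "y \<in> B" "F p \<in> cdom y" using obtain_charts by metis
  interpret soliton_charts A g B gbar c F \<epsilon> N S Vbar V \<sigma> C lam \<mu> x y
    by unfold_locales (fact assms(1), fact yB(1))
  show ?thesis using shape_scalar[of "cmap x p"] assms(2) yB(2) cinv_cmap[OF x_chart] by simp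
qed

text \<open>
  The Weingarten equation determines \<open>S\<close> through the injective differential of the immersion, and
  both sides of that equation transform by the chain rule.
\<close>

lemma shape_scalar_chart_independent:
  assumes "x \<in> A" "p \<in> cdom x" "x' \<in> A" "p \<in> cdom x'"
    and r: "\<And>a. S x p *v a = r *\<^sub>R a" and r': "\<And>a. S x' p *v a = r' *\<^sub>R a"
  shows "r = r'"
proof -
  obtain y where y: "y \<in> B" "F p \<in> cdom y" using obtain_charts by metis
  let ?k = "cmap y \<circ> F" and ?T = "cderiv x (cmap x') p"
  interpret X': soliton_charts A g B gbar c F \<epsilon> N S Vbar V \<sigma> C lam \<mu> x' y
    by unfold_locales (fact assms(3), fact y(1))
  have u': "cmap x' p \<in> X'.U" using assms(4) y(2) by auto
  have chain_k: "cderiv x ?k p v = cderiv x' ?k p (?T v)" for v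
    by (rule cderiv_chain[OF atlas_M assms(1,3,2,4)]) (use X'.H.differentiable_at_dom(1)[OF u'] in \<open>simp add: o_def\<close>)
  have chain_N: "cderiv x (N y) p v = cderiv x' (N y) p (?T v)" for v
    by (rule cderiv_chain[OF atlas_M assms(1,3,2,4)]) (rule X'.H.differentiable_at_dom(2)[OF u'])
  have wein: "covariant_derivative_along gbar F z y N p v = - cderiv z ?k p (S z p *v v)"
    if "z \<in> A" "p \<in> cdom z" for z v
    using weingarten that y by (auto simp: weingarten_operator_def)
  have lin': "linear (cderiv x' ?k p)"
    unfolding X'.cderiv_immersion[OF assms(4)] by (rule X'.H.linear_df[OF u'])
  have inj: "inj (cderiv x ?k p)"
    using immersion assms(1,2) y by (auto simp: isometric_immersion_def)
  obtain e :: "real ^ 'n" where e: "e \<noteq> 0" using nonzero_Basis nonempty_Basis by blast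
  interpret X: soliton_charts A g B gbar c F \<epsilon> N S Vbar V \<sigma> C lam \<mu> x y
    by unfold_locales (fact assms(1), fact y(1))
  have u: "cmap x p \<in> X.U" using assms(2) y(2) by auto
  have lin: "linear (cderiv x ?k p)"
    unfolding X.cderiv_immersion[OF assms(2)] by (rule X.H.linear_df[OF u])
  have "covariant_derivative_along gbar F x y N p e = covariant_derivative_along gbar F x' y N p (?T e)"
    by (simp add: covariant_derivative_along_def chain_k chain_N)
  then have "cderiv x ?k p (r *\<^sub>R e) = cderiv x' ?k p (r' *\<^sub>R ?T e)"
    using wein[OF assms(1,2), of e] wein[OF assms(3,4), of "?T e"] by (simp add: r r')
  also have "\<dots> = cderiv x ?k p (r' *\<^sub>R e)"
    by (simp only: linear_scale[OF lin'] linear_scale[OF lin] chain_k[symmetric])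
  finally have "r *\<^sub>R e = r' *\<^sub>R e" using inj by (simp add: inj_eq)
  then show ?thesis using e by simp
qed

text \<open>
  The scalar \<open>H\<close> with \<open>\<A> = H g\<close>, which does not depend on the chart used to find it.
\<close>

definition mean_curvature :: "'m \<Rightarrow> real" where
  "mean_curvature p = (SOME r. \<exists>x\<in>A. p \<in> cdom x \<and> (\<forall>a. S x p *v a = r *\<^sub>R a))"

lemma shape_mean_curvature:
  assumes "x \<in> A" "p \<in> cdom x"
  shows "S x p *v a = mean_curvature p *\<^sub>R a"
proof -
  obtain r where r: "\<forall>a. S x p *v a = r *\<^sub>R a" using shape_scalar_global[OF assms] by blast
  then have "\<exists>r. \<exists>x\<in>A. p \<in> cdom x \<and> (\<forall>a. S x p *v a = r *\<^sub>R a)" using assms by blast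
  from someI_ex[OF this] obtain x' where
    "x' \<in> A" "p \<in> cdom x'" "\<forall>a. S x' p *v a = mean_curvature p *\<^sub>R a"
    unfolding mean_curvature_def by blast
  then have "r = mean_curvature p"
    using shape_scalar_chart_independent[OF assms] r by blast
  then show ?thesis using r by blast
qed

lemma constant_of_zero_derivative:
  fixes \<phi> :: "'m \<Rightarrow> real"
  assumes deriv: "\<And>x y u. x \<in> A \<Longrightarrow> y \<in> B \<Longrightarrow> u \<in> cmap x ` (cdom x \<inter> F -` cdom y) \<Longrightarrow>
    ((\<lambda>u. \<phi> (cinv x u)) has_derivative (\<lambda>d. 0)) (at u)"
  shows "\<phi> p = \<phi> q"
proof (rule connected_local_const[OF connected_M UNIV_I UNIV_I], rule ballI)
  fix p
  obtain x y where xy: "x \<in> A" "y \<in> B" "p \<in> cdom x" "F p \<in> cdom y" by (rule obtain_charts)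
  interpret soliton_charts A g B gbar c F \<epsilon> N S Vbar V \<sigma> C lam \<mu> x y
    by unfold_locales (fact xy(1), fact xy(2))
  have "cmap x p \<in> U" using xy by auto
  then obtain r where r: "0 < r" "ball (cmap x p) r \<subseteq> U"
    using open_U openE by blast
  define G where "G = cdom x \<inter> cmap x -` ball (cmap x p) r"
  have "open G"
    using x_chart unfolding G_def
    by (rule_tac continuous_open_preimage) (auto simp: is_chart_def homeomorphism_def)
  moreover have "p \<in> G" using xy(3) r(1) by (simp add: G_def)
  moreover have "\<phi> p = \<phi> q" if "q \<in> G" for q
  proof -
    have "\<phi> (cinv x (cmap x p)) = \<phi> (cinv x (cmap x q))"
    proof (rule has_derivative_zero_unique[OF convex_ball, where f = "\<lambda>u. \<phi> (cinv x u)"])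
      show "((\<lambda>u. \<phi> (cinv x u)) has_derivative (\<lambda>d. 0)) (at u within ball (cmap x p) r)"
        if "u \<in> ball (cmap x p) r" for u
        by (rule has_derivative_at_withinI[OF deriv[OF xy(1,2) subsetD[OF r(2) that]]])
    qed (use that r(1) in \<open>auto simp: G_def\<close>)
    then show ?thesis using xy(3) that by (simp add: G_def cinv_cmap[OF x_chart])
  qed
  ultimately show "eventually (\<lambda>q. \<phi> p = \<phi> q) (at p within UNIV)"
    unfolding eventually_at_topological by (intro exI[of _ G]) simp
qed

end

context soliton_charts begin

abbreviation "H' \<equiv> \<lambda>u. mean_curvature (cinv x u)"

lemma umbilical_chart: "umbilical_hypersurface U g' \<Gamma>' W h' \<Gamma>bar f N' \<epsilon> H' c"
proof (intro umbilical_hypersurface.intro umbilical_hypersurface_axioms.intro H.hypersurface_axioms)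
  show "2 \<le> DIM(real ^ 'n)" using dim_ge_2 by simp
  fix u assume u: "u \<in> U"
  show "H.Amb.cov f N' u a = - (H' u *\<^sub>R dder f u a)" for a
    by (simp add: shape_operator[OF u] shape_mean_curvature[OF x U_point(1)[OF u]] linear_scale[OF H.linear_df[OF u]])
  show "H.Amb.curv (f u) a b w = c *\<^sub>R (h' (f u) b w *\<^sub>R a - h' (f u) a w *\<^sub>R b)" for a b w
    by (rule ambient_constant_curvature[OF u])
qed

end

context conformal_soliton_hypersurface begin

lemma mean_curvature_constant: "mean_curvature p = mean_curvature q"
proof (rule constant_of_zero_derivative)
  fix x y u assume xy: "x \<in> A" "y \<in> B" and u: "u \<in> cmap x ` (cdom x \<inter> F -` cdom y)"
  interpret soliton_charts A g B gbar c F \<epsilon> N S Vbar V \<sigma> C lam \<mu> x y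
    by unfold_locales (fact xy)+
  show "((\<lambda>u. mean_curvature (cinv x u)) has_derivative (\<lambda>d. 0)) (at u)"
    using dder_works[OF umbilical_hypersurface.H_differentiable[OF umbilical_chart u]]
      umbilical_hypersurface.H_deriv_0[OF umbilical_chart u] by simp
qed

text \<open>
  The factor of the Hessian of \<open>C\<close> found in a pair of charts. It mentions the ambient chart \<open>y\<close> only
  in the normal derivative of \<open>\<sigma>\<close>, and no chart of the hypersurface; this is what makes it a
  function on the hypersurface.
\<close>

definition hessian_factor :: "('q, 'k) chart \<Rightarrow> 'm \<Rightarrow> real" where
  "hessian_factor y p = - (dder (\<lambda>v. \<sigma> (cinv y v)) (cmap y (F p)) (N y p) + c * C p +
     mean_curvature p * \<sigma> (F p) + \<epsilon> * (mean_curvature p)\<^sup>2 * C p)"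

end

context soliton_charts begin

lemma hessian_chart:
  assumes u: "u \<in> U"
  shows "dder (\<lambda>w. dder C' w b) u a - dder C' u (\<Gamma>' u a b) = hessian_factor y (cinv x u) * g' u a b"
  using umbilical_hypersurface.hessian_angle[OF umbilical_chart u Y_Ck \<sigma>_differentiable conformal_chart angle_chart]
    U_point[OF u] by (simp add: hessian_factor_def)

lemma hessian_eq:
  assumes p: "p \<in> cdom x" "F p \<in> cdom y"
  shows "hessian g C x p = hessian_factor y p *\<^sub>R g x p"
proof -
  have u: "cmap x p \<in> U" using p by auto
  have "C' differentiable (at (cmap x p))" by (rule Ck_on_differentiable[OF C_Ck[of 1] _ u]) simp
  from metric_chart.hessian_axis[OF chart_M[OF x] p(1) this] hessian_chart[OF u]
  show ?thesis by (simp add: vec_eq_iff ip_axis cinv_cmap[OF x_chart p(1)])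
qed

end

context conformal_soliton_hypersurface begin

text \<open>
  In a fixed chart of the hypersurface the Hessian and the metric are given matrices, and the metric
  does not vanish, so the proportionality factor is the same for all \<open>y\<close>.
\<close>

lemma hessian_factor_unique:
  assumes "y \<in> B" "F p \<in> cdom y" "y' \<in> B" "F p \<in> cdom y'"
  shows "hessian_factor y p = hessian_factor y' p"
proof -
  obtain x where xA: "x \<in> A" "p \<in> cdom x" using obtain_charts by metis
  have "hessian g C x p = hessian_factor z p *\<^sub>R g x p" if "z \<in> B" "F p \<in> cdom z" for z
  proof -
    interpret soliton_charts A g B gbar c F \<epsilon> N S Vbar V \<sigma> C lam \<mu> x z
      by unfold_locales (fact xA(1), fact that(1))
    show ?thesis by (rule hessian_eq[OF xA(2) that(2)])
  qed
  then have "hessian_factor y p *\<^sub>R g x p = hessian_factor y' p *\<^sub>R g x p" using assms by metis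
  moreover have "0 < g x p $ i $ i" for i
    using g_pos[OF xA, of "axis i 1"] by (simp add: ip_axis axis_eq_0_iff)
  then have "g x p \<noteq> 0" by (metis less_irrefl zero_index)
  ultimately show ?thesis by simp
qed

lemma angle_function_concircular: "special_scalar_concircular A g C"
proof -
  define \<Phi> where "\<Phi> p = hessian_factor (SOME y. y \<in> B \<and> F p \<in> cdom y) p" for p
  have \<Phi>: "hessian_factor y p = \<Phi> p" if "y \<in> B" "F p \<in> cdom y" for y p
    unfolding \<Phi>_def using someI[of "\<lambda>y. y \<in> B \<and> F p \<in> cdom y" y] that
    by (intro hessian_factor_unique) auto
  \<comment> \<open>\<open>K\<close> is constant, since \<open>d\<Phi> = - k dC\<close> with \<open>k = c + \<epsilon> H\<^sup>2\<close> the curvature of the hypersurface\<close>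
  define K where "K p = \<Phi> p + (c + \<epsilon> * (mean_curvature p)\<^sup>2) * C p" for p
  have K: "K p = K q" for p q
  proof (rule constant_of_zero_derivative)
    fix x y u assume xy: "x \<in> A" "y \<in> B" and u: "u \<in> cmap x ` (cdom x \<inter> F -` cdom y)"
    interpret soliton_charts A g B gbar c F \<epsilon> N S Vbar V \<sigma> C lam \<mu> x y
      by unfold_locales (fact xy)+
    have "dder (\<lambda>w. dder C' w b) w a - dder C' w (\<Gamma>' w a b) = \<Phi> (cinv x w) * g' w a b" if w: "w \<in> U" for w a b
      using hessian_chart[OF w] \<Phi>[OF xy(2) U_point(2)[OF w]] by simp
    from umbilical_hypersurface.hessian_factor_affine[OF umbilical_chart u C_Ck this]
    show "((\<lambda>u. K (cinv x u)) has_derivative (\<lambda>d. 0)) (at u)" by (simp add: K_def)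
  qed
  define k where "k = c + \<epsilon> * (mean_curvature undefined)\<^sup>2"
  have "\<Phi> p = - k * C p + K undefined" for p
  proof -
    have "K p = \<Phi> p + k * C p"
      by (simp add: K_def k_def mean_curvature_constant[of p undefined])
    with K[of undefined p] show ?thesis by simp
  qed
  moreover have "hessian g C x p = \<Phi> p *\<^sub>R g x p" if xA: "x \<in> A" "p \<in> cdom x" for x p
  proof -
    obtain y where yB: "y \<in> B" "F p \<in> cdom y" using obtain_charts by metis
    interpret soliton_charts A g B gbar c F \<epsilon> N S Vbar V \<sigma> C lam \<mu> x y
      by unfold_locales (fact xA(1), fact yB(1))
    show ?thesis using hessian_eq[OF xA(2) yB(2)] \<Phi>[OF yB] by simp
  qed
  moreover have "smooth_fun A C"
    unfolding smooth_fun_def smooth_in_def smooth_on_def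
  proof (intro ballI allI)
    fix x n assume xA: "x \<in> A"
    show "Ck_on n (cmap x ` (cdom x \<inter> UNIV)) (C \<circ> cinv x)"
    proof (rule Ck_on_locally)
      fix u assume "u \<in> cmap x ` (cdom x \<inter> UNIV)"
      then obtain p where p: "p \<in> cdom x" "u = cmap x p" by auto
      obtain y where yB: "y \<in> B" "F p \<in> cdom y" using obtain_charts by metis
      interpret soliton_charts A g B gbar c F \<epsilon> N S Vbar V \<sigma> C lam \<mu> x y
        by unfold_locales (fact xA, fact yB(1))
      show "\<exists>T. open T \<and> u \<in> T \<and> Ck_on n T (C \<circ> cinv x)"
        using open_U C_Ck[of n] p yB(2) by (intro exI[of _ U]) (auto simp: o_def)
    qed
  qed
  ultimately show ?thesis
    unfolding special_scalar_concircular_def by metis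
qed

end

theorem theorem2:
  fixes A :: "('m::{t2_space, second_countable_topology}, 'n::finite) chart set"
    and g :: "('m, 'n) tensor2"
    and B :: "('q::{t2_space, second_countable_topology}, 'k::finite) chart set"
    and gbar :: "('q, 'k) tensor2"
    and c :: real
    and F :: "'m \<Rightarrow> 'q"
    and \<epsilon> :: real
    and N :: "('m, 'q, 'k) field_along"
    and S :: "('m, 'n) tensor2"
    and Vbar :: "('q, 'k) vfield"
    and V :: "('m, 'n) vfield"
    and \<sigma> :: "'q \<Rightarrow> real"
    and C lam \<mu> :: "'m \<Rightarrow> real"
  assumes "CARD('n) \<ge> 2" and "CARD('k) = CARD('n) + 1"
    and "smooth_atlas A" and "connected (UNIV :: 'm set)"
    and "riemannian_metric A g" and "complete_metric A g"
    and "smooth_atlas B"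
    and "semi_riemannian_metric B gbar" and "constant_sectional_curvature B gbar c"
    and "isometric_immersion A g B gbar F"
    and "unit_normal_field A B gbar F \<epsilon> N"
    and "weingarten_operator A B gbar F N S"
    and "conformal_vector_field B gbar Vbar \<sigma>"
    and "angle_function B gbar F Vbar N C"
    and "tangent_component A B F \<epsilon> Vbar N C V"
    and "proper_ricci_almost_soliton A g V lam"
    and "\<exists>D. closure D = UNIV \<and> (\<forall>p\<in>D. \<sigma> (F p) - lam p \<noteq> 0)"
    and "smooth_fun A \<mu>"
    and "\<forall>x\<in>A. \<forall>p\<in>cdom x. ricci g x p = \<mu> p *\<^sub>R lower_index g S x p"
  shows "special_scalar_concircular A g C"
proof -
  interpret conformal_soliton_hypersurface A g B gbar c F \<epsilon> N S Vbar V \<sigma> C lam \<mu>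
    using assms by unfold_locales (auto simp: proper_ricci_almost_soliton_def)
  show ?thesis by (rule angle_function_concircular)
qed

end
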